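(* Let $W$ be a Weyl group of type $A_n$ with set of simple reflections $S$ and length function $l$, let $\mathfrak H$ be its Hecke algebra over $K=\mathbf Q(u)$, and let $X=\sum_{x\in W}u^{-l(x)}T_x\in\mathfrak H$. If $E$ is a simple $\mathfrak H$-module, then $\dim_K(XE)=1$; in particular, $E$ contains a canonical line (namely $XE$).
   Context: Let $u$ be an indeterminate. $\mathfrak H$ is the $\mathbf Q(u)$-vector space with basis $\{T_w:w\in W\}$, made into an associative unital $\mathbf Q(u)$-algebra by $T_wT_{w'}=T_{ww'}$ if $l(ww')=l(w)+l(w')$, and $(T_s+1)(T_s-u^2)=0$ for $s\in S$. *)

theory Defs
  imports
    "HOL-Algebra.Sym_Groups"
    "HOL-Computational_Algebra.Polynomial"
    "HOL-Computational_Algebra.Fraction_Field"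
begin

text \<open>The field of rational functions in one indeterminate over the rationals.\<close>

type_synonym ratfun = "rat poly fract"

definition indet_u :: ratfun where
  "indet_u = Fract [:0, 1:] 1"

text \<open>\<open>S\<close> consists of involutions in all uses below, so words in \<open>S\<close> alone
  (without inverses) suffice.\<close>

definition word_length :: "('w, 'm) monoid_scheme \<Rightarrow> 'w set \<Rightarrow> 'w \<Rightarrow> nat" where
  "word_length W S w =
     (LEAST k. \<exists>ss. length ss = k \<and> set ss \<subseteq> S \<and> foldr (\<otimes>\<^bsub>W\<^esub>) ss \<one>\<^bsub>W\<^esub> = w)"

text \<open>The Weyl group of type \<open>A\<^sub>n\<close> is the symmetric group on \<open>{1..n+1}\<close>, its simple reflections
  being the adjacent transpositions; any pair \<open>(W, S)\<close> isomorphic to it is admitted.\<close>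

definition weyl_type_A :: "nat \<Rightarrow> ('w, 'm) monoid_scheme \<Rightarrow> 'w set \<Rightarrow> bool" where
  "weyl_type_A n W S \<longleftrightarrow>
     Group.group W \<and> S \<subseteq> carrier W \<and>
     (\<exists>\<phi> \<in> iso W (sym_group (Suc n)). \<phi> ` S = {transpose i (Suc i) |i. i \<in> {1..n}})"

text \<open>The scalars act on the underlying vector space of the algebra by \<open>scale\<close>.  That \<open>T \<one>\<close> is
  the unit follows from the first multiplication rule, since \<open>T ` carrier W\<close> spans.\<close>

locale hecke_algebra =
  fixes W :: "('w, 'm) monoid_scheme" (structure)
    and S :: "'w set"
    and scale :: "ratfun \<Rightarrow> 'h::ring_1 \<Rightarrow> 'h"
    and T :: "'w \<Rightarrow> 'h"
  assumes vector_space: "vector_space scale"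
    and scale_mult_left: "scale a x * y = scale a (x * y)"
    and scale_mult_right: "x * scale a y = scale a (x * y)"
    and inj_T: "inj_on T (carrier W)"
    and independent_T: "\<not> module.dependent scale (T ` carrier W)"
    and span_T: "module.span scale (T ` carrier W) = UNIV"
    and T_mult: "\<lbrakk>w \<in> carrier W; w' \<in> carrier W;
        word_length W S (w \<otimes> w') = word_length W S w + word_length W S w'\<rbrakk>
      \<Longrightarrow> T w * T w' = T (w \<otimes> w')"
    and T_quadratic: "s \<in> S \<Longrightarrow> (T s + 1) * (T s - scale (indet_u ^ 2) 1) = 0"

definition hecke_X ::
    "('w, 'm) monoid_scheme \<Rightarrow> 'w set \<Rightarrow> (ratfun \<Rightarrow> 'h::ring_1 \<Rightarrow> 'h) \<Rightarrow> ('w \<Rightarrow> 'h) \<Rightarrow> 'h" where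
  "hecke_X W S scale T =
     (\<Sum>x\<in>carrier W. scale (indet_u powi (- int (word_length W S x))) (T x))"

text \<open>The library's \<open>module\<close> locales require a commutative ring of scalars.\<close>

locale left_module =
  fixes act :: "'h::ring_1 \<Rightarrow> 'e::ab_group_add \<Rightarrow> 'e"
  assumes act_add_right: "act x (e + f) = act x e + act x f"
    and act_add_left: "act (x + y) e = act x e + act y e"
    and act_mult: "act (x * y) e = act x (act y e)"
    and act_one: "act 1 e = e"

definition left_submodule :: "('h::ring_1 \<Rightarrow> 'e::ab_group_add \<Rightarrow> 'e) \<Rightarrow> 'e set \<Rightarrow> bool" where
  "left_submodule act N \<longleftrightarrow>
     0 \<in> N \<and> (\<forall>e\<in>N. \<forall>f\<in>N. e + f \<in> N) \<and> (\<forall>x. \<forall>e\<in>N. act x e \<in> N)"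

definition simple_left_module :: "('h::ring_1 \<Rightarrow> 'e::ab_group_add \<Rightarrow> 'e) \<Rightarrow> bool" where
  "simple_left_module act \<longleftrightarrow>
     left_module act \<and> (UNIV :: 'e set) \<noteq> {0} \<and>
     (\<forall>N. left_submodule act N \<longrightarrow> N = {0} \<or> N = UNIV)"

text \<open>The vector space structure that a module inherits from the scalars of the algebra.\<close>

definition module_scale ::
    "('k \<Rightarrow> 'h::ring_1 \<Rightarrow> 'h) \<Rightarrow> ('h \<Rightarrow> 'e::ab_group_add \<Rightarrow> 'e) \<Rightarrow> 'k \<Rightarrow> 'e \<Rightarrow> 'e" where
  "module_scale scale act c e = act (scale c 1) e"

end

(* Write t_x = u^(-l(x)) T_x, so that X is the sum of all t_x.

   The commutator relation r = t_2 t_1 - t_1 t_2 - t_2 + t_1 for adjacent generators satisfies r X = 0.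
   Modulo it, X H X is spanned by the elements X w X with w a product of distinct generators, and
   the order of the factors of w does not matter up to shorter products.  Hence X H X is fixed
   pointwise by the anti-involution t_x -> t_(x^-1), and the operators X h commute on X E.

   Q(u) is ordered with u infinitely large, so the form with orthonormal basis (t_x) is anisotropic
   and the Jucys-Murphy elements act semisimply.  As in the Okounkov-Vershik approach, the weights of
   E include the contents of a Young diagram read along its rows and also read along its columns.
   The corresponding weight elements x and y satisfy t_s x = u x for s inside a row block and
   y t_s = -u^(-1) y for s inside a column block.  There is only one double coset of the two block
   subgroups on which y t_p x can be nonzero, so y H x is a line and y E is one-dimensional, while
   y X x is a nonzero element of this line because one power of u dominates its coefficient.
   So X E is nonzero and some X h y h' has rank one on it; commutativity makes X E a line. *)

theory Submission imports Defs begin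

section \<open>Inversions of permutations\<close>

text \<open>Passing from T_x to t_x makes the setting symmetric: a generator g satisfies g^2 = 1 +
  (u - u^(-1)) g, with eigenvalues u and -u^(-1), and left multiplication by it is self-adjoint for
  the form. The form lives on H and not on E. Hence forbidden weight patterns are excluded by
  elements f of H, namely products of polynomials in the Jucys-Murphy elements that act on a weight
  vector by a nonzero scalar. The roots of these polynomials are powers of u^2, so they lie in K.
  Neither XE nonzero nor dim XE at most 1 can be read off from X alone. Non-vanishing is tested by x
  and y, which must both act nontrivially on the same E; this is why two readings of one diagram are
  required. For the upper bound, commutativity alone would not do: K is not algebraically closed, so
  a commuting family may lack a common eigenvector. The rank one operator built from y supplies
  one.\<close>

definition swp :: "nat \<Rightarrow> nat \<Rightarrow> nat" where
  "swp i = transpose i (Suc i)"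

text \<open>\<open>R\<close> selects the pairs to be counted, so that the length, the inversions
  inside a row block and those with images in one column block obey the same lemmas.\<close>

definition invset :: "nat \<Rightarrow> (nat \<Rightarrow> nat \<Rightarrow> bool) \<Rightarrow> (nat \<Rightarrow> nat) \<Rightarrow> (nat \<times> nat) set" where
  "invset N R p = {(a, b). a \<in> {1..N} \<and> b \<in> {1..N} \<and> a < b \<and> R a b \<and> p b < p a}"

abbreviation invs :: "nat \<Rightarrow> (nat \<Rightarrow> nat) \<Rightarrow> (nat \<times> nat) set" where
  "invs N \<equiv> invset N (\<lambda>_ _. True)"

lemma swp_simps [simp]:
  "swp i i = Suc i" "swp i (Suc i) = i" "j \<noteq> i \<Longrightarrow> j \<noteq> Suc i \<Longrightarrow> swp i j = j"
  "swp i (swp i j) = j"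
  by (auto simp: swp_def transpose_def)

lemma swp_comp [simp]: "swp i \<circ> swp i = id" "swp i \<circ> (swp i \<circ> p) = p" "p \<circ> swp i \<circ> swp i = p"
  by (auto simp: fun_eq_iff)

lemma swp_permutes: "1 \<le> i \<Longrightarrow> i < N \<Longrightarrow> swp i permutes {1..N}"
  unfolding swp_def by (rule permutes_swap_id) auto

lemma inv_swp [simp]: "inv' (swp i) = swp i"
  by (simp add: inv_equality)

lemma swp_less_iff: "(a, b) \<noteq> (i, Suc i) \<Longrightarrow> (a, b) \<noteq> (Suc i, i) \<Longrightarrow> swp i a < swp i b \<longleftrightarrow> a < b"
  by (auto simp: swp_def transpose_def)

lemma finite_invset [simp]: "finite (invset N R p)"
  by (rule finite_subset[of _ "{1..N} \<times> {1..N}"]) (auto simp: invset_def)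

text \<open>Applying \<open>swp i\<close> to both entries preserves the order of every pair except
  the descent itself, so the remaining inversions correspond bijectively. \<open>R'\<close> is
  \<open>R\<close> carried along; for column inversions it depends on the permutation and really
  changes.\<close>

lemma invset_comp_swp:
  assumes "p permutes {1..N}" "1 \<le> i" "i < N" "p (Suc i) < p i"
    and R: "\<And>a b. R' a b = R (swp i a) (swp i b)"
  shows "card (invset N R p) = card (invset N R' (p \<circ> swp i)) + (if R i (Suc i) then 1 else 0)"
proof -
  let ?f = "map_prod (swp i) (swp i)"
  have inS: "swp i a \<in> {1..N} \<longleftrightarrow> a \<in> {1..N}" for a
    using permutes_in_image[OF swp_permutes[OF assms(2,3)], of a] .
  have "inj ?f"
    by (metis injI swp_simps(4) map_prod_inj_on prod.inj_map)
  have "invset N R' (p \<circ> swp i) = ?f ` (invset N R p - {(i, Suc i)})" (is "?A = ?B")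
  proof (intro equalityI subsetI)
    fix x assume "x \<in> ?A"
    then obtain a b where x: "x = (a, b)" "a \<in> {1..N}" "b \<in> {1..N}" "a < b" "R' a b"
      "p (swp i b) < p (swp i a)" by (auto simp: invset_def)
    have ne: "(a, b) \<noteq> (i, Suc i)" "(a, b) \<noteq> (Suc i, i)" using x assms(4) by auto
    have "swp i a < swp i b" using swp_less_iff[OF ne] x by simp
    moreover have "(swp i a, swp i b) \<noteq> (i, Suc i)" using ne(2) by (auto simp: swp_def transpose_def split: if_splits)
    ultimately have "(swp i a, swp i b) \<in> invset N R p - {(i, Suc i)}"
      using x R inS[of a] inS[of b] unfolding invset_def by (simp del: atLeastAtMost_iff)
    then show "x \<in> ?B" using x(1) by (force intro: rev_image_eqI)
  next
    fix x assume "x \<in> ?B"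
    then obtain a b where x: "x = (swp i a, swp i b)" "a \<in> {1..N}" "b \<in> {1..N}" "a < b" "R a b"
      "p b < p a" "(a, b) \<noteq> (i, Suc i)" by (auto simp: invset_def)
    have "swp i a < swp i b" using x by (subst swp_less_iff) auto
    then show "x \<in> ?A" using x R inS[of a] inS[of b] unfolding invset_def by (simp del: atLeastAtMost_iff)
  qed
  then have "card (invset N R' (p \<circ> swp i)) = card (invset N R p - {(i, Suc i)})"
    using card_image[OF inj_on_subset[OF \<open>inj ?f\<close> subset_UNIV], of "invset N R p - {(i, Suc i)}"] by simp
  moreover have "(i, Suc i) \<in> invset N R p \<longleftrightarrow> R i (Suc i)"
    using assms by (auto simp: invset_def)
  ultimately show ?thesis
    using card_Suc_Diff1[OF finite_invset, of "(i, Suc i)" N R p] by auto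
qed

text \<open>Here values move and positions stay, hence an equality of sets: only the pair of
  positions holding \<open>Suc i\<close> and \<open>i\<close> stops being inverted.\<close>

lemma invset_swp_comp:
  assumes "p permutes {1..N}" "1 \<le> i" "i < N" "inv' p (Suc i) < inv' p i"
  shows "invset N R (swp i \<circ> p) = invset N R p - {(inv' p (Suc i), inv' p i)}"
proof -
  have eq: "p x = y \<longleftrightarrow> x = inv' p y" for x y
    using permutes_inverses[OF assms(1)] by metis
  have "swp i (p b) < swp i (p a) \<longleftrightarrow> p b < p a \<and> (a, b) \<noteq> (inv' p (Suc i), inv' p i)"
    if "a < b" for a b
  proof (cases "(p b, p a) = (i, Suc i)")
    case True
    then have "inv' p i = b" "inv' p (Suc i) = a" by (auto simp: eq)
    with True show ?thesis by simp
  next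
    case False
    show ?thesis
    proof (cases "(p b, p a) = (Suc i, i)")
      case True
      then have "b = inv' p (Suc i)" "a = inv' p i" by (auto simp: eq)
      then show ?thesis using that assms(4) by simp
    next
      case F: False
      show ?thesis using swp_less_iff[OF False F] False by (auto simp: eq)
    qed
  qed
  then show ?thesis by (auto simp: invset_def)
qed

lemma invs_comp_swp:
  assumes "p permutes {1..N}" "1 \<le> i" "i < N"
  shows "card (invs N (p \<circ> swp i)) =
    (if p i < p (Suc i) then Suc (card (invs N p)) else card (invs N p) - 1)"
    and "p (Suc i) < p i \<Longrightarrow> card (invs N p) > 0"
proof -
  show pos: "card (invs N p) > 0" if "p (Suc i) < p i"
    using invset_comp_swp[OF assms that, of "\<lambda>_ _. True" "\<lambda>_ _. True"] by simp
  show "card (invs N (p \<circ> swp i)) =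
    (if p i < p (Suc i) then Suc (card (invs N p)) else card (invs N p) - 1)"
  proof (cases "p i < p (Suc i)")
    case True
    have "p \<circ> swp i permutes {1..N}"
      using permutes_compose[OF swp_permutes[OF assms(2,3)] assms(1)] .
    from invset_comp_swp[OF this assms(2,3), of "\<lambda>_ _. True" "\<lambda>_ _. True"] True show ?thesis by simp
  next
    case False
    then have "p (Suc i) < p i"
      using permutes_inj[OF assms(1)] by (metis injD linorder_neqE_nat n_not_Suc_n)
    from invset_comp_swp[OF assms this, of "\<lambda>_ _. True" "\<lambda>_ _. True"] False show ?thesis by simp
  qed
qed

lemma card_invs_inv:
  assumes "p permutes {1..N}"
  shows "card (invs N (inv' p)) = card (invs N p)"
proof (rule bij_betw_same_card)
  have inS: "p a \<in> {1..N} \<longleftrightarrow> a \<in> {1..N}" "inv' p a \<in> {1..N} \<longleftrightarrow> a \<in> {1..N}" for a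
    using permutes_in_image[OF assms] permutes_in_image[OF permutes_inv[OF assms]] by blast+
  note i = permutes_inverses[OF assms]
  show "bij_betw (\<lambda>(a, b). (inv' p b, inv' p a)) (invs N (inv' p)) (invs N p)"
    by (rule bij_betw_byWitness[where f' = "\<lambda>(a, b). (p b, p a)"])
       (use inS in \<open>auto simp: invset_def i simp del: atLeastAtMost_iff\<close>)
qed

lemma invs_swp_comp:
  assumes "p permutes {1..N}" "1 \<le> i" "i < N"
  shows "card (invs N (swp i \<circ> p)) =
    (if inv' p i < inv' p (Suc i) then Suc (card (invs N p)) else card (invs N p) - 1)"
    and "inv' p (Suc i) < inv' p i \<Longrightarrow> card (invs N p) > 0"
proof -
  have "swp i \<circ> p permutes {1..N}"
    using permutes_compose[OF assms(1) swp_permutes[OF assms(2,3)]] .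
  from card_invs_inv[OF this]
  have "card (invs N (swp i \<circ> p)) = card (invs N (inv' p \<circ> swp i))"
    using o_inv_distrib[OF permutes_bij[OF swp_permutes[OF assms(2,3)]] permutes_bij[OF assms(1)]]
    by (metis inv_swp)
  then show "card (invs N (swp i \<circ> p)) =
    (if inv' p i < inv' p (Suc i) then Suc (card (invs N p)) else card (invs N p) - 1)"
    unfolding invs_comp_swp(1)[OF permutes_inv[OF assms(1)] assms(2,3)] card_invs_inv[OF assms(1)] by simp
  show "inv' p (Suc i) < inv' p i \<Longrightarrow> card (invs N p) > 0"
    using invs_comp_swp(2)[OF permutes_inv[OF assms(1)] assms(2,3)] card_invs_inv[OF assms(1)] by simp
qed

text \<open>The codomain is any linear order, so that negated values turn this into a search for an
  adjacent ascent.\<close>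

lemma adjacent_descent:
  fixes f :: "nat \<Rightarrow> 'a::linorder"
  assumes "a < b" "f b < f a"
  obtains i where "a \<le> i" "i < b" "f (Suc i) < f i"
proof (rule ccontr)
  assume "\<not> thesis"
  with that have le: "f i \<le> f (Suc i)" if "a \<le> i" "i < b" for i
    using \<open>a \<le> i\<close> \<open>i < b\<close> by (meson not_less)
  have "f a \<le> f (a + k)" if "a + k \<le> b" for k
    using that
  proof (induction k)
    case (Suc k)
    with le[of "a + k"] show ?case by simp
  qed simp
  from this[of "b - a"] assms show False by simp
qed

lemma permutes_increasing_id:
  assumes p: "p permutes {1..N}" and inc: "\<And>i. 1 \<le> i \<Longrightarrow> i < N \<Longrightarrow> p i < p (Suc i)"
  shows "p = id"
proof -
  have mono: "p a < p b" if "1 \<le> a" "a < b" "b \<le> N" for a b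
  proof (rule ccontr)
    assume "\<not> p a < p b"
    moreover have "p a \<noteq> p b" using that permutes_inj[OF p] by (metis injD nat_neq_iff)
    ultimately have "p b < p a" by simp
    then obtain i where "a \<le> i" "i < b" "p (Suc i) < p i"
      using adjacent_descent[OF \<open>a < b\<close>] by metis
    with inc[of i] that show False by simp
  qed
  \<comment> \<open>Strict growth pushes every value up to at least its position; as
    \<open>p\<close> only rearranges the sum of all values, no inequality can be strict.\<close>
  have "a \<le> p a" if "1 \<le> a" "a \<le> N" for a
    using that
  proof (induction a)
    case (Suc a)
    show ?case
    proof (cases "a = 0")
      case True
      have "p (Suc a) \<in> {1..N}" unfolding permutes_in_image[OF p] using Suc by simp
      with True show ?thesis by simp
    next
      case False
      with Suc mono[of a "Suc a"] show ?thesis by simp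
    qed
  qed simp
  moreover have "(\<Sum>a\<in>{1..N}. p a) = (\<Sum>a\<in>{1..N}. a)"
    using sum.permute[OF p, of "\<lambda>a. a"] by (simp add: comp_def)
  ultimately have "p a = a" if "a \<in> {1..N}" for a
    using sum_mono_inv[of "\<lambda>a. a" "{1..N}" p] that by simp
  then show ?thesis
    using permutes_not_in[OF p] by (metis eq_id_iff)
qed

lemma permutes_descent:
  assumes "p permutes {1..N}" "p \<noteq> id"
  obtains i where "1 \<le> i" "i < N" "p (Suc i) < p i"
proof -
  have "\<exists>i. 1 \<le> i \<and> i < N \<and> p (Suc i) < p i"
  proof (rule ccontr)
    assume *: "\<not> ?thesis"
    have "p i < p (Suc i)" if "1 \<le> i" "i < N" for i
      using * that permutes_inj[OF assms(1)]
      by (metis injD linorder_neqE_nat n_not_Suc_n)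
    then show False using permutes_increasing_id[OF assms(1)] assms(2) by blast
  qed
  then show ?thesis using that by blast
qed

lemma permutes_left_descent:
  assumes "p permutes {1..N}" "p \<noteq> id"
  obtains i where "1 \<le> i" "i < N" "inv' p (Suc i) < inv' p i"
proof -
  have "inv' p \<noteq> id" using assms by (metis inv_id permutes_inv_inv)
  then show ?thesis using that permutes_descent[OF permutes_inv[OF assms(1)]] by metis
qed

lemma invs_id [simp]: "invset N R id = {}"
  by (auto simp: invset_def)

section \<open>The Hecke algebra of the symmetric group\<close>

\<comment> \<open>Keeps the simplifier from rewriting \<open>{1..N}\<close> to \<open>{Suc 0..N}\<close>.\<close>
declare One_nat_def [simp del]

abbreviation perms :: "nat \<Rightarrow> (nat \<Rightarrow> nat) set" where
  "perms N \<equiv> {p. p permutes {1..N}}"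

lemma finite_perms [simp]: "finite (perms N)"
  by (simp add: finite_permutations)

lemma inv_swp_comp:
  assumes "p permutes {1..N}" "1 \<le> i" "i < N"
  shows "inv' (swp i \<circ> p) = inv' p \<circ> swp i" "inv' (p \<circ> swp i) = swp i \<circ> inv' p"
  using o_inv_distrib[OF permutes_bij[OF swp_permutes[OF assms(2,3)]] permutes_bij[OF assms(1)]]
    o_inv_distrib[OF permutes_bij[OF assms(1)] permutes_bij[OF swp_permutes[OF assms(2,3)]]]
  by simp_all

lemma permutes_swp_comp:
  assumes "p permutes {1..N}" "1 \<le> i" "i < N"
  shows "swp i \<circ> p permutes {1..N}" "p \<circ> swp i permutes {1..N}"
  using permutes_compose[OF assms(1) swp_permutes[OF assms(2,3)]]
    permutes_compose[OF swp_permutes[OF assms(2,3)] assms(1)] .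

text \<open>\<open>t p\<close> is the normalised basis element \<open>u\<^sup>-\<^sup>l\<^sup>(\<^sup>p\<^sup>) T\<^sub>p\<close>; since the scalars form an
  ordered field in which \<open>u\<close> is infinitely large, forms that are sums of squares are anisotropic.\<close>

locale type_A_hecke = vector_space scale
  for scale :: "'k::linordered_field \<Rightarrow> 'h::ring_1 \<Rightarrow> 'h" (infixr "*s" 75) +
  fixes N :: nat and u :: 'k and t :: "(nat \<Rightarrow> nat) \<Rightarrow> 'h"
  assumes scale_mult_left: "(c *s x) * y = c *s (x * y)"
    and scale_mult_right: "x * (c *s y) = c *s (x * y)"
    and u_large: "of_nat k < u"
    and N_pos: "1 \<le> N"
    and t_id: "t id = 1"
    and swp_mult_t: "\<lbrakk>p permutes {1..N}; 1 \<le> i; i < N\<rbrakk> \<Longrightarrow> t (swp i) * t p =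
      t (swp i \<circ> p) + (if inv' p (Suc i) < inv' p i then (u - inverse u) *s t p else 0)"
    and t_mult_swp: "\<lbrakk>p permutes {1..N}; 1 \<le> i; i < N\<rbrakk> \<Longrightarrow> t p * t (swp i) =
      t (p \<circ> swp i) + (if p (Suc i) < p i then (u - inverse u) *s t p else 0)"
    and t_independent: "\<lbrakk>(\<Sum>p\<in>perms N. f p *s t p) = 0; p permutes {1..N}\<rbrakk> \<Longrightarrow> f p = 0"
    and t_spanning: "\<exists>f. h = (\<Sum>p\<in>perms N. f p *s t p)"
begin

abbreviation g :: "nat \<Rightarrow> 'h" where "g i \<equiv> t (swp i)"

abbreviation "a0 \<equiv> u - inverse u"

lemma u_pos: "0 < u" using u_large[of 0] by simp
lemma u_gt_1: "1 < u" using u_large[of 1] by simp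

lemmas scale_simps = scale_mult_left scale_mult_right scale_right_distrib scale_left_distrib
  scale_right_diff_distrib scale_left_diff_distrib

lemma t_induct [case_names basis add scale]:
  assumes "\<And>p. p permutes {1..N} \<Longrightarrow> Q (t p)"
    and "\<And>x y. Q x \<Longrightarrow> Q y \<Longrightarrow> Q (x + y)"
    and "\<And>c x. Q x \<Longrightarrow> Q (c *s x)"
  shows "Q h"
proof -
  obtain f where h: "h = (\<Sum>p\<in>perms N. f p *s t p)" using t_spanning by blast
  have "Q 0" using assms(3)[OF assms(1)[OF permutes_id], of 0] by simp
  have "A \<subseteq> perms N \<longrightarrow> Q (\<Sum>p\<in>A. f p *s t p)" if "finite A" for A
    using that by (induction rule: finite_induct) (auto intro!: assms \<open>Q 0\<close>)
  with h show ?thesis by simp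
qed

lemma g_quadratic: "1 \<le> i \<Longrightarrow> i < N \<Longrightarrow> g i * g i = 1 + a0 *s g i"
  using swp_mult_t[OF swp_permutes] by (simp add: t_id)

lemma g_mult_t:
  assumes "p permutes {1..N}" "1 \<le> i" "i < N" "inv' p i < inv' p (Suc i)"
  shows "g i * t p = t (swp i \<circ> p)"
  using swp_mult_t[OF assms(1-3)] assms(4) by simp

lemma t_mult_g:
  assumes "p permutes {1..N}" "1 \<le> i" "i < N" "p i < p (Suc i)"
  shows "t p * g i = t (p \<circ> swp i)"
  using t_mult_swp[OF assms(1-3)] assms(4) by simp

lemma g_commute:
  assumes "1 \<le> i" "i < N" "1 \<le> j" "j < N" "Suc i < j \<or> Suc j < i"
  shows "g i * g j = g j * g i"
proof -
  have "swp j i < swp j (Suc i)" "swp i j < swp i (Suc j)" using assms(5) by auto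
  moreover have "swp i \<circ> swp j = swp j \<circ> swp i"
    using assms(5) by (auto simp: fun_eq_iff swp_def transpose_def)
  ultimately show ?thesis
    using g_mult_t[OF swp_permutes[OF assms(3,4)] assms(1,2)]
      g_mult_t[OF swp_permutes[OF assms(1,2)] assms(3,4)] by simp
qed

lemma g_braid:
  assumes "1 \<le> i" "Suc i < N"
  shows "g i * g (Suc i) * g i = g (Suc i) * g i * g (Suc i)"
proof -
  have i: "i < N" "1 \<le> Suc i" using assms by auto
  note p = swp_permutes[OF assms(1) i(1)] swp_permutes[OF i(2) assms(2)]
  have 1: "g (Suc i) * g i = t (swp (Suc i) \<circ> swp i)" "g i * g (Suc i) = t (swp i \<circ> swp (Suc i))"
    using g_mult_t[OF p(1) i(2) assms(2)] g_mult_t[OF p(2) assms(1) i(1)] by simp_all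
  have "g i * (g (Suc i) * g i) = t (swp i \<circ> (swp (Suc i) \<circ> swp i))"
    unfolding 1 by (rule g_mult_t)
      (use permutes_swp_comp[OF p(1) i(2) assms(2)] assms i in
        \<open>auto simp: inv_swp_comp[OF p(1) i(2) assms(2)]\<close>)
  moreover have "g (Suc i) * (g i * g (Suc i)) = t (swp (Suc i) \<circ> (swp i \<circ> swp (Suc i)))"
    unfolding 1 by (rule g_mult_t)
      (use permutes_swp_comp[OF p(2) assms(1) i(1)] assms i in
        \<open>auto simp: inv_swp_comp[OF p(2) assms(1) i(1)]\<close>)
  moreover have "swp i \<circ> (swp (Suc i) \<circ> swp i) = swp (Suc i) \<circ> (swp i \<circ> swp (Suc i))"
    by (auto simp: fun_eq_iff swp_def transpose_def)
  ultimately show ?thesis by (simp add: mult.assoc)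
qed

text \<open>The subalgebra H_j generated by \<open>g 1\<close> to \<open>g j\<close>. Closure under
  left multiplication by generators alone gives induction over words.\<close>

inductive_set alg :: "nat \<Rightarrow> 'h set" for j where
  one: "1 \<in> alg j"
| add: "x \<in> alg j \<Longrightarrow> y \<in> alg j \<Longrightarrow> x + y \<in> alg j"
| scale: "x \<in> alg j \<Longrightarrow> c *s x \<in> alg j"
| mult: "x \<in> alg j \<Longrightarrow> 1 \<le> i \<Longrightarrow> i \<le> j \<Longrightarrow> i < N \<Longrightarrow> g i * x \<in> alg j"

lemma t_left_factor:
  assumes "p permutes {1..N}" "p \<noteq> id"
  obtains i p' where "1 \<le> i" "i < N" "p' permutes {1..N}" "t p = g i * t p'"
    "p = swp i \<circ> p'" "card (invs N p') < card (invs N p)" "inv' p (Suc i) < inv' p i"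
proof -
  obtain i where i: "1 \<le> i" "i < N" "inv' p (Suc i) < inv' p i"
    using permutes_left_descent[OF assms] .
  let ?p' = "swp i \<circ> p"
  have p': "?p' permutes {1..N}" using permutes_swp_comp[OF assms(1) i(1,2)] by simp
  have "g i * t ?p' = t (swp i \<circ> ?p')"
    by (rule g_mult_t[OF p' i(1,2)]) (use i in \<open>simp add: inv_swp_comp[OF assms(1) i(1,2)]\<close>)
  then have "t p = g i * t ?p'" by simp
  moreover have "card (invs N ?p') < card (invs N p)"
    using invs_swp_comp[OF assms(1) i(1,2)] i(3) by simp
  ultimately show ?thesis using that[OF i(1,2) p'] i(3) by simp
qed

lemma alg_UNIV: "N \<le> Suc j \<Longrightarrow> x \<in> alg j"
proof (induction x rule: t_induct)
  case (basis p)
  then show ?case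
  proof (induction "card (invs N p)" arbitrary: p rule: less_induct)
    case less
    show ?case
    proof (cases "p = id")
      case False
      obtain i p' where "1 \<le> i" "i < N" "p' permutes {1..N}" "t p = g i * t p'"
        "card (invs N p') < card (invs N p)"
        using t_left_factor[OF less.prems(1) False] by metis
      then show ?thesis using less.hyps less.prems by (auto intro!: alg.mult)
    qed (simp only: t_id alg.one)
  qed
qed (auto intro: alg.intros)

lemma gen_induct [case_names one add scale mult]:
  assumes "Q 1" "\<And>x y. Q x \<Longrightarrow> Q y \<Longrightarrow> Q (x + y)" "\<And>c x. Q x \<Longrightarrow> Q (c *s x)"
    and "\<And>i x. 1 \<le> i \<Longrightarrow> i < N \<Longrightarrow> Q x \<Longrightarrow> Q (g i * x)"
  shows "Q h"
proof -
  have "h \<in> alg N" by (rule alg_UNIV) simp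
  then show ?thesis by induction (auto intro: assms)
qed

section \<open>Coordinates, the anti-involution and the invariant form\<close>

definition coef :: "'h \<Rightarrow> (nat \<Rightarrow> nat) \<Rightarrow> 'k" where
  "coef h = (SOME f. h = (\<Sum>p\<in>perms N. f p *s t p))"

lemma coef_sum: "h = (\<Sum>p\<in>perms N. coef h p *s t p)"
  unfolding coef_def by (rule someI_ex[OF t_spanning])

lemma coef_unique:
  assumes "h = (\<Sum>p\<in>perms N. f p *s t p)" "p permutes {1..N}"
  shows "coef h p = f p"
proof -
  have "(\<Sum>p\<in>perms N. (coef h p - f p) *s t p) = h - h"
    using assms(1) coef_sum[of h] by (simp add: scale_left_diff_distrib sum_subtractf)
  then have "coef h p - f p = 0"
    by (intro t_independent[OF _ assms(2)]) simp
  then show ?thesis by simp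
qed

lemma coef_add: "p permutes {1..N} \<Longrightarrow> coef (x + y) p = coef x p + coef y p"
proof (rule coef_unique)
  show "x + y = (\<Sum>p\<in>perms N. (coef x p + coef y p) *s t p)"
    by (simp add: scale_left_distrib sum.distrib coef_sum[symmetric])
qed

lemma coef_scale: "p permutes {1..N} \<Longrightarrow> coef (c *s x) p = c * coef x p"
proof (rule coef_unique)
  have "(\<Sum>p\<in>perms N. (c * coef x p) *s t p) = c *s (\<Sum>p\<in>perms N. coef x p *s t p)"
    by (simp add: scale_sum_right)
  then show "c *s x = (\<Sum>p\<in>perms N. (c * coef x p) *s t p)" by (simp add: coef_sum[symmetric])
qed

lemma coef_t:
  assumes "q permutes {1..N}" "p permutes {1..N}"
  shows "coef (t q) p = (if p = q then 1 else 0)"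
proof (rule coef_unique[OF _ assms(2)])
  have "(\<Sum>p\<in>perms N. (if p = q then 1 else 0) *s t p) = (\<Sum>p\<in>perms N. if p = q then t p else 0)"
    by (rule sum.cong) auto
  then show "t q = (\<Sum>p\<in>perms N. (if p = q then 1 else 0) *s t p)" using assms(1) by simp
qed

definition sig :: "'h \<Rightarrow> 'h" where
  "sig h = (\<Sum>p\<in>perms N. coef h p *s t (inv' p))"

lemma sig_add: "sig (x + y) = sig x + sig y"
  by (simp add: sig_def coef_add scale_left_distrib sum.distrib)

lemma sig_scale: "sig (c *s x) = c *s sig x"
  by (simp add: sig_def coef_scale scale_sum_right)

lemma sig_t: "p permutes {1..N} \<Longrightarrow> sig (t p) = t (inv' p)"
proof -
  assume p: "p permutes {1..N}"
  have "sig (t p) = (\<Sum>q\<in>perms N. if q = p then t (inv' q) else 0)"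
    unfolding sig_def by (rule sum.cong) (auto simp: coef_t[OF p])
  then show ?thesis using p by simp
qed

lemma sig_0 [simp]: "sig 0 = 0" using sig_scale[of 0 0] by simp
lemma sig_minus: "sig (- x) = - sig x" using sig_scale[of "-1" x] by simp
lemma sig_diff: "sig (x - y) = sig x - sig y" using sig_add[of x "- y"] by (simp add: sig_minus)
lemma sig_1 [simp]: "sig 1 = 1" using sig_t[OF permutes_id] by (simp add: t_id inv_id[unfolded id_def] del: id_apply)

lemma sig_g: "1 \<le> i \<Longrightarrow> i < N \<Longrightarrow> sig (g i) = g i"
  using sig_t[OF swp_permutes] by simp

text \<open>Inverting permutations exchanges the rules for left and right multiplication by a
  generator.\<close>

lemma sig_g_mult:
  assumes "1 \<le> i" "i < N"
  shows "sig (g i * x) = sig x * g i"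
proof (induction x rule: t_induct)
  case (basis p)
  show ?case
    using swp_mult_t[OF basis assms] t_mult_swp[OF permutes_inv[OF basis] assms]
    by (simp add: sig_add sig_scale sig_t basis permutes_swp_comp[OF basis assms]
        inv_swp_comp[OF basis assms])
qed (simp_all add: sig_add sig_scale distrib_left distrib_right scale_simps)

lemma sig_mult: "sig (x * y) = sig y * sig x"
proof (induction x rule: gen_induct)
  case (mult i x)
  then show ?case by (simp add: mult.assoc sig_g_mult)
qed (simp_all add: sig_add sig_scale distrib_left distrib_right scale_mult_left scale_mult_right)

lemma sig_sig [simp]: "sig (sig x) = x"
  by (induction x rule: t_induct)
    (simp_all add: sig_add sig_scale sig_t permutes_inv permutes_inv_inv)

definition form :: "'h \<Rightarrow> 'h \<Rightarrow> 'k" where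
  "form x y = (\<Sum>p\<in>perms N. coef x p * coef y p)"

lemma form_add: "form (x + y) z = form x z + form y z" "form z (x + y) = form z x + form z y"
  by (simp_all add: form_def coef_add distrib_left distrib_right sum.distrib)

lemma form_scale: "form (c *s x) z = c * form x z" "form z (c *s x) = c * form z x"
  by (simp_all add: form_def coef_scale sum_distrib_left algebra_simps)

lemma form_0 [simp]: "form 0 z = 0" "form z 0 = 0"
  using form_scale(1)[of 0 0 z] form_scale(2)[of z 0 0] by simp_all

lemma form_t:
  assumes "p permutes {1..N}" "q permutes {1..N}"
  shows "form (t p) (t q) = (if p = q then 1 else 0)"
proof -
  have "form (t p) (t q) = (\<Sum>r\<in>perms N. if r = p then if r = q then 1 else 0 else 0)"
    unfolding form_def by (rule sum.cong) (auto simp: coef_t assms)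
  then show ?thesis using assms by simp
qed

lemma form_eq_0: "form z z = 0 \<Longrightarrow> z = 0"
proof -
  assume "form z z = 0"
  then have "\<forall>p\<in>perms N. coef z p * coef z p = 0"
    unfolding form_def by (subst sum_nonneg_eq_0_iff[symmetric]) auto
  then show "z = 0" using coef_sum[of z] by simp
qed

text \<open>In the basis \<open>t p\<close> a generator has a symmetric matrix: it joins
  \<open>t p\<close> and \<open>t (swp i \<circ> p)\<close> by the entry 1 in both directions and
  adds a diagonal entry.\<close>

lemma form_g:
  assumes "1 \<le> i" "i < N"
  shows "form (g i * x) y = form x (g i * y)"
proof (induction x rule: t_induct)
  case (basis p)
  show ?case
  proof (induction y rule: t_induct)
    case (basis q)
    note pq = basis \<open>p permutes {1..N}\<close>
    have "swp i \<circ> p = q \<longleftrightarrow> p = swp i \<circ> q" by (metis swp_comp(2))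
    then show ?case
      using pq by (auto simp: swp_mult_t[OF _ assms] form_add form_scale form_t permutes_swp_comp[OF _ assms])
  qed (simp_all add: form_add form_scale distrib_left scale_mult_right)
qed (simp_all add: form_add form_scale distrib_left scale_mult_right)

lemma form_sig: "form (h * x) y = form x (sig h * y)"
proof (induction h arbitrary: x y rule: gen_induct)
  case (mult i h)
  then show ?case by (simp add: mult.assoc form_g sig_g_mult)
qed (simp_all add: form_add form_scale distrib_right scale_mult_left sig_add sig_scale)

text \<open>Definiteness in algebraic form. It replaces complete reducibility: it excludes Jordan
  blocks of elements fixed by \<open>sig\<close> and kills \<open>phi k * f\<close> as soon as
  \<open>phi k\<close> squared kills \<open>f\<close>.\<close>

lemma sig_self_mult_eq_0:
  assumes "sig z * z = 0"
  shows "z = 0"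
proof -
  have "form z z = form 1 (sig z * z)" using form_sig[of z 1 z] by simp
  also have "\<dots> = 0" using assms by simp
  finally show ?thesis by (rule form_eq_0)
qed

section \<open>The element X and its commutator relations\<close>

definition X :: 'h where "X = (\<Sum>p\<in>perms N. t p)"

text \<open>The part of \<open>X\<close> on which left multiplication by \<open>g i\<close>
  shortens; it carries the whole deviation of \<open>g i * X\<close> from \<open>X\<close>.\<close>

definition Xdes :: "nat \<Rightarrow> 'h" where
  "Xdes i = (\<Sum>p\<in>{p\<in>perms N. inv' p (Suc i) < inv' p i}. t p)"

lemma sig_sum: "sig (sum f A) = (\<Sum>x\<in>A. sig (f x))"
  by (induction A rule: infinite_finite_induct) (auto simp: sig_add)

lemma sig_X: "sig X = X"
  unfolding X_def sig_sum
  by (rule sum.reindex_bij_witness[where i = inv' and j = inv'])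
    (auto simp: sig_t permutes_inv permutes_inv_inv)

lemma sum_t_swp:
  assumes "1 \<le> i" "i < N"
  shows "(\<Sum>p\<in>{p\<in>perms N. C p}. t (swp i \<circ> p)) = (\<Sum>p\<in>{p\<in>perms N. C (swp i \<circ> p)}. t p)"
  by (rule sum.reindex_bij_witness[where i = "\<lambda>p. swp i \<circ> p" and j = "\<lambda>p. swp i \<circ> p"])
    (auto simp: permutes_swp_comp[OF _ assms])

lemma g_mult_sum:
  assumes "1 \<le> i" "i < N"
  shows "g i * (\<Sum>p\<in>{p\<in>perms N. C p}. t p) = (\<Sum>p\<in>{p\<in>perms N. C (swp i \<circ> p)}. t p)
    + a0 *s (\<Sum>p\<in>{p\<in>perms N. C p \<and> inv' p (Suc i) < inv' p i}. t p)"
proof -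
  have "g i * (\<Sum>p\<in>{p\<in>perms N. C p}. t p) = (\<Sum>p\<in>{p\<in>perms N. C p}. t (swp i \<circ> p))
    + (\<Sum>p\<in>{p\<in>perms N. C p}. if inv' p (Suc i) < inv' p i then a0 *s t p else 0)"
    unfolding sum_distrib_left sum.distrib[symmetric]
    by (rule sum.cong) (auto simp: swp_mult_t[OF _ assms])
  also have "(\<Sum>p\<in>{p\<in>perms N. C p}. if inv' p (Suc i) < inv' p i then a0 *s t p else 0) =
    a0 *s (\<Sum>p\<in>{p\<in>perms N. C p \<and> inv' p (Suc i) < inv' p i}. t p)"
    unfolding scale_sum_right by (rule sum.mono_neutral_cong_right) auto
  finally show ?thesis unfolding sum_t_swp[OF assms] .
qed

lemma g_mult_X: "1 \<le> i \<Longrightarrow> i < N \<Longrightarrow> g i * X = X + a0 *s Xdes i"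
  using g_mult_sum[of i "\<lambda>_. True"] by (simp add: X_def Xdes_def)

text \<open>Both sides are the sum over all \<open>p\<close> in which the value \<open>i + 2\<close>
  stands before \<open>i\<close>, plus \<open>a0\<close> times the sum over those in which
  \<open>i + 2\<close>, \<open>i + 1\<close>, \<open>i\<close> occur in this order. This symmetry is
  what yields r X = 0.\<close>

lemma g_mult_Xdes_commute:
  assumes "1 \<le> i" "Suc i < N"
  shows "g (Suc i) * Xdes i = g i * Xdes (Suc i)"
proof -
  have i: "i < N" "1 \<le> Suc i" using assms by auto
  have 1: "{p\<in>perms N. inv' (swp (Suc i) \<circ> p) (Suc i) < inv' (swp (Suc i) \<circ> p) i}
    = {p\<in>perms N. inv' p (Suc (Suc i)) < inv' p i}"
    by (intro Collect_cong conj_cong) (auto simp: inv_swp_comp[OF _ i(2) assms(2)])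
  have 2: "{p\<in>perms N. inv' (swp i \<circ> p) (Suc (Suc i)) < inv' (swp i \<circ> p) (Suc i)}
    = {p\<in>perms N. inv' p (Suc (Suc i)) < inv' p i}"
    by (intro Collect_cong conj_cong) (auto simp: inv_swp_comp[OF _ assms(1) i(1)])
  show ?thesis
    unfolding Xdes_def g_mult_sum[OF i(2) assms(2)] g_mult_sum[OF assms(1) i(1)] 1 2
    by (simp add: conj_commute conj_left_commute)
qed

lemma left_relation:
  assumes "1 \<le> i" "Suc i < N"
  shows "g (Suc i) * g i * X = g i * g (Suc i) * X + g (Suc i) * X - g i * X"
proof -
  have i: "i < N" "1 \<le> Suc i" using assms by auto
  show ?thesis
    using g_mult_Xdes_commute[OF assms]
    by (simp add: mult.assoc g_mult_X[OF assms(1) i(1)] g_mult_X[OF i(2) assms(2)] distrib_left scale_mult_right)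
qed

lemma right_relation:
  assumes "1 \<le> i" "Suc i < N"
  shows "X * (g i * g (Suc i)) = X * (g (Suc i) * g i) + X * g (Suc i) - X * g i"
  using arg_cong[OF left_relation[OF assms], of sig] assms
  by (simp add: sig_add sig_diff sig_mult sig_g sig_X mult.assoc)

end

section \<open>Commutativity\<close>

text \<open>Words are lists of indices of generators.  Each of the moves changes \<open>X w X\<close> only by words
  with fewer letters; the last two rest on \<open>r X = 0\<close> and its mirror image.\<close>

inductive shuffle :: "nat list \<Rightarrow> nat list \<Rightarrow> bool" where
  shuffle_refl: "shuffle xs xs"
| shuffle_sym: "shuffle xs ys \<Longrightarrow> shuffle ys xs"
| shuffle_trans: "shuffle xs ys \<Longrightarrow> shuffle ys zs \<Longrightarrow> shuffle xs zs"
| shuffle_commute: "Suc i < j \<or> Suc j < i \<Longrightarrow> shuffle (xs @ [i, j] @ ys) (xs @ [j, i] @ ys)"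
| shuffle_left: "shuffle (i # j # ys) (j # i # ys)"
| shuffle_right: "shuffle (xs @ [i, j]) (xs @ [j, i])"

lemmas shuffle_induct = shuffle.induct [case_names refl sym trans commute left right]

lemma shuffle_mset: "shuffle xs ys \<Longrightarrow> mset xs = mset ys"
  by (induction rule: shuffle_induct) auto

lemma shuffle_move:
  assumes "\<forall>x\<in>set bs. Suc x < k \<or> Suc k < x"
  shows "shuffle (as @ bs @ [k] @ cs) (as @ [k] @ bs @ cs)"
  using assms
proof (induction bs arbitrary: as)
  case (Cons b bs)
  have "shuffle (as @ (b # bs) @ [k] @ cs) ((as @ [b]) @ [k] @ bs @ cs)"
    using Cons.IH[of "as @ [b]"] Cons.prems by simp
  moreover have "shuffle ((as @ [b]) @ [k] @ bs @ cs) (as @ [k] @ (b # bs) @ cs)"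
    using shuffle_commute[of b k as "bs @ cs"] Cons.prems by simp
  ultimately show ?case by (rule shuffle_trans)
qed (simp add: shuffle_refl)

text \<open>A maximal letter \<open>m\<close> fails to commute with \<open>m - 1\<close> only, so \<open>m - 1\<close> can be brought next to
  it at one of the two ends.\<close>

lemma shuffle_max:
  assumes "distinct ws" "\<forall>x\<in>set ws. x < m"
  shows "shuffle (m # ws) (ws @ [m])"
proof (cases "m \<noteq> 0 \<and> m - 1 \<in> set ws")
  case True
  define k where "k = m - 1"
  have m: "m = Suc k" and k: "k \<in> set ws" using True by (auto simp: k_def)
  from split_list[OF k] obtain as bs where ws: "ws = as @ [k] @ bs" by auto
  have lt: "x < k" if "x \<in> set as \<union> set bs" for x
    using that assms unfolding ws m by (auto simp: less_Suc_eq)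
  show ?thesis
  proof (cases "\<exists>x\<in>set as. Suc x = k")
    case False
    then have as: "\<forall>x\<in>set as. Suc x < k \<or> Suc k < x" using lt by (metis Suc_lessI UnI1)
    have 1: "shuffle (m # ws) (m # k # as @ bs)"
      using shuffle_move[OF as, of "[m]" bs] ws by simp
    have 2: "shuffle (k # m # as @ bs) (k # as @ bs @ [m])"
      using shuffle_sym[OF shuffle_move[of "as @ bs" m "[k]" "[]"]] lt m by fastforce
    have 3: "shuffle (k # as @ bs @ [m]) (ws @ [m])"
      using shuffle_sym[OF shuffle_move[OF as, of "[]" "bs @ [m]"]] ws by simp
    show ?thesis
      using 1 2 3 shuffle_left[of m k "as @ bs"] by (meson shuffle_trans)
  next
    case True
    then have "\<forall>x\<in>set bs. Suc x \<noteq> k" using assms(1) ws by auto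
    then have bs: "\<forall>x\<in>set bs. Suc x < k \<or> Suc k < x" using lt by (metis Suc_lessI UnI2)
    have 1: "shuffle (m # ws) (m # as @ bs @ [k])"
      using shuffle_sym[OF shuffle_move[OF bs, of "m # as" "[]"]] ws by simp
    have 2: "shuffle (m # as @ bs @ [k]) (as @ bs @ [m, k])"
      using shuffle_sym[OF shuffle_move[of "as @ bs" m "[]" "[k]"]] lt m by fastforce
    have 3: "shuffle (as @ bs @ [k, m]) (ws @ [m])"
      using shuffle_move[OF bs, of as "[m]"] ws by simp
    show ?thesis
      using 1 2 3 shuffle_right[of "as @ bs" m k] by (metis shuffle_trans append.assoc)
  qed
next
  case False
  then have "\<forall>x\<in>set ws. Suc x < m \<or> Suc m < x"
    using assms(2) by (metis Suc_lessI diff_Suc_1 not_less_zero)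
  from shuffle_sym[OF shuffle_move[OF this, of "[]" "[]"]] show ?thesis by simp
qed

text \<open>Only a swap of the first two letters is disturbed by the new letter in front. In that
  case \<open>shuffle_max\<close> sends \<open>m\<close> to the end, the swap is made, and
  \<open>m\<close> is brought back.\<close>

lemma shuffle_Cons_max:
  assumes "shuffle xs ys" "distinct xs" "\<forall>x\<in>set xs. x < m"
  shows "shuffle (m # xs) (m # ys)"
  using assms
proof (induction rule: shuffle_induct)
  case (sym xs ys)
  then show ?case by (metis shuffle_sym shuffle_mset mset_eq_setD mset_eq_imp_distinct_iff)
next
  case (trans xs ys zs)
  then show ?case by (metis shuffle_trans shuffle_mset mset_eq_setD mset_eq_imp_distinct_iff)
next
  case (commute i j xs ys)
  then show ?case using shuffle_commute[of i j "m # xs" ys] by simp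
next
  case (left i j ys)
  have 1: "shuffle (m # i # j # ys) ((i # j # ys) @ [m])"
    using shuffle_max[of "i # j # ys" m] left by simp
  have 2: "shuffle (m # j # i # ys) ((j # i # ys) @ [m])"
    using shuffle_max[of "j # i # ys" m] left by simp
  from 1 shuffle_left[of i j "ys @ [m]"] shuffle_sym[OF 2] show ?case
    by (metis append_Cons shuffle_trans)
next
  case (right xs i j)
  then show ?case using shuffle_right[of "m # xs" i j] by simp
qed (rule shuffle_refl)

text \<open>The letter \<open>m - 1\<close> occurs at most once, hence on one side of
  \<open>m\<close> only. If it is not on the left, \<open>m\<close> commutes to the front; otherwise
  \<open>m\<close> commutes to the back and \<open>shuffle_max\<close> carries it round.\<close>

lemma shuffle_Max_front:
  assumes "distinct ws" "m \<in> set ws" "\<forall>x\<in>set ws. x \<le> m"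
  obtains ws' where "shuffle ws (m # ws')" "distinct ws'" "set ws' = set ws - {m}"
proof -
  from split_list[OF assms(2)] obtain as bs where ws: "ws = as @ [m] @ bs" by auto
  have lt: "x < m" if "x \<in> set as \<union> set bs" for x
    using that assms unfolding ws by (auto simp: le_less)
  have "shuffle ws (m # as @ bs)"
  proof (cases "\<exists>x\<in>set as. Suc x = m")
    case False
    then have "\<forall>x\<in>set as. Suc x < m \<or> Suc m < x" using lt by (metis Suc_lessI UnI1)
    from shuffle_move[OF this, of "[]" bs] show ?thesis using ws by simp
  next
    case True
    then have "\<forall>x\<in>set bs. Suc x \<noteq> m" using assms(1) ws by auto
    then have "\<forall>x\<in>set bs. Suc x < m \<or> Suc m < x" using lt by (metis Suc_lessI UnI2)
    from shuffle_sym[OF shuffle_move[OF this, of as "[]"]] have "shuffle ws ((as @ bs) @ [m])"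
      using ws by simp
    moreover have "shuffle (m # as @ bs) ((as @ bs) @ [m])"
      using shuffle_max[of "as @ bs" m] assms(1) lt ws by auto
    ultimately show ?thesis by (meson shuffle_sym shuffle_trans)
  qed
  then show ?thesis using that[of "as @ bs"] assms(1) ws by auto
qed

lemma shuffle_all:
  assumes "distinct xs" "distinct ys" "set xs = set ys"
  shows "shuffle xs ys"
  using assms
proof (induction "length xs" arbitrary: xs ys rule: less_induct)
  case less
  show ?case
  proof (cases "xs = []")
    case False
    define m where "m = Max (set xs)"
    have m: "m \<in> set xs" "\<forall>x\<in>set xs. x \<le> m" using False by (auto simp: m_def)
    obtain xs' where xs': "shuffle xs (m # xs')" "distinct xs'" "set xs' = set xs - {m}"
      using shuffle_Max_front[OF less.prems(1) m] .
    obtain ys' where ys': "shuffle ys (m # ys')" "distinct ys'" "set ys' = set ys - {m}"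
      using shuffle_Max_front[OF less.prems(2)] m less.prems(3) by metis
    have "length xs' < length xs"
      using arg_cong[OF shuffle_mset[OF xs'(1)], of size] by simp
    then have "shuffle xs' ys'" using less xs' ys' by metis
    moreover have "\<forall>x\<in>set xs'. x < m" using xs'(3) m by (auto simp: le_less)
    ultimately have "shuffle (m # xs') (m # ys')" using xs'(2) by (intro shuffle_Cons_max)
    with xs'(1) ys'(1) show ?thesis by (meson shuffle_sym shuffle_trans)
  qed (use less in \<open>simp add: shuffle_refl\<close>)
qed

context type_A_hecke
begin

lemma alg_mono: "x \<in> alg i \<Longrightarrow> i \<le> j \<Longrightarrow> x \<in> alg j"
  by (induction rule: alg.induct) (auto intro: alg.intros)

lemma alg_mult: "x \<in> alg j \<Longrightarrow> y \<in> alg j \<Longrightarrow> x * y \<in> alg j"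
  by (induction rule: alg.induct)
    (auto intro: alg.intros simp: distrib_right scale_mult_left mult.assoc)

lemma alg_g: "1 \<le> i \<Longrightarrow> i \<le> j \<Longrightarrow> i < N \<Longrightarrow> g i \<in> alg j"
  using alg.mult[OF alg.one] by simp

lemma alg_diff: "x \<in> alg j \<Longrightarrow> y \<in> alg j \<Longrightarrow> x - y \<in> alg j"
  using alg.add[OF _ alg.scale[of y j "-1"], of x] by simp

lemma alg_sig: "x \<in> alg j \<Longrightarrow> sig x \<in> alg j"
  by (induction rule: alg.induct)
    (auto intro: alg.intros alg_mult alg_g simp: sig_add sig_scale sig_g_mult)

lemma alg_commute: "x \<in> alg j \<Longrightarrow> Suc j < i \<Longrightarrow> i < N \<Longrightarrow> g i * x = x * g i"
proof (induction rule: alg.induct)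
  case (mult x k)
  then have "g i * g k = g k * g i" by (intro g_commute) auto
  with mult show ?case by (simp flip: mult.assoc) (simp add: mult.assoc)
qed (simp_all add: distrib_left distrib_right scale_mult_left scale_mult_right)

lemma alg_0_commute: "x \<in> alg 0 \<Longrightarrow> y * x = x * y"
  by (induction rule: alg.induct) (simp_all add: distrib_left distrib_right scale_mult_left scale_mult_right)

section \<open>One-step decompositions over smaller parabolic subalgebras\<close>

inductive_set dec :: "nat \<Rightarrow> 'h set" for j where
  base: "x \<in> alg j \<Longrightarrow> x \<in> dec j"
| gen: "x \<in> alg j \<Longrightarrow> y \<in> alg j \<Longrightarrow> x * g (Suc j) * y \<in> dec j"
| add: "x \<in> dec j \<Longrightarrow> y \<in> dec j \<Longrightarrow> x + y \<in> dec j"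

lemma dec_scale: "x \<in> dec j \<Longrightarrow> c *s x \<in> dec j"
proof (induction rule: dec.induct)
  case (gen x y)
  then show ?case using dec.gen[OF alg.scale[of x j c], of y] by (simp add: scale_mult_left)
qed (auto simp: scale_right_distrib intro: dec.intros alg.scale)

lemma dec_mult_left: "x \<in> dec j \<Longrightarrow> a \<in> alg j \<Longrightarrow> a * x \<in> dec j"
proof (induction rule: dec.induct)
  case (gen x y)
  then show ?case using dec.gen[OF alg_mult[of a j x], of y] by (simp add: mult.assoc)
qed (auto simp: distrib_left intro: dec.intros alg_mult)

lemma dec_mult_right: "x \<in> dec j \<Longrightarrow> a \<in> alg j \<Longrightarrow> x * a \<in> dec j"
proof (induction rule: dec.induct)
  case (gen x y)
  then show ?case using dec.gen[of x j "y * a"] by (simp add: mult.assoc alg_mult)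
qed (auto simp: distrib_right intro: dec.intros alg_mult)

lemma g_sandwich:
  assumes "x \<in> alg j" "Suc j < i" "i < N"
  shows "g i * x * g i = x + a0 *s (x * g i)"
proof -
  have "g i * x * g i = x * (g i * g i)"
    using alg_commute[OF assms] by (simp flip: mult.assoc)
  then show ?thesis using g_quadratic[of i] assms by (simp add: distrib_left scale_mult_right)
qed

lemma g_sandwich_gen:
  assumes "x \<in> alg j" "y \<in> alg j" "Suc (Suc j) < N"
  shows "g (Suc (Suc j)) * (x * g (Suc j) * y) * g (Suc (Suc j))
    = x * g (Suc j) * g (Suc (Suc j)) * (g (Suc j) * y)"
proof -
  let ?g = "g (Suc (Suc j))" and ?f = "g (Suc j)"
  have c: "?g * x = x * ?g" "?g * y = y * ?g"
    using assms by (auto intro: alg_commute)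
  have "?g * (x * ?f * y) * ?g = x * (?g * ?f * ?g) * y"
    using c by (metis mult.assoc)
  also have "?g * ?f * ?g = ?f * ?g * ?f" using g_braid[of "Suc j"] assms(3) by simp
  finally show ?thesis by (simp add: mult.assoc)
qed

text \<open>Two top generators can be merged: between them stands, by induction, either an element
  of the subalgebra commuting with them or one with a single next lower generator, to which the
  braid relation applies.\<close>

lemma alg_decompose: "x \<in> alg (Suc j) \<Longrightarrow> Suc j < N \<Longrightarrow> x \<in> dec j"
proof (induction j arbitrary: x)
  case 0
  have "g 1 * x \<in> dec 0" if "x \<in> dec 0" for x
    using that
  proof (induction rule: dec.induct)
    case (base x)
    then show ?case using dec.gen[OF alg.one base] by (simp add: One_nat_def)
  next
    case (gen x y)
    have "g 1 * (x * g (Suc 0) * y) = g 1 * x * g 1 * y" by (simp add: mult.assoc One_nat_def)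
    also have "g 1 * x = x * g 1" using alg_0_commute[OF gen(1)] by simp
    also have "x * g 1 * g 1 * y = x * y + a0 *s (x * g (Suc 0) * y)"
      using g_quadratic[of 1] 0
      by (simp add: mult.assoc scale_mult_left scale_mult_right distrib_left distrib_right One_nat_def)
    finally show ?case using gen by (auto intro: dec.intros dec_scale alg_mult)
  qed (auto simp: distrib_left intro: dec.intros)
  with 0(1) show ?case
    by (induction rule: alg.induct) (auto intro: dec.intros dec_scale alg.intros simp: le_Suc_eq One_nat_def)
next
  case (Suc j)
  let ?g = "g (Suc (Suc j))"
  have *: "?g * x * ?g \<in> dec (Suc j)" if "x \<in> alg (Suc j)" for x
  proof -
    from Suc.IH[OF that] Suc.prems have "x \<in> dec j" by simp
    then show ?thesis
    proof induction
      case (base x)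
      have "x \<in> alg (Suc j)" using base alg_mono by auto
      then show ?case
        unfolding g_sandwich[OF base lessI Suc.prems(2)]
        using dec.gen[OF _ alg.one, of x] by (auto intro: dec.intros dec_scale)
    next
      case (gen x y)
      show ?case
        unfolding g_sandwich_gen[OF gen Suc.prems(2)]
        using gen Suc.prems(2) by (intro dec.gen alg_mult alg_g) (auto intro: alg_mono)
    next
      case (add x y)
      then show ?case by (simp add: distrib_left distrib_right dec.add)
    qed
  qed
  have "?g * x \<in> dec (Suc j)" if "x \<in> dec (Suc j)" for x
    using that
  proof (induction rule: dec.induct)
    case (base x)
    then show ?case using dec.gen[OF alg.one base] by simp
  next
    case (gen x y)
    then show ?case using dec_mult_right[OF * gen(2), of x] by (simp add: mult.assoc)
  qed (auto simp: distrib_left intro: dec.intros)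
  with Suc.prems(1) show ?case
  proof (induction rule: alg.induct)
    case (mult x i)
    then show ?case
      by (cases "i = Suc (Suc j)") (auto intro!: dec_mult_left alg_g)
  qed (auto intro: dec.intros dec_scale alg.intros)
qed

text \<open>Compared with \<open>dec\<close>, the factor to the right of the top generator is gone,
  since the relation r X = 0 lets that generator stand next to \<open>X\<close>.\<close>

definition good :: "nat \<Rightarrow> 'h set" where
  "good j = {a * X + b * g (Suc j) * X |a b. a \<in> alg j \<and> b \<in> alg j}"

lemma goodI: "a \<in> alg j \<Longrightarrow> b \<in> alg j \<Longrightarrow> x = a * X + b * g (Suc j) * X \<Longrightarrow> x \<in> good j"
  by (auto simp: good_def)

lemma good_add: "x \<in> good j \<Longrightarrow> y \<in> good j \<Longrightarrow> x + y \<in> good j"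
proof -
  assume "x \<in> good j" "y \<in> good j"
  then obtain a b c d where *: "a \<in> alg j" "b \<in> alg j" "c \<in> alg j" "d \<in> alg j"
    "x = a * X + b * g (Suc j) * X" "y = c * X + d * g (Suc j) * X" unfolding good_def by blast
  then show ?thesis by (intro goodI[of "a + c" j "b + d"]) (auto intro: alg.add simp: distrib_right)
qed

lemma good_mult: "x \<in> good j \<Longrightarrow> c \<in> alg j \<Longrightarrow> c * x \<in> good j"
proof -
  assume "x \<in> good j" and c: "c \<in> alg j"
  then obtain a b where *: "a \<in> alg j" "b \<in> alg j" "x = a * X + b * g (Suc j) * X"
    unfolding good_def by blast
  with c show ?thesis
    by (intro goodI[of "c * a" j "c * b"]) (auto intro: alg_mult simp: distrib_left mult.assoc)
qed

lemma good_scale: "x \<in> good j \<Longrightarrow> c *s x \<in> good j"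
  using good_mult[OF _ alg.scale[OF alg.one], of x j c] by (simp add: scale_mult_left)

text \<open>Follows the pattern of \<open>alg_decompose\<close>, with \<open>left_relation\<close>
  as the new ingredient: it replaces \<open>?g * ?f * X\<close> by terms whose top generator, if
  present, is adjacent to \<open>X\<close>.\<close>

lemma alg_mult_X: "x \<in> alg (Suc j) \<Longrightarrow> Suc j < N \<Longrightarrow> x * X \<in> good j"
proof (induction j arbitrary: x)
  case 0
  have "g 1 * x \<in> good 0" if "x \<in> good 0" for x
  proof -
    from that obtain a b where *: "a \<in> alg 0" "b \<in> alg 0" "x = a * X + b * g 1 * X"
      unfolding good_def by (auto simp: One_nat_def)
    have "g 1 * x = (g 1 * a) * X + (g 1 * b) * g 1 * X" by (simp add: * distrib_left mult.assoc)
    also have "\<dots> = a * g 1 * X + b * (g 1 * g 1) * X"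
      using alg_0_commute[OF *(1)] alg_0_commute[OF *(2)] by (simp add: mult.assoc)
    also have "\<dots> = b * X + (a + a0 *s b) * g (Suc 0) * X"
      using g_quadratic[of 1] 0
      by (simp add: scale_mult_left scale_mult_right distrib_left distrib_right One_nat_def)
    finally show ?thesis by (rule goodI[rotated 2]) (use * in \<open>auto intro: alg.intros\<close>)
  qed
  with 0(1) show ?case
  proof (induction rule: alg.induct)
    case one
    show ?case by (rule goodI[of 1 0 0]) (use alg.one alg.scale[OF alg.one, of 0] in auto)
  qed (auto intro: good_add good_scale simp: distrib_right scale_mult_left mult.assoc le_Suc_eq One_nat_def)
next
  case (Suc j)
  let ?g = "g (Suc (Suc j))" and ?f = "g (Suc j)"
  have f: "?f \<in> alg (Suc j)" using Suc.prems(2) by (intro alg_g) auto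
  have L1: "?g * (a * X) \<in> good (Suc j)" if "a \<in> alg (Suc j)" for a
  proof -
    from Suc.IH[OF that] Suc.prems(2) obtain b c where
      bc: "b \<in> alg j" "c \<in> alg j" "a * X = b * X + c * ?f * X" by (auto simp: good_def)
    have comm: "?g * b = b * ?g" "?g * c = c * ?g"
      using bc Suc.prems(2) by (auto intro: alg_commute)
    have "?g * (a * X) = (?g * b) * X + (?g * c) * ?f * X"
      by (simp add: bc distrib_left mult.assoc)
    also have "\<dots> = b * ?g * X + c * (?g * ?f * X)" unfolding comm by (simp add: mult.assoc)
    also have "?g * ?f * X = ?f * ?g * X + ?g * X - ?f * X"
      using left_relation[of "Suc j"] Suc.prems(2) by simp
    finally have eq: "?g * (a * X) = (0 - c * ?f) * X + (b + c * ?f + c) * ?g * X"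
      by (simp add: algebra_simps)
    have bc': "b \<in> alg (Suc j)" "c \<in> alg (Suc j)" using bc by (auto intro: alg_mono)
    show ?thesis
    proof (rule goodI[OF _ _ eq])
      have "0 \<in> alg (Suc j)" using alg.scale[OF alg.one, of 0] by simp
      with bc' f show "0 - c * ?f \<in> alg (Suc j)" by (intro alg_diff alg_mult)
      show "b + c * ?f + c \<in> alg (Suc j)" using bc' f by (intro alg.add alg_mult)
    qed
  qed
  \<comment> \<open>Of two top generators one is removed by the quadratic or the braid relation; the
    braid case ends in the shape treated by \<open>L1\<close>.\<close>
  have L2: "?g * b * ?g * X \<in> good (Suc j)" if "b \<in> alg (Suc j)" for b
  proof -
    from alg_decompose[OF that] Suc.prems have "b \<in> dec j" by simp
    then show ?thesis
    proof induction
      case (base x)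
      have "x \<in> alg (Suc j)" using base alg_mono by auto
      then show ?case
        unfolding g_sandwich[OF base lessI Suc.prems(2)]
        by (intro goodI[of x "Suc j" "a0 *s x"])
          (auto intro: alg.scale simp: distrib_right scale_mult_left)
    next
      case (gen x y)
      have xy: "x \<in> alg (Suc j)" "y \<in> alg (Suc j)" using gen by (auto intro: alg_mono)
      have "x * ?f * (?g * (?f * y * X)) \<in> good (Suc j)"
        using xy f by (intro good_mult L1 alg_mult)
      then show ?case
        unfolding g_sandwich_gen[OF gen Suc.prems(2)] by (simp add: mult.assoc)
    next
      case (add x y)
      then show ?case by (simp add: distrib_left distrib_right good_add)
    qed
  qed
  have "?g * x \<in> good (Suc j)" if x: "x \<in> good (Suc j)" for x
  proof -
    from x obtain a b where "a \<in> alg (Suc j)" "b \<in> alg (Suc j)" "x = a * X + b * ?g * X"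
      unfolding good_def by blast
    then show ?thesis using good_add[OF L1 L2, of a b] by (simp add: distrib_left mult.assoc)
  qed
  with Suc.prems(1) show ?case
  proof (induction rule: alg.induct)
    case one
    show ?case by (rule goodI[of 1 _ 0]) (use alg.one alg.scale[OF alg.one, of 0] in auto)
  next
    case (mult x i)
    then show ?case
      by (cases "i = Suc (Suc j)") (auto intro!: good_mult alg_g simp: mult.assoc)
  qed (auto intro: good_add good_scale simp: distrib_right scale_mult_left)
qed

lemma X_mult_alg:
  assumes "x \<in> alg (Suc j)" "Suc j < N"
  obtains a b where "a \<in> alg j" "b \<in> alg j" "X * x = X * a + X * (g (Suc j) * b)"
proof -
  have "sig x * X \<in> good j" using alg_mult_X alg_sig assms by blast
  then obtain a b where ab: "a \<in> alg j" "b \<in> alg j" "sig x * X = a * X + b * g (Suc j) * X"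
    unfolding good_def by blast
  have "X * x = X * sig a + X * (g (Suc j) * sig b)"
    using arg_cong[OF ab(3), of sig] assms(2) by (simp add: sig_mult sig_add sig_X sig_g)
  then show ?thesis using that ab alg_sig by blast
qed

section \<open>Words in distinct generators span X H X\<close>

abbreviation word :: "nat list \<Rightarrow> 'h" where "word ws \<equiv> prod_list (map g ws)"

lemma sig_word: "set ws \<subseteq> {0<..<N} \<Longrightarrow> sig (word ws) = word (rev ws)"
  by (induction ws) (auto simp: sig_mult sig_g)

definition cox :: "nat \<Rightarrow> 'h set" where
  "cox j = {X * word ws * X |ws. distinct ws \<and> set ws \<subseteq> {j<..<N}}"

lemma sig_span_cox: "x \<in> span (cox 0) \<Longrightarrow> sig x \<in> span (cox 0)"
proof (induction rule: span_induct_alt)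
  case (step c x y)
  from step(1) obtain ws where ws: "x = X * word ws * X" "distinct ws" "set ws \<subseteq> {0<..<N}"
    unfolding cox_def by blast
  have "sig x = X * word (rev ws) * X"
    using ws(1) sig_word[OF ws(3)] by (simp add: sig_mult sig_X mult.assoc)
  moreover have "distinct (rev ws)" "set (rev ws) \<subseteq> {0<..<N}" using ws by auto
  ultimately have "sig x \<in> cox 0" unfolding cox_def by blast
  with step show ?case by (auto simp: sig_add sig_scale intro: span_add span_scale span_base)
qed (simp add: span_zero)

lemma word_alg_commute:
  assumes "a \<in> alg j" "set ws \<subseteq> {Suc j<..<N}"
  shows "a * word ws = word ws * a"
  using assms(2)
proof (induction ws)
  case (Cons i ws)
  have "a * word (i # ws) = (a * g i) * word ws" by (simp add: mult.assoc)
  also have "a * g i = g i * a" using alg_commute[OF assms(1), of i] Cons.prems by simp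
  finally show ?case using Cons by (simp add: mult.assoc)
qed simp

text \<open>The top generator of \<open>a\<close> becomes the first letter of the word, and the
  factor \<open>c\<close> left behind it commutes with all later letters.\<close>

lemma X_alg_word_X:
  "a \<in> alg j \<Longrightarrow> j < N \<Longrightarrow> distinct ws \<Longrightarrow> set ws \<subseteq> {j<..<N} \<Longrightarrow> X * a * word ws * X \<in> span (cox 0)"
proof (induction j arbitrary: a ws)
  case 0
  have "X * word ws * X \<in> cox 0" using 0 unfolding cox_def by blast
  with 0(1) show ?case
    by (induction rule: alg.induct)
      (auto simp: distrib_left distrib_right scale_mult_left scale_mult_right intro: span_add span_scale span_base)
next
  case (Suc j)
  obtain b c where bc: "b \<in> alg j" "c \<in> alg j" "X * a = X * b + X * (g (Suc j) * c)"
    using X_mult_alg[OF Suc.prems(1,2)] .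
  have ws': "distinct (Suc j # ws)" "set (Suc j # ws) \<subseteq> {j<..<N}" "set ws \<subseteq> {j<..<N}"
    "set (Suc j # ws) \<subseteq> {0<..<N}"
    using Suc.prems by (auto simp: subset_iff intro: Suc_lessD)
  have 1: "X * b * word ws * X \<in> span (cox 0)"
    using Suc.IH[OF bc(1)] Suc.prems ws' by simp
  \<comment> \<open>Once shifted, \<open>c\<close> stands to the right of the word, but the
    induction hypothesis wants it on the left; \<open>sig\<close> mirrors the product, reverses the
    word and preserves the span.\<close>
  have "X * sig c * word (rev (Suc j # ws)) * X \<in> span (cox 0)"
    using ws' Suc.prems(2) by (intro Suc.IH alg_sig bc(2)) auto
  from sig_span_cox[OF this] have "X * word (Suc j # ws) * c * X \<in> span (cox 0)"
    unfolding sig_word[OF ws'(4), symmetric] sig_mult sig_sig sig_X by (simp only: mult.assoc)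
  also have "X * word (Suc j # ws) * c * X = X * (g (Suc j) * (c * word ws)) * X"
    using word_alg_commute[OF bc(2) Suc.prems(4)] by (simp add: mult.assoc)
  finally have "X * (g (Suc j) * c) * word ws * X \<in> span (cox 0)" by (simp add: mult.assoc)
  with 1 show ?case unfolding bc(3) by (auto simp: distrib_right intro: span_add)
qed

text \<open>Swapping commuting letters changes nothing; swapping other letters at an end changes
  \<open>X w X\<close> by two words with one of the swapped letters deleted, and these are fixed by
  \<open>sig\<close> through \<open>IH\<close>.\<close>

lemma shuffle_word:
  assumes "shuffle xs ys" "distinct xs" "set xs \<subseteq> {0<..<N}"
    and IH: "\<And>vs. length vs < length xs \<Longrightarrow> distinct vs \<Longrightarrow> set vs \<subseteq> {0<..<N} \<Longrightarrow>
      sig (X * word vs * X) = X * word vs * X"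
  shows "sig (X * word xs * X - X * word ys * X) = X * word xs * X - X * word ys * X"
  using assms
proof (induction rule: shuffle_induct)
  case (sym xs ys)
  have *: "mset xs = mset ys" using shuffle_mset[OF sym(1)] .
  have "sig (X * word xs * X - X * word ys * X) = X * word xs * X - X * word ys * X"
    using sym(3-) * by (intro sym.IH) (metis mset_eq_imp_distinct_iff mset_eq_setD mset_eq_length)+
  from arg_cong[OF this, of uminus] show ?case by (simp add: sig_diff)
next
  case (trans xs ys zs)
  have *: "mset xs = mset ys" using shuffle_mset[OF trans(1)] .
  have 1: "sig (X * word xs * X - X * word ys * X) = X * word xs * X - X * word ys * X"
    using trans.prems by (intro trans.IH(1))
  have 2: "sig (X * word ys * X - X * word zs * X) = X * word ys * X - X * word zs * X"
    using trans.prems * by (intro trans.IH(2)) (metis mset_eq_imp_distinct_iff mset_eq_setD mset_eq_length)+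
  have "X * word xs * X - X * word zs * X =
    (X * word xs * X - X * word ys * X) + (X * word ys * X - X * word zs * X)" by simp
  with 1 2 show ?case by (metis sig_add)
next
  case (commute i j xs ys)
  then have "g i * g j = g j * g i" by (intro g_commute) auto
  then show ?case by (simp flip: mult.assoc)
next
  case (left i j ys)
  have fix': "sig (X * word (i # ys) * X) = X * word (i # ys) * X"
    "sig (X * word (j # ys) * X) = X * word (j # ys) * X"
    using left by (intro left.prems(3); auto)+
  have *: "X * (g k * g l) * word ys * X - X * (g l * g k) * word ys * X =
    X * word (l # ys) * X - X * word (k # ys) * X" if "l = Suc k" "1 \<le> k" "l < N" for k l
    unfolding that(1) right_relation[OF that(2) that(3)[unfolded that(1)]]
    by (simp add: algebra_simps)
  consider "j = Suc i" | "i = Suc j" | "Suc i < j \<or> Suc j < i" using left(1) by fastforce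
  then show ?case
  proof cases
    case 1
    have "X * word (i # j # ys) * X - X * word (j # i # ys) * X =
        X * word (j # ys) * X - X * word (i # ys) * X"
      using *[of j i] 1 left by (simp add: mult.assoc)
    with fix' show ?thesis by (simp only: sig_diff)
  next
    case 2
    have "X * word (i # j # ys) * X - X * word (j # i # ys) * X =
        - (X * (g j * g i) * word ys * X - X * (g i * g j) * word ys * X)"
      by (simp add: mult.assoc)
    also have "\<dots> = X * word (j # ys) * X - X * word (i # ys) * X"
      using *[of i j] 2 left by simp
    finally have "X * word (i # j # ys) * X - X * word (j # i # ys) * X =
        X * word (j # ys) * X - X * word (i # ys) * X" .
    with fix' show ?thesis by (simp only: sig_diff)
  next
    case 3
    then have "g i * g j = g j * g i" using left by (intro g_commute) auto
    then show ?thesis by (simp flip: mult.assoc)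
  qed
next
  case (right xs i j)
  have fix': "sig (X * word (xs @ [i]) * X) = X * word (xs @ [i]) * X"
    "sig (X * word (xs @ [j]) * X) = X * word (xs @ [j]) * X"
    using right by (intro right.prems(3); auto)+
  have *: "X * word xs * (g l * g k * X) - X * word xs * (g k * g l * X) =
    X * word (xs @ [l]) * X - X * word (xs @ [k]) * X" if "l = Suc k" "1 \<le> k" "l < N" for k l
    unfolding that(1) left_relation[OF that(2) that(3)[unfolded that(1)]]
    by (simp add: algebra_simps)
  consider "j = Suc i" | "i = Suc j" | "Suc i < j \<or> Suc j < i" using right(1) by fastforce
  then show ?case
  proof cases
    case 1
    have "X * word (xs @ [i, j]) * X - X * word (xs @ [j, i]) * X =
        - (X * word xs * (g j * g i * X) - X * word xs * (g i * g j * X))"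
      by (simp add: mult.assoc)
    also have "\<dots> = X * word (xs @ [i]) * X - X * word (xs @ [j]) * X"
      using *[of j i] 1 right by simp
    finally have "X * word (xs @ [i, j]) * X - X * word (xs @ [j, i]) * X =
        X * word (xs @ [i]) * X - X * word (xs @ [j]) * X" .
    with fix' show ?thesis by (simp only: sig_diff)
  next
    case 2
    have "X * word (xs @ [i, j]) * X - X * word (xs @ [j, i]) * X =
        X * word (xs @ [i]) * X - X * word (xs @ [j]) * X"
      using *[of i j] 2 right by (simp add: mult.assoc)
    with fix' show ?thesis by (simp only: sig_diff)
  next
    case 3
    then have "g i * g j = g j * g i" using right by (intro g_commute) auto
    then show ?thesis by (simp flip: mult.assoc)
  qed
qed (simp_all)

lemma sig_cox_word:
  "distinct ws \<Longrightarrow> set ws \<subseteq> {0<..<N} \<Longrightarrow> sig (X * word ws * X) = X * word ws * X"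
proof (induction "length ws" arbitrary: ws rule: less_induct)
  case less
  let ?f = "X * word ws * X - sig (X * word ws * X)"
  \<comment> \<open>\<open>sig\<close> reverses the word, and the reverse has the same letters. So
    the defect \<open>?f\<close> is fixed by \<open>sig\<close>; being also negated by it, it
    satisfies 2 \<open>?f\<close> = 0.\<close>
  have "shuffle ws (rev ws)" using less.prems by (intro shuffle_all) auto
  from shuffle_word[OF this less.prems less.hyps]
  have "sig ?f = ?f"
    using sig_word[OF less.prems(2)] by (simp add: sig_mult sig_X mult.assoc)
  moreover have "sig ?f = - ?f" by (simp add: sig_diff)
  ultimately have "(1 + 1) *s ?f = 0" by (simp only: scale_left_distrib scale_one) (metis add.left_inverse)
  then show ?case by (simp del: one_add_one)
qed

lemma sig_X_mult_X: "sig (X * h * X) = X * h * X"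
proof -
  \<comment> \<open>All of \<open>h\<close> is taken as the prefix, in front of the empty
    word.\<close>
  have "X * h * word [] * X \<in> span (cox 0)"
    using N_pos by (intro X_alg_word_X[of h "N - 1"] alg_UNIV) auto
  then have "X * h * X \<in> span (cox 0)" by simp
  then show ?thesis
  proof (induction rule: span_induct_alt)
    case (step c x y)
    then show ?case by (auto simp: sig_add sig_scale cox_def sig_cox_word)
  qed simp
qed

text \<open>\<open>sig\<close> fixes the whole product and reverses it. The middle \<open>X\<close>
  serves both halves, and in each half \<open>X * sig h * X\<close> may be replaced by
  \<open>X * h * X\<close>.\<close>

lemma X_commute: "X * x * X * y * X = X * y * X * x * X"
proof -
  have *: "X * sig h * X = X * h * X" for h
    using sig_X_mult_X[of h] by (simp add: sig_mult sig_X mult.assoc)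
  have "X * x * X * y * X = sig (X * (x * X * y) * X)"
    using sig_X_mult_X[of "x * X * y"] by (simp add: mult.assoc)
  also have "\<dots> = (X * sig y * X) * (sig x * X)" by (simp add: sig_mult sig_X mult.assoc)
  also have "\<dots> = X * y * (X * sig x * X)" unfolding *[of y] by (simp add: mult.assoc)
  also have "\<dots> = X * y * X * x * X" unfolding *[of x] by (simp add: mult.assoc)
  finally show ?thesis .
qed

end

section \<open>Jucys--Murphy elements\<close>

text \<open>\<open>Y\<close> and \<open>Z\<close> stand for consecutive Jucys-Murphy elements,
  \<open>s\<close> for the generator between them, and \<open>f\<close> exchanges them. The left
  side of the last identity is the mirror image of \<open>f\<close>.\<close>

lemma ring_intertwiner:
  fixes s Y Z c :: "'a::ring_1"
  assumes s: "s * s = 1 + c * s" and c: "\<And>x. x * c = c * x" and YZ: "Z * Y = Y * Z" and Z: "Z = s * Y * s"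
  defines "f \<equiv> s * (Z - Y) - c * Z"
  shows "Z * s = s * Y + c * Z" "Y * s = s * Z - c * Z"
    "f * Y = Z * f" "f * Z = Y * f" "f * f = c * c * (Y * Z) - (Z - Y) * (Z - Y)"
    "(Z - Y) * s - c * Z = - f"
proof -
  show 1: "Z * s = s * Y + c * Z"
  proof -
    have "Z * s = s * Y * (s * s)" by (simp add: Z mult.assoc)
    also have "\<dots> = s * Y + (s * Y * c) * s" by (simp add: s distrib_left mult.assoc)
    also have "s * Y * c * s = c * Z" using c[of "s * Y"] by (simp add: Z mult.assoc)
    finally show ?thesis .
  qed
  show 2: "Y * s = s * Z - c * Z"
  proof -
    have "s * Z = (s * s) * (Y * s)" by (simp add: Z mult.assoc)
    also have "\<dots> = Y * s + c * Z" by (simp add: s distrib_right Z mult.assoc)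
    finally show ?thesis by simp
  qed
  have cr: "x * (c * r) = c * (x * r)" for x r by (metis c mult.assoc)
  have assocs: "Z * (s * r) = s * (Y * r) + c * (Z * r)" "Y * (s * r) = s * (Z * r) - c * (Z * r)"
    "s * (s * r) = r + c * (s * r)" "Z * (Y * r) = Y * (Z * r)" for r
    by (metis 1 distrib_right mult.assoc, metis 2 left_diff_distrib mult.assoc,
        metis s distrib_right mult.assoc mult_1, metis YZ mult.assoc)
  \<comment> \<open>As rewrite rules these move \<open>s\<close> to the left past \<open>Y\<close>
    and \<open>Z\<close> and the central \<open>c\<close> to the front, so both sides reach one
    normal form.\<close>
  note rules = 1 2 s YZ assocs c[of s] c[of Y] c[of Z] cr[of s] cr[of Y] cr[of Z]
    mult.assoc distrib_left distrib_right left_diff_distrib right_diff_distrib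
  show "f * Y = Z * f" "f * Z = Y * f" "(Z - Y) * s - c * Z = - f"
    unfolding f_def by (simp_all add: rules)
  show "f * f = c * c * (Y * Z) - (Z - Y) * (Z - Y)"
    unfolding f_def by (simp add: rules)
qed

context type_A_hecke
begin

text \<open>The multiplicative Jucys-Murphy elements, numbered from 0: \<open>jm k\<close> lies in
  \<open>alg k\<close> and belongs to entry \<open>k\<close> of a weight. A content c will appear as
  the eigenvalue \<open>qpow c\<close>, that is u^(2c).\<close>

fun jm :: "nat \<Rightarrow> 'h" where
  "jm 0 = 1"
| "jm (Suc k) = g (Suc k) * jm k * g (Suc k)"

lemma sig_jm: "k < N \<Longrightarrow> sig (jm k) = jm k"
  by (induction k) (auto simp: sig_mult sig_g mult.assoc)

lemma jm_alg: "k < N \<Longrightarrow> jm k \<in> alg k"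
  by (induction k) (auto intro!: alg_mult alg_g intro: alg_mono alg.one)

lemma jm_g_commute:
  assumes "1 \<le> i" "i < N" "k < N" "i \<noteq> k" "i \<noteq> Suc k"
  shows "g i * jm k = jm k * g i"
proof (cases "Suc k < i")
  case True
  with jm_alg assms show ?thesis by (intro alg_commute)
next
  case False
  with assms have "i < k" by simp
  with \<open>k < N\<close> show ?thesis
  proof (induction k)
    case (Suc k)
    show ?case
    proof (cases "i < k")
      case True
      then have "g i * g (Suc k) = g (Suc k) * g i" using Suc assms by (intro g_commute) auto
      moreover have "g i * jm k = jm k * g i" using Suc True by simp
      ultimately show ?thesis unfolding jm.simps by (metis mult.assoc)
    next
      case False
      then have k: "k = i" using Suc by simp
      \<comment> \<open>Only \<open>k = i\<close> is left. One braid move on each side of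
        \<open>jm j\<close> carries \<open>g i\<close> across, because \<open>jm j\<close> commutes
        with \<open>?h\<close>.\<close>
      obtain j where j: "i = Suc j" using assms(1) by (cases i) auto
      let ?h = "g (Suc i)"
      have br: "g i * ?h * g i = ?h * g i * ?h" using g_braid[OF assms(1)] Suc k by simp
      have c: "?h * jm j = jm j * ?h"
        using jm_alg[of j] assms(2) j k Suc.prems by (intro alg_commute[of _ j]) auto
      have "g i * jm (Suc k) = (g i * ?h * g i) * jm j * g i * ?h"
        by (simp add: k j mult.assoc)
      also have "\<dots> = (?h * g i * ?h) * jm j * g i * ?h" by (simp only: br)
      also have "\<dots> = ?h * g i * (?h * jm j) * g i * ?h" by (simp only: mult.assoc)
      also have "\<dots> = ?h * g i * (jm j * ?h) * g i * ?h" by (simp only: c)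
      also have "\<dots> = ?h * g i * jm j * (?h * g i * ?h)" by (simp only: mult.assoc)
      also have "\<dots> = ?h * g i * jm j * (g i * ?h * g i)" by (simp only: br)
      also have "\<dots> = jm (Suc k) * g i" by (simp add: k j mult.assoc)
      finally show ?thesis .
    qed
  qed simp
qed

lemma jm_commute:
  assumes "j < N" "k < N"
  shows "jm j * jm k = jm k * jm j"
proof -
  have *: "x * jm k = jm k * x" if "x \<in> alg j" "j < k" "k < N" for j k x
    using that
  proof (induction rule: alg.induct)
    case (mult x i)
    then have "g i * jm k = jm k * g i" by (intro jm_g_commute) auto
    with mult show ?case by (metis mult.assoc)
  qed (simp_all add: distrib_left distrib_right scale_mult_left scale_mult_right)
  consider "j < k" | "k < j" | "j = k" by linarith
  then show ?thesis using *[OF jm_alg] assms by cases simp_all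
qed

text \<open>The intertwiner of consecutive Jucys-Murphy elements with the denominator
  \<open>jm (Suc k) - jm k\<close> cleared, so that it exists in the algebra even where their
  eigenvalues coincide.\<close>

definition phi :: "nat \<Rightarrow> 'h" where
  "phi k = g (Suc k) * (jm (Suc k) - jm k) - a0 *s jm (Suc k)"

lemma jm_intertwine:
  assumes "Suc k < N"
  shows "jm k * g (Suc k) = g (Suc k) * jm (Suc k) - a0 *s jm (Suc k)"
    and "jm (Suc k) * g (Suc k) = g (Suc k) * jm k + a0 *s jm (Suc k)"
    and "phi k * jm k = jm (Suc k) * phi k" "phi k * jm (Suc k) = jm k * phi k"
    and "phi k * phi k = (a0 * a0) *s (jm k * jm (Suc k)) - (jm (Suc k) - jm k) * (jm (Suc k) - jm k)"
    and "sig (phi k) = - phi k"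
proof -
  have 1: "g (Suc k) * g (Suc k) = 1 + (a0 *s 1) * g (Suc k)"
    using g_quadratic[of "Suc k"] assms by (simp add: scale_mult_left)
  have 2: "x * (a0 *s 1) = (a0 *s 1) * x" for x
    by (simp only: scale_mult_left scale_mult_right mult_1_left mult_1_right)
  have 3: "jm (Suc k) * jm k = jm k * jm (Suc k)" using assms by (intro jm_commute) auto
  have sc: "(a0 *s 1) * x = a0 *s x" for x by (simp only: scale_mult_left mult_1_left)
  note R = ring_intertwiner[OF 1 2 3 jm.simps(2), unfolded sc phi_def[symmetric]]
  show "jm k * g (Suc k) = g (Suc k) * jm (Suc k) - a0 *s jm (Suc k)"
    "jm (Suc k) * g (Suc k) = g (Suc k) * jm k + a0 *s jm (Suc k)"
    "phi k * jm k = jm (Suc k) * phi k" "phi k * jm (Suc k) = jm k * phi k"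
    by (fact R)+
  show "phi k * phi k = (a0 * a0) *s (jm k * jm (Suc k)) - (jm (Suc k) - jm k) * (jm (Suc k) - jm k)"
    using R(5) by (simp only: scale_mult_left scale_scale mult_1_left)
  have "sig (phi k) = (jm (Suc k) - jm k) * g (Suc k) - a0 *s jm (Suc k)"
    unfolding phi_def using assms
    by (simp only: sig_diff sig_mult sig_scale sig_jm sig_g Suc_lessD One_nat_def[symmetric])
  then show "sig (phi k) = - phi k" using R(6) by simp
qed

text \<open>Since \<open>sig\<close> is the adjoint of a positive definite form, self-adjoint elements act semisimply.\<close>

lemma sig_fixed_power:
  assumes "sig w = w" "w ^ m * x = 0"
  shows "w * x = 0"
proof -
  have sq: "w * y = 0" if "w * (w * y) = 0" for y
  proof (rule sig_self_mult_eq_0)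
    show "sig (w * y) * (w * y) = 0" using that assms(1) by (simp add: sig_mult mult.assoc)
  qed
  from assms(2) show ?thesis
  proof (induction m)
    case (Suc m)
    show ?case
    proof (cases m)
      case (Suc m')
      with Suc.prems have "w * (w * (w ^ m' * x)) = 0" by (simp add: mult.assoc)
      from sq[OF this] Suc.IH show ?thesis by (simp add: Suc mult.assoc)
    qed (use Suc.prems in simp)
  qed simp
qed

section \<open>Spectra of the Jucys-Murphy elements\<close>

definition qpow :: "int \<Rightarrow> 'k" where "qpow c = (u * u) powi c"

lemma qpow_0 [simp]: "qpow 0 = 1" by (simp add: qpow_def)

lemma uu_gt_1: "1 < u * u" using u_gt_1 by (simp add: less_1_mult)

lemma qpow_pos: "0 < qpow c" using uu_gt_1 by (simp add: qpow_def)

lemma qpow_nonzero [simp]: "qpow c \<noteq> 0" using qpow_pos[of c] by simp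

lemma qpow_inj [simp]: "qpow b = qpow c \<longleftrightarrow> b = c"
  using power_int_strict_increasing[of b c "u * u"] power_int_strict_increasing[of c b "u * u"] uu_gt_1
  by (cases b c rule: linorder_cases) (auto simp: qpow_def)

lemma qpow_add_1: "qpow (c + 1) = u * u * qpow c"
  using u_pos by (simp add: qpow_def power_int_add)

lemma qpow_diff_1: "qpow (c - 1) = qpow c / (u * u)"
  using u_pos by (simp add: qpow_def power_int_diff)

lemma a0_pos: "0 < a0" using u_gt_1 by (simp add: inverse_less_1_iff less_trans[of _ 1])

text \<open>In terms of the eigenvalues \<open>y\<close>, \<open>z\<close> of two consecutive Jucys--Murphy elements, the square
  of the intertwiner is \<open>- (z - u\<^sup>2 y) (z - u\<^sup>-\<^sup>2 y)\<close>.\<close>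

lemma phi_square_scalar:
  "a0 * a0 * (y * z) - (z - y) * (z - y) = - ((z - u * u * y) * (z - y / (u * u)))"
  using u_pos by (simp add: field_simps)

definition pol :: "'h \<Rightarrow> 'k list \<Rightarrow> 'h" where
  "pol w cs = prod_list (map (\<lambda>c. w - c *s 1) cs)"

lemma pol_simps [simp]:
  "pol w [] = 1" "pol w (c # cs) = (w - c *s 1) * pol w cs" "pol w (as @ bs) = pol w as * pol w bs"
  by (simp_all add: pol_def)

lemma pol_intertwine: "x * w = w' * x \<Longrightarrow> x * pol w cs = pol w' cs * x"
proof (induction cs)
  case (Cons c cs)
  have "x * ((w - c *s 1) * pol w cs) = (w' - c *s 1) * (x * pol w cs)"
    using Cons.prems by (simp add: scale_mult_left scale_mult_right algebra_simps flip: mult.assoc)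
  then show ?case using Cons by (simp add: mult.assoc)
qed simp

lemma pol_commute: "x * w = w * x \<Longrightarrow> x * pol w cs = pol w cs * x"
  by (rule pol_intertwine)

lemma sig_pol: "sig w = w \<Longrightarrow> sig (pol w cs) = pol w cs"
proof (induction cs)
  case (Cons c cs)
  have "(w - c *s 1) * pol w cs = pol w cs * (w - c *s 1)"
    by (rule pol_commute) (simp add: algebra_simps scale_mult_left scale_mult_right)
  with Cons show ?case by (simp add: sig_mult sig_diff sig_scale)
qed simp

text \<open>Isolates the root \<open>c\<close> with its multiplicity, which semisimplicity later
  reduces to one.\<close>

lemma pol_filter:
  "\<exists>m. pol w cs = (w - c *s 1) ^ m * pol w (filter (\<lambda>d. d \<noteq> c) cs)"
proof (induction cs)
  case Nil
  show ?case by (rule exI[of _ 0]) simp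
next
  case (Cons d cs)
  then obtain m where m: "pol w cs = (w - c *s 1) ^ m * pol w (filter (\<lambda>d. d \<noteq> c) cs)" by blast
  show ?case
  proof (cases "d = c")
    case True
    with m show ?thesis by (intro exI[of _ "Suc m"]) (simp add: mult.assoc)
  next
    case False
    have "(w - d *s 1) * (w - c *s 1) ^ m = (w - c *s 1) ^ m * (w - d *s 1)"
      by (rule power_commuting_commutes[symmetric]) (simp add: algebra_simps scale_mult_left scale_mult_right)
    with m False show ?thesis by (intro exI[of _ m]) (simp flip: mult.assoc)
  qed
qed

text \<open>Where \<open>Y\<close> acts by \<open>c\<close>, the quadratic relation forces
  \<open>Z\<close> to be u^2 c or u^(-2) c. The vector \<open>x\<close> is arbitrary because the
  induction applies the statement to \<open>(Y - c *s 1) * x\<close>.\<close>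

lemma pol_eliminate:
  assumes YZ: "Z * Y = Y * Z"
  shows "pol Y cs * x = 0 \<Longrightarrow> (Z - (u * u) *s Y) * (Z - inverse (u * u) *s Y) * x = 0 \<Longrightarrow>
    pol Z (concat (map (\<lambda>c. [u * u * c, inverse (u * u) * c]) cs)) * x = 0"
proof (induction cs arbitrary: x)
  case (Cons c cs)
  define Q where "Q = (Z - (u * u) *s Y) * (Z - inverse (u * u) *s Y)"
  define D where "D = pol Z (concat (map (\<lambda>c. [u * u * c, inverse (u * u) * c]) cs))"
  have YQ: "Y * Q = Q * Y"
    unfolding Q_def using YZ
    by (simp add: algebra_simps scale_mult_left scale_mult_right) (metis mult.assoc)
  have ZQ: "Z * Q = Q * Z"
    unfolding Q_def using YZ
    by (simp add: algebra_simps scale_mult_left scale_mult_right) (metis mult.assoc)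
  have YD: "Y * D = D * Y" unfolding D_def by (rule pol_commute) (simp add: YZ)
  have QD: "Q * D = D * Q" unfolding D_def by (rule pol_commute) (simp add: ZQ)
  have Yc: "(Y - c *s 1) * pol Y cs = pol Y cs * (Y - c *s 1)"
    by (rule pol_commute) (simp add: algebra_simps scale_mult_left scale_mult_right)
  have "pol Y cs * ((Y - c *s 1) * x) = 0"
    using Cons.prems(1) Yc by (simp flip: mult.assoc)
  moreover have "Q * ((Y - c *s 1) * x) = (Y - c *s 1) * (Q * x)"
    using YQ by (simp add: algebra_simps scale_mult_left scale_mult_right flip: mult.assoc)
  ultimately have "D * ((Y - c *s 1) * x) = 0"
    using Cons.IH[of "(Y - c *s 1) * x"] Cons.prems(2) unfolding D_def Q_def by simp
  then have Y: "Y * (D * x) = c *s (D * x)"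
    using YD by (simp add: algebra_simps scale_mult_left scale_mult_right flip: mult.assoc)
  have "(Z - (u * u * c) *s 1) * ((Z - (inverse (u * u) * c) *s 1) * (D * x)) = Q * (D * x)"
  proof -
    define r where "r = (Z - (inverse (u * u) * c) *s 1) * (D * x)"
    have r: "(Z - inverse (u * u) *s Y) * (D * x) = r"
      unfolding r_def using Y by (simp only: left_diff_distrib scale_mult_left mult_1_left scale_scale)
    have "Y * r = (Z - (inverse (u * u) * c) *s 1) * (Y * (D * x))"
      unfolding r_def using YZ
      by (simp add: left_diff_distrib right_diff_distrib scale_mult_left scale_mult_right flip: mult.assoc)
    then have Yr: "Y * r = c *s r" by (simp only: Y scale_mult_right r_def)
    have "Q * (D * x) = (Z - (u * u) *s Y) * r" unfolding Q_def by (simp only: mult.assoc r[symmetric])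
    also have "\<dots> = (Z - (u * u * c) *s 1) * r"
      by (simp only: left_diff_distrib scale_mult_left mult_1_left Yr scale_scale)
    finally show ?thesis unfolding r_def by simp
  qed
  also have "\<dots> = 0" using QD Cons.prems(2) by (metis Q_def mult.assoc mult_zero_right)
  finally show ?case by (simp add: D_def mult.assoc)
qed simp

text \<open>Let \<open>?G\<close> be the polynomial of \<open>jm k\<close> evaluated at
  \<open>jm (Suc k)\<close>. Intertwining gives \<open>?G * (phi k * phi k) = 0\<close>, and the
  square of \<open>phi k\<close> is \<open>- ?Q\<close>; elimination on the image of
  \<open>?G\<close> then adds the exponents c + 1 and c - 1 to the old ones.\<close>

lemma jm_annihilated: "k < N \<Longrightarrow> \<exists>cs. pol (jm k) (map qpow cs) = 0"
proof (induction k)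
  case 0
  show ?case by (rule exI[of _ "[0]"]) simp
next
  case (Suc k)
  then obtain cs where cs: "pol (jm k) (map qpow cs) = 0" by auto
  let ?Y = "jm k" and ?Z = "jm (Suc k)" and ?G = "pol (jm (Suc k)) (map qpow cs)"
  let ?Q = "(?Z - (u * u) *s ?Y) * (?Z - inverse (u * u) *s ?Y)"
  note I = jm_intertwine[OF Suc.prems]
  have YZ: "?Z * ?Y = ?Y * ?Z" using Suc.prems by (intro jm_commute) auto
  have "phi k * pol ?Y (map qpow cs) = ?G * phi k" by (rule pol_intertwine) (rule I(3))
  then have "?G * (phi k * phi k) = 0" using cs by (simp flip: mult.assoc)
  moreover have "phi k * phi k = - ?Q"
  proof -
    have "- ?Q = (u * u + inverse (u * u)) *s (?Y * ?Z) - ?Z * ?Z - ?Y * ?Y"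
    proof -
      have *: "- ((?Z - q *s ?Y) * (?Z - q' *s ?Y)) = (q + q') *s (?Y * ?Z) - ?Z * ?Z - ?Y * ?Y"
        if "q * q' = 1" for q q'
        using that by (simp add: scale_mult_left scale_mult_right left_diff_distrib right_diff_distrib
            scale_right_diff_distrib YZ scale_left_distrib mult.commute[of q' q] del: jm.simps)
      show ?thesis using u_pos by (intro *) (simp add: field_simps)
    qed
    moreover have "u * u + inverse (u * u) = a0 * a0 + 2" using u_pos by (simp add: field_simps)
    moreover have "(a0 * a0 + 2) *s r = (a0 * a0) *s r + r + r" for r
      by (simp only: scale_left_distrib scale_one add.assoc one_add_one[symmetric])
    moreover have "(?Z - ?Y) * (?Z - ?Y) = ?Z * ?Z - ?Y * ?Z - ?Y * ?Z + ?Y * ?Y"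
      by (simp add: left_diff_distrib right_diff_distrib YZ del: jm.simps)
    ultimately show ?thesis
      unfolding I(5) by (simp only: diff_diff_eq2 diff_conv_add_uminus minus_add_distrib minus_minus ac_simps)
  qed
  ultimately have "?G * ?Q = 0" by simp
  moreover have "?Z * (?Z - c *s ?Y) = (?Z - c *s ?Y) * ?Z" for c
    by (simp add: left_diff_distrib right_diff_distrib scale_mult_left scale_mult_right YZ del: jm.simps)
  then have "?Z * ?Q = ?Q * ?Z" by (metis mult.assoc)
  then have "?Q * ?G = ?G * ?Q" by (intro pol_commute) simp
  ultimately have "?Q * ?G = 0" by simp
  moreover have "pol ?Y (map qpow cs) * ?G = 0" using cs by simp
  ultimately have "pol ?Z (concat (map (\<lambda>c. [u * u * c, inverse (u * u) * c]) (map qpow cs))) * ?G = 0"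
    by (intro pol_eliminate[OF YZ])
  also have "concat (map (\<lambda>c. [u * u * c, inverse (u * u) * c]) (map qpow cs)) =
    map qpow (concat (map (\<lambda>c. [c + 1, c - 1]) cs))"
    by (induction cs) (auto simp: qpow_add_1 qpow_diff_1 field_simps)
  finally have "pol ?Z (map qpow (concat (map (\<lambda>c. [c + 1, c - 1]) cs) @ cs)) = 0" by simp
  then show ?case by blast
qed

end

section \<open>Weights of a simple module\<close>

context type_A_hecke
begin

lemma phi_eigen:
  assumes "Suc k < N" "jm k * f = y *s f" "jm (Suc k) * f = z *s f"
  shows "phi k * f = (z - y) *s (g (Suc k) * f) - (a0 * z) *s f"
    and "phi k * (phi k * f) = - ((z - u * u * y) * (z - y / (u * u))) *s f"
proof -
  show "phi k * f = (z - y) *s (g (Suc k) * f) - (a0 * z) *s f"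
    unfolding phi_def left_diff_distrib mult.assoc assms right_diff_distrib scale_mult_left scale_mult_right
      scale_left_diff_distrib[of z y] scale_scale ..
  have d: "(jm (Suc k) - jm k) * f = (z - y) *s f"
    by (simp only: left_diff_distrib assms scale_left_diff_distrib)
  have "phi k * (phi k * f) = (a0 * a0) *s (jm k * (jm (Suc k) * f)) -
    (jm (Suc k) - jm k) * ((jm (Suc k) - jm k) * f)"
    using arg_cong[OF jm_intertwine(5)[OF assms(1)], of "\<lambda>x. x * f"]
    by (simp only: left_diff_distrib[of _ _ f] mult.assoc scale_mult_left)
  also have "\<dots> = (a0 * a0 * (y * z) - (z - y) * (z - y)) *s f"
    by (simp only: d assms scale_mult_right scale_scale)
      (simp only: scale_left_diff_distrib[of _ _ f] mult_ac)
  finally show "phi k * (phi k * f) = - ((z - u * u * y) * (z - y / (u * u))) *s f"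
    by (simp only: phi_square_scalar)
qed

text \<open>\<open>phi k\<close> is skew under \<open>sig\<close> and its square kills
  \<open>f\<close>, so \<open>phi k * f\<close> is isotropic. The argument is made for
  \<open>f\<close> in the algebra, where the form lives.\<close>

lemma phi_eigen_0:
  assumes "Suc k < N" "jm k * f = y *s f" "jm (Suc k) * f = z *s f"
    and "z = u * u * y \<or> y = u * u * z"
  shows "phi k * f = 0"
proof (rule sig_self_mult_eq_0)
  have "(z - u * u * y) * (z - y / (u * u)) = 0" using assms(4) u_pos by auto
  then have "phi k * (phi k * f) = 0" using phi_eigen(2)[OF assms(1-3)] by simp
  then show "sig (phi k * f) * (phi k * f) = 0"
    using jm_intertwine(6)[OF assms(1)] by (simp add: sig_mult mult.assoc)
qed

lemma adjacent_up:
  assumes "Suc k < N" "jm k * f = qpow c *s f" "jm (Suc k) * f = qpow (c + 1) *s f"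
  shows "g (Suc k) * f = u *s f"
proof -
  have "phi k * f = 0" by (rule phi_eigen_0[OF assms]) (simp only: qpow_add_1, simp)
  then have "(qpow (c + 1) - qpow c) *s (g (Suc k) * f) = (a0 * qpow (c + 1)) *s f"
    using phi_eigen(1)[OF assms] by simp
  also have "a0 * qpow (c + 1) = (qpow (c + 1) - qpow c) * u"
    using u_pos unfolding qpow_add_1 by (simp add: field_simps)
  finally have "(qpow (c + 1) - qpow c) *s (g (Suc k) * f) = (qpow (c + 1) - qpow c) *s u *s f"
    by (simp only: scale_scale)
  moreover have "qpow (c + 1) - qpow c \<noteq> 0" by simp
  ultimately show ?thesis by (metis scale_left_imp_eq)
qed

lemma adjacent_down:
  assumes "Suc k < N" "jm k * f = qpow c *s f" "jm (Suc k) * f = qpow (c - 1) *s f"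
  shows "g (Suc k) * f = (- inverse u) *s f"
proof -
  have "phi k * f = 0"
    by (rule phi_eigen_0[OF assms]) (use u_pos in \<open>simp only: qpow_diff_1, simp\<close>)
  then have "(qpow (c - 1) - qpow c) *s (g (Suc k) * f) = (a0 * qpow (c - 1)) *s f"
    using phi_eigen(1)[OF assms] by simp
  also have "a0 * qpow (c - 1) = (qpow (c - 1) - qpow c) * (- inverse u)"
    using u_pos unfolding qpow_diff_1 by (simp add: field_simps)
  finally have "(qpow (c - 1) - qpow c) *s (g (Suc k) * f) = (qpow (c - 1) - qpow c) *s (- inverse u) *s f"
    by (simp only: scale_scale)
  moreover have "qpow (c - 1) - qpow c \<noteq> 0" by simp
  ultimately show ?thesis by (metis scale_left_imp_eq)
qed

text \<open>Equal consecutive eigenvalues would give \<open>jm k\<close> a Jordan block on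
  \<open>f\<close> and \<open>g (Suc k) * f\<close>, which an element fixed by \<open>sig\<close>
  cannot have.\<close>

lemma adjacent_equal:
  assumes "Suc k < N" "jm k * f = qpow c *s f" "jm (Suc k) * f = qpow c *s f"
  shows "f = 0"
proof -
  let ?w = "jm k - qpow c *s 1"
  have "jm k * (g (Suc k) * f) = (jm k * g (Suc k)) * f" by (simp add: mult.assoc)
  also have "\<dots> = qpow c *s (g (Suc k) * f) - (a0 * qpow c) *s f"
    unfolding jm_intertwine(1)[OF assms(1)]
    by (simp only: left_diff_distrib mult.assoc assms scale_mult_left scale_mult_right scale_scale)
  finally have 1: "?w * (g (Suc k) * f) = - (a0 * qpow c) *s f"
    by (simp only: left_diff_distrib scale_mult_left mult_1_left scale_minus_left) simp
  have wf: "?w * f = 0"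
    by (simp only: left_diff_distrib scale_mult_left mult_1_left assms) simp
  have "?w ^ 2 * (g (Suc k) * f) = ?w * (?w * (g (Suc k) * f))"
    by (simp add: power2_eq_square mult.assoc)
  also have "\<dots> = - (a0 * qpow c) *s (?w * f)" by (simp only: 1 scale_mult_right)
  finally have "?w ^ 2 * (g (Suc k) * f) = 0" by (simp only: wf scale_zero_right)
  moreover have "sig ?w = ?w" using assms(1) by (simp add: sig_diff sig_scale sig_jm)
  ultimately have "?w * (g (Suc k) * f) = 0" using sig_fixed_power[of ?w 2] by blast
  with 1 have "- (a0 * qpow c) *s f = 0" by simp
  then have "a0 * qpow c = 0 \<or> f = 0" by (simp only: scale_eq_0_iff neg_equal_0_iff_equal)
  then show ?thesis using a0_pos by auto
qed

text \<open>On a common eigenvector the two sides of the braid relation act by -l and 1/l, and l^2 =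
  -1 has no solution in an ordered field.\<close>

lemma zigzag_zero:
  assumes "1 \<le> i" "Suc i < N" "l \<noteq> 0" "g i * f = l *s f" "g (Suc i) * f = (- inverse l) *s f"
  shows "f = 0"
proof -
  have "g i * g (Suc i) * g i * f = g i * (g (Suc i) * (g i * f))" by (simp add: mult.assoc)
  also have "\<dots> = (l * (- inverse l * l)) *s f"
    by (simp only: assms(4,5) scale_mult_right scale_scale mult_ac)
  finally have 1: "g i * g (Suc i) * g i * f = (- l) *s f" using assms(3) by simp
  have "g (Suc i) * g i * g (Suc i) * f = g (Suc i) * (g i * (g (Suc i) * f))" by (simp add: mult.assoc)
  also have "\<dots> = (- inverse l * (l * (- inverse l))) *s f"
    by (simp only: assms(4,5) scale_mult_right scale_scale mult_ac)
  finally have "g (Suc i) * g i * g (Suc i) * f = inverse l *s f" using assms(3) by simp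
  with 1 g_braid[OF assms(1,2)] have "(- l) *s f = inverse l *s f" by metis
  then have "f = 0 \<or> - l = inverse l" by (simp only: scale_cancel_right) blast
  moreover have "- l \<noteq> inverse l"
  proof
    assume "- l = inverse l"
    then have "- (l * l) = 1" using assms(3) by (metis mult_minus_left left_inverse)
    moreover have "0 \<le> l * l" by simp
    ultimately show False by (metis neg_0_le_iff_le not_one_le_zero minus_equation_iff)
  qed
  ultimately show ?thesis by blast
qed

end

locale type_A_hecke_module = type_A_hecke scale N u t + left_module act
  for scale :: "'k::linordered_field \<Rightarrow> 'h::ring_1 \<Rightarrow> 'h" (infixr "*s" 75)
    and N :: nat and u :: 'k and t :: "(nat \<Rightarrow> nat) \<Rightarrow> 'h"
    and act :: "'h \<Rightarrow> 'e::ab_group_add \<Rightarrow> 'e" +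
  assumes nonzero: "\<exists>v::'e. v \<noteq> 0"
    and simple: "left_submodule act M \<Longrightarrow> M = {0} \<or> M = UNIV"
begin

definition smul :: "'k \<Rightarrow> 'e \<Rightarrow> 'e" where "smul c e = act (c *s 1) e"

lemma act_0_right [simp]: "act x 0 = 0"
  using act_add_right[of x 0 0] by simp

lemma act_0_left [simp]: "act 0 e = 0"
  using act_add_left[of 0 0 e] by simp

lemma act_minus_left: "act (- x) e = - act x e"
  using act_add_left[of x "- x" e] by (simp add: minus_unique)

lemma act_diff_left: "act (x - y) e = act x e - act y e"
  using act_add_left[of x "- y" e] by (simp add: act_minus_left)

lemma act_scale: "act (c *s x) e = smul c (act x e)"
  using act_mult[of "c *s 1" x e] by (simp add: smul_def scale_mult_left)

lemma act_smul: "act x (smul c e) = smul c (act x e)"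
  unfolding smul_def
  by (simp only: act_mult[symmetric] scale_mult_left scale_mult_right mult_1_left mult_1_right)

sublocale E: vector_space smul
proof
  show "smul a (x + y) = smul a x + smul a y" for a x y by (simp add: smul_def act_add_right)
  show "smul (a + b) x = smul a x + smul b x" for a b x
    by (simp add: smul_def act_add_left scale_left_distrib)
  show "smul a (smul b x) = smul (a * b) x" for a b x
    by (simp add: smul_def scale_mult_left flip: act_mult)
  show "smul 1 x = x" for x by (simp add: smul_def act_one)
qed

lemma cyclic:
  assumes "e \<noteq> 0"
  obtains h where "act h e = f"
proof -
  have "left_submodule act (range (\<lambda>h. act h e))"
    unfolding left_submodule_def
  proof (intro conjI ballI allI)
    show "0 \<in> range (\<lambda>h. act h e)" by (metis act_0_left rangeI)
  next
    fix x y assume "x \<in> range (\<lambda>h. act h e)" "y \<in> range (\<lambda>h. act h e)"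
    then show "x + y \<in> range (\<lambda>h. act h e)" by (auto simp: act_add_left[symmetric])
  next
    fix x y assume "y \<in> range (\<lambda>h. act h e)"
    then show "act x y \<in> range (\<lambda>h. act h e)" by (auto simp: act_mult[symmetric])
  qed
  moreover have "e \<in> range (\<lambda>h. act h e)" by (metis act_one rangeI)
  ultimately have "range (\<lambda>h. act h e) = UNIV" using simple assms by blast
  then show ?thesis using that by (metis UNIV_I imageE)
qed

text \<open>The eigenvector is a polynomial in \<open>w\<close> applied to \<open>v\<close>, so
  eigenvalues of \<open>v\<close> under elements commuting with \<open>w\<close> survive.\<close>

lemma pol_eigen:
  assumes "v \<noteq> 0" "act (pol w cs) v = 0"
  shows "\<exists>c\<in>set cs. \<exists>ds. act (pol w ds) v \<noteq> 0 \<and> act w (act (pol w ds) v) = smul c (act (pol w ds) v)"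
  using assms
proof (induction cs)
  case (Cons c cs)
  show ?case
  proof (cases "act (pol w cs) v = 0")
    case False
    have "act w (act (pol w cs) v) = smul c (act (pol w cs) v)"
      using Cons.prems(2) by (simp add: act_mult act_diff_left act_scale act_one)
    with False show ?thesis by auto
  qed (use Cons in auto)
qed (simp add: act_one)

lemma act_pol_eigen:
  assumes "act w v = smul c v" "c \<notin> set ds"
  shows "\<exists>\<kappa>. \<kappa> \<noteq> 0 \<and> act (pol w ds) v = smul \<kappa> v"
  using assms(2)
proof (induction ds)
  case Nil
  show ?case by (rule exI[of _ 1]) (simp add: act_one)
next
  case (Cons d ds)
  then obtain \<kappa> where "\<kappa> \<noteq> 0" "act (pol w ds) v = smul \<kappa> v" by auto
  then have "act (pol w (d # ds)) v = smul (\<kappa> * (c - d)) v"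
    by (simp add: act_mult act_diff_left act_scale act_one act_smul assms(1) algebra_simps)
  with \<open>\<kappa> \<noteq> 0\<close> Cons.prems show ?case by (intro exI[of _ "\<kappa> * (c - d)"]) auto
qed

text \<open>The list may be shorter than \<open>N\<close>, so that joint eigenvectors can be built
  one Jucys-Murphy element at a time.\<close>

definition wvec :: "int list \<Rightarrow> 'e \<Rightarrow> bool" where
  "wvec a v \<longleftrightarrow> v \<noteq> 0 \<and> (\<forall>k<length a. act (jm k) v = smul (qpow (a ! k)) v)"

definition weights :: "int list set" where
  "weights = {a. length a = N \<and> (\<exists>v. wvec a v)}"

lemma wvec_exists: "k \<le> N \<Longrightarrow> \<exists>a v. length a = k \<and> wvec a v"
proof (induction k)
  case 0
  then show ?case using nonzero by (auto simp: wvec_def)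
next
  case (Suc k)
  then obtain a v where a: "length a = k" "wvec a v" by auto
  obtain cs where "pol (jm k) (map qpow cs) = 0" using jm_annihilated[of k] Suc.prems by auto
  then obtain c ds where w: "act (pol (jm k) ds) v \<noteq> 0"
    "act (jm k) (act (pol (jm k) ds) v) = smul (qpow c) (act (pol (jm k) ds) v)"
    using pol_eigen[of v "jm k" "map qpow cs"] a(2) by (auto simp: wvec_def)
  have "act (jm i) (act (pol (jm k) ds) v) = smul (qpow (a ! i)) (act (pol (jm k) ds) v)" if "i < k" for i
  proof -
    have "jm i * pol (jm k) ds = pol (jm k) ds * jm i"
      using that Suc.prems by (intro pol_commute jm_commute) auto
    then have "act (jm i) (act (pol (jm k) ds) v) = act (pol (jm k) ds) (act (jm i) v)"
      by (metis act_mult)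
    with a that show ?thesis by (simp add: wvec_def act_smul)
  qed
  with w a(1) have "wvec (a @ [c]) (act (pol (jm k) ds) v)"
    by (auto simp: wvec_def nth_append less_Suc_eq)
  with a(1) show ?case by (intro exI[of _ "a @ [c]"] exI[of _ "act (pol (jm k) ds) v"]) simp
qed

lemma weights_nonempty: "\<exists>a. a \<in> weights"
  using wvec_exists[of N] by (auto simp: weights_def)

text \<open>Turns a weight vector of E into an element of the algebra with the same eigenvalues,
  where the form is available. Each factor is the annihilating polynomial of one \<open>jm k\<close>
  without the root in question; semisimplicity makes it an eigenelement. The commutation clause lets
  the factors be rearranged in the induction.\<close>

lemma weight_projector_aux:
  assumes "length a = N" "wvec a v" "m \<le> N"
  shows "\<exists>f \<kappa>. sig f = f \<and> (\<forall>k<m. jm k * f = qpow (a ! k) *s f) \<and> \<kappa> \<noteq> 0 \<and> act f v = smul \<kappa> v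
    \<and> (\<forall>x. (\<forall>k<N. x * jm k = jm k * x) \<longrightarrow> x * f = f * x)"
  using assms(3)
proof (induction m)
  case 0
  show ?case by (rule exI[of _ 1], rule exI[of _ 1]) (simp add: act_one)
next
  case (Suc m)
  then obtain f \<kappa> where f: "sig f = f" "\<forall>k<m. jm k * f = qpow (a ! k) *s f" "\<kappa> \<noteq> 0" "act f v = smul \<kappa> v"
    "\<And>x. (\<forall>k<N. x * jm k = jm k * x) \<Longrightarrow> x * f = f * x" by auto
  let ?c = "qpow (a ! m)"
  obtain cs where cs: "pol (jm m) (map qpow cs) = 0" using jm_annihilated[of m] Suc.prems by auto
  define ds where "ds = filter (\<lambda>d. d \<noteq> ?c) (map qpow cs)"
  define h where "h = pol (jm m) ds"
  have jj: "jm k * jm m = jm m * jm k" if "k < N" for k using that Suc.prems by (intro jm_commute) auto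
  have hc: "x * h = h * x" if "x * jm m = jm m * x" for x
    unfolding h_def using that by (rule pol_commute)
  obtain r where "(jm m - ?c *s 1) ^ r * h = 0"
    using pol_filter[of "jm m" "map qpow cs" ?c] cs unfolding h_def ds_def by metis
  moreover have "sig (jm m - ?c *s 1) = jm m - ?c *s 1"
    using Suc.prems by (simp add: sig_diff sig_scale sig_jm)
  ultimately have "(jm m - ?c *s 1) * h = 0" by (rule sig_fixed_power[rotated])
  then have jh: "jm m * h = ?c *s h" by (simp add: left_diff_distrib scale_mult_left)
  have hf: "h * f = f * h" by (rule f(5)) (use hc jj in metis)
  obtain \<kappa>' where k': "\<kappa>' \<noteq> 0" "act h v = smul \<kappa>' v"
    using act_pol_eigen[of "jm m" v ?c ds] assms(1,2) Suc.prems unfolding h_def wvec_def ds_def by auto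
  show ?case
  proof (intro exI conjI allI impI)
    show "sig (h * f) = h * f"
      using hf f(1) Suc.prems by (simp add: sig_mult h_def sig_pol sig_jm)
    show "jm k * (h * f) = qpow (a ! k) *s (h * f)" if "k < Suc m" for k
    proof (cases "k = m")
      case True
      with jh show ?thesis by (simp add: scale_mult_left flip: mult.assoc)
    next
      case False
      with that have "k < m" by simp
      then have "jm k * (h * f) = h * (jm k * f)"
        using hc[OF jj[of k]] Suc.prems by (metis less_trans Suc_le_lessD mult.assoc)
      with f(2) \<open>k < m\<close> show ?thesis by (simp add: scale_mult_right)
    qed
    show "\<kappa>' * \<kappa> \<noteq> 0" using k' f(3) by simp
    show "act (h * f) v = smul (\<kappa>' * \<kappa>) v"
      by (simp add: act_mult f(4) act_smul k'(2) mult.commute)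
    show "x * (h * f) = h * f * x" if "\<forall>k<N. x * jm k = jm k * x" for x
      using hc[of x] f(5)[OF that] that Suc.prems by (metis Suc_le_lessD mult.assoc)
  qed
qed

lemma weight_projector:
  assumes "a \<in> weights"
  obtains f v \<kappa> where "sig f = f" "\<And>k. k < N \<Longrightarrow> jm k * f = qpow (a ! k) *s f"
    "\<kappa> \<noteq> 0" "act f v = smul \<kappa> v" "v \<noteq> 0" "f \<noteq> 0"
proof -
  obtain v where a: "length a = N" "wvec a v" using assms by (auto simp: weights_def)
  obtain f \<kappa> where f: "sig f = f" "\<And>k. k < N \<Longrightarrow> jm k * f = qpow (a ! k) *s f" "\<kappa> \<noteq> 0" "act f v = smul \<kappa> v"
    using weight_projector_aux[OF a order_refl] by metis
  moreover have "v \<noteq> 0" using a by (simp add: wvec_def)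
  moreover from this f have "f \<noteq> 0" by auto
  ultimately show ?thesis using that by metis
qed

lemma weights_first:
  assumes "x # xs \<in> weights"
  shows "x = 0"
proof -
  obtain f where "jm 0 * f = qpow x *s f" "f \<noteq> 0"
    using weight_projector[OF assms] N_pos by (metis Suc_le_lessD One_nat_def nth_Cons_0)
  then have "1 *s f = qpow x *s f" "f \<noteq> 0" by simp_all
  then have "qpow x = qpow 0" by (metis scale_cancel_right qpow_0)
  then show ?thesis by (simp only: qpow_inj)
qed

lemma weights_not_equal: "as @ x # x # bs \<notin> weights"
proof
  assume a: "as @ x # x # bs \<in> weights"
  then have l: "Suc (length as) < N" by (auto simp: weights_def)
  obtain f where f: "\<And>k. k < N \<Longrightarrow> jm k * f = qpow ((as @ x # x # bs) ! k) *s f" "f \<noteq> 0"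
    using weight_projector[OF a] by metis
  from f(1)[of "length as"] f(1)[of "Suc (length as)"] l
  have "f = 0" by (intro adjacent_equal[OF l]) (auto simp: nth_append)
  with f(2) show False by simp
qed

lemma weights_not_zigzag:
  assumes "\<bar>x - y\<bar> = 1"
  shows "as @ x # y # x # bs \<notin> weights"
proof
  assume a: "as @ x # y # x # bs \<in> weights"
  let ?k = "length as"
  have l: "Suc (Suc ?k) < N" using a by (auto simp: weights_def)
  obtain f where f: "\<And>k. k < N \<Longrightarrow> jm k * f = qpow ((as @ x # y # x # bs) ! k) *s f" "f \<noteq> 0"
    using weight_projector[OF a] by metis
  have e: "jm ?k * f = qpow x *s f" "jm (Suc ?k) * f = qpow y *s f" "jm (Suc (Suc ?k)) * f = qpow x *s f"
    using f(1)[of ?k] f(1)[of "Suc ?k"] f(1)[of "Suc (Suc ?k)"] l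
    by (simp_all add: nth_append del: jm.simps)
  have lt: "Suc ?k < N" "1 \<le> Suc ?k" using l by auto
  consider "y = x + 1" | "y = x - 1" using assms by linarith
  then have "f = 0"
  proof cases
    case 1
    have "g (Suc ?k) * f = u *s f" using e 1 by (intro adjacent_up[OF lt(1)]) auto
    moreover have "g (Suc (Suc ?k)) * f = (- inverse u) *s f"
      using e 1 by (intro adjacent_down[OF l, of _ y]) auto
    ultimately show ?thesis using u_pos l by (intro zigzag_zero[of "Suc ?k" u]) auto
  next
    case 2
    have "g (Suc ?k) * f = (- inverse u) *s f" using e 2 by (intro adjacent_down[OF lt(1)]) auto
    moreover have "g (Suc (Suc ?k)) * f = u *s f"
      using e 2 by (intro adjacent_up[OF l, of _ y]) auto
    ultimately show ?thesis using u_pos l by (intro zigzag_zero[of "Suc ?k" "- inverse u"]) auto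
  qed
  with f(2) show False by simp
qed

text \<open>\<open>phi\<close> exchanges the two eigenvalues, and its square acts on
  \<open>v\<close> by a scalar that vanishes only for exponents differing by exactly 1; so
  \<open>phi\<close> applied to \<open>v\<close> is again a weight vector.\<close>

lemma weights_swap:
  assumes a: "as @ x # y # bs \<in> weights" and xy: "2 \<le> \<bar>x - y\<bar>"
  shows "as @ y # x # bs \<in> weights"
proof -
  let ?k = "length as"
  let ?a = "as @ x # y # bs" and ?b = "as @ y # x # bs"
  have l: "Suc ?k < N" "length ?a = N" using a by (auto simp: weights_def)
  obtain v where v: "v \<noteq> 0" "\<And>k. k < N \<Longrightarrow> act (jm k) v = smul (qpow (?a ! k)) v"
    using a by (auto simp: weights_def wvec_def)
  have e: "act (jm ?k) v = smul (qpow x) v" "act (jm (Suc ?k)) v = smul (qpow y) v"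
    using v(2)[of ?k] v(2)[of "Suc ?k"] l by (simp_all add: nth_append del: jm.simps)
  note I = jm_intertwine[OF l(1)]
  have d: "act (jm (Suc ?k) - jm ?k) v = smul (qpow y - qpow x) v"
    by (simp only: act_diff_left e E.scale_left_diff_distrib)
  let ?w = "act (phi ?k) v"
  have "act (phi ?k) ?w = act (phi ?k * phi ?k) v" by (simp add: act_mult)
  also have "\<dots> = smul (a0 * a0) (act (jm ?k) (act (jm (Suc ?k)) v)) -
      act (jm (Suc ?k) - jm ?k) (act (jm (Suc ?k) - jm ?k) v)"
    unfolding I(5)
    by (simp only: act_diff_left[of "(a0 * a0) *s (jm ?k * jm (Suc ?k))"] act_scale act_mult)
  also have "\<dots> = smul (a0 * a0 * (qpow x * qpow y)) v - smul ((qpow y - qpow x) * (qpow y - qpow x)) v"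
    by (simp only: d e act_smul E.scale_scale mult.commute[of "qpow x"])
  also have "\<dots> = smul (a0 * a0 * (qpow x * qpow y) - (qpow y - qpow x) * (qpow y - qpow x)) v"
    by (simp only: E.scale_left_diff_distrib[of _ _ v])
  also have "\<dots> = smul (- ((qpow y - qpow (x + 1)) * (qpow y - qpow (x - 1)))) v"
    by (simp only: phi_square_scalar qpow_add_1 qpow_diff_1)
  finally have "act (phi ?k) ?w = smul (- ((qpow y - qpow (x + 1)) * (qpow y - qpow (x - 1)))) v" .
  moreover have "- ((qpow y - qpow (x + 1)) * (qpow y - qpow (x - 1))) \<noteq> 0" using xy by auto
  ultimately have "?w \<noteq> 0" using v(1) by (metis E.scale_eq_0_iff act_0_right)
  moreover have "act (jm i) ?w = smul (qpow (?b ! i)) ?w" if "i < N" for i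
  proof -
    consider "i = ?k" | "i = Suc ?k" | "i \<noteq> ?k" "i \<noteq> Suc ?k" by blast
    then show ?thesis
    proof cases
      case 1
      have "act (jm ?k) ?w = act (phi ?k) (act (jm (Suc ?k)) v)" using I(4) by (metis act_mult)
      with 1 e show ?thesis by (simp add: act_smul)
    next
      case 2
      have "act (jm (Suc ?k)) ?w = act (phi ?k) (act (jm ?k) v)" using I(3) by (metis act_mult)
      with 2 e show ?thesis by (simp add: act_smul nth_append del: jm.simps)
    next
      case 3
      have "g (Suc ?k) * jm i = jm i * g (Suc ?k)"
        using 3 that l by (intro jm_g_commute) auto
      moreover have "jm (Suc ?k) * jm i = jm i * jm (Suc ?k)" "jm ?k * jm i = jm i * jm ?k"
        using that l by (auto intro!: jm_commute simp del: jm.simps)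
      moreover from this have "(jm (Suc ?k) - jm ?k) * jm i = jm i * (jm (Suc ?k) - jm ?k)"
        by (simp only: left_diff_distrib right_diff_distrib)
      ultimately have "g (Suc ?k) * (jm (Suc ?k) - jm ?k) * jm i = jm i * (g (Suc ?k) * (jm (Suc ?k) - jm ?k))"
        by (metis mult.assoc)
      with \<open>jm (Suc ?k) * jm i = jm i * jm (Suc ?k)\<close> have "phi ?k * jm i = jm i * phi ?k"
        unfolding phi_def
        by (simp only: left_diff_distrib[of _ _ "jm i"] right_diff_distrib[of "jm i"] scale_mult_left scale_mult_right)
      then have "act (jm i) ?w = act (phi ?k) (act (jm i) v)" by (metis act_mult)
      moreover have "?a ! i = ?b ! i" using 3 by (auto simp: nth_append nth_Cons split: nat.splits)
      ultimately show ?thesis using v(2)[OF that] by (simp add: act_smul)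
    qed
  qed
  ultimately show ?thesis using l by (auto simp: weights_def wvec_def)
qed

end

section \<open>Weights and Young diagrams\<close>

text \<open>A box \<open>(r, c)\<close> stands for row \<open>r\<close> and column \<open>c\<close>, both counted from \<open>0\<close>.\<close>

definition cont :: "nat \<times> nat \<Rightarrow> int" where
  "cont b = int (snd b) - int (fst b)"

definition row_less :: "nat \<times> nat \<Rightarrow> nat \<times> nat \<Rightarrow> bool" where
  "row_less b d \<longleftrightarrow> fst b < fst d \<or> fst b = fst d \<and> snd b < snd d"

definition col_less :: "nat \<times> nat \<Rightarrow> nat \<times> nat \<Rightarrow> bool" where
  "col_less b d \<longleftrightarrow> snd b < snd d \<or> snd b = snd d \<and> fst b < fst d"

definition seg :: "int \<Rightarrow> nat \<Rightarrow> int list" where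
  "seg s m = map (\<lambda>i. s + int i) [0..<m]"

lemma seg_0 [simp]: "seg s 0 = []" by (simp add: seg_def)

lemma seg_append: "seg s (a + b) = seg s a @ seg (s + int a) b"
  by (rule nth_equalityI) (auto simp: seg_def nth_append)

lemma seg_Suc: "seg s (Suc m) = s # seg (s + 1) m"
  by (rule nth_equalityI) (auto simp: seg_def nth_Cons simp del: upt_Suc split: nat.splits)

lemma seg_1 [simp]: "seg s 1 = [s]"
  by (simp add: seg_def One_nat_def)

lemma set_seg: "x \<in> set (seg s m) \<longleftrightarrow> s \<le> x \<and> x < s + int m"
proof
  assume "s \<le> x \<and> x < s + int m"
  then show "x \<in> set (seg s m)"
    unfolding seg_def by (auto intro!: image_eqI[of _ _ "nat (x - s)"])
qed (auto simp: seg_def)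

definition reading :: "nat list \<Rightarrow> (nat \<times> nat) list" where
  "reading ls = concat (map (\<lambda>r. map (Pair r) [0..<ls ! r]) [0..<length ls])"

lemma reading_snoc: "reading (ls @ [l]) = reading ls @ map (Pair (length ls)) [0..<l]"
proof -
  have "map (\<lambda>r. map (Pair r) [0..<(ls @ [l]) ! r]) [0..<length ls] =
    map (\<lambda>r. map (Pair r) [0..<ls ! r]) [0..<length ls]"
    by (rule map_cong) (auto simp: nth_append)
  from arg_cong[OF this, of concat] show ?thesis unfolding reading_def by simp
qed

lemma set_reading: "(r, c) \<in> set (reading ls) \<longleftrightarrow> r < length ls \<and> c < ls ! r"
  by (auto simp: reading_def intro!: bexI[of _ r])

lemma cont_row: "map cont (map (Pair r) [0..<l]) = seg (- int r) l"
  by (simp add: cont_def seg_def)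

lemma sorted_reading: "sorted_wrt row_less (reading ls)"
proof (induction ls rule: rev_induct)
  case (snoc l ls)
  have "sorted_wrt row_less (map (Pair (length ls)) [0..<l])"
    by (simp add: sorted_wrt_map row_less_def)
  moreover have "row_less b d" if "b \<in> set (reading ls)" "d \<in> set (map (Pair (length ls)) [0..<l])" for b d
    using that set_reading[of "fst b" "snd b" ls] by (auto simp: row_less_def)
  ultimately show ?case using snoc by (simp add: reading_snoc sorted_wrt_append)
qed (simp add: reading_def)

text \<open>The measure to be minimised over all weights: exchanging neighbours that rise by at
  least 2 lowers it, so in a minimal weight neighbours rise by 1 or fall.\<close>

fun ascents :: "int list \<Rightarrow> nat" where
  "ascents [] = 0"
| "ascents (x # xs) = length (filter ((<) x) xs) + ascents xs"

lemma ascents_swap: "x < y \<Longrightarrow> ascents (as @ y # x # bs) < ascents (as @ x # y # bs)"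
  by (induction as) auto

section \<open>Weights as readings of a partition\<close>

locale weight_set =
  fixes Om :: "int list set"
  assumes nonempty: "\<exists>a. a \<in> Om"
    and no_Nil: "[] \<notin> Om"
    and first: "x # xs \<in> Om \<Longrightarrow> x = 0"
    and not_equal: "as @ x # x # bs \<notin> Om"
    and not_zigzag: "\<bar>x - y\<bar> = 1 \<Longrightarrow> as @ x # y # x # bs \<notin> Om"
    and swap: "as @ x # y # bs \<in> Om \<Longrightarrow> 2 \<le> \<bar>x - y\<bar> \<Longrightarrow> as @ y # x # bs \<in> Om"
begin

lemma move_left:
  "as @ bs @ y # cs \<in> Om \<Longrightarrow> \<forall>b\<in>set bs. 2 \<le> \<bar>b - y\<bar> \<Longrightarrow> as @ y # bs @ cs \<in> Om"
proof (induction bs arbitrary: cs rule: rev_induct)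
  case (snoc b bs)
  then have "(as @ bs) @ y # b # cs \<in> Om" using swap[of "as @ bs" b y cs] by simp
  with snoc show ?case by simp
qed simp

lemma move_right:
  "as @ y # bs @ cs \<in> Om \<Longrightarrow> \<forall>b\<in>set bs. 2 \<le> \<bar>b - y\<bar> \<Longrightarrow> as @ bs @ y # cs \<in> Om"
proof (induction bs arbitrary: as)
  case (Cons b bs)
  then have "as @ b # y # (bs @ cs) \<in> Om"
    using swap[of as y b "bs @ cs"] by (simp add: abs_minus_commute)
  with Cons.IH[of "as @ [b]"] Cons.prems(2) show ?case by simp
qed simp

text \<open>A lower row would be longer than the one above it. Moving \<open>s - 1\<close> left
  until it follows \<open>s\<close> strips the first column and leaves the same pattern with smaller
  \<open>m\<close>, down to the zigzag s, s - 1, s.\<close>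

lemma no_equal_rows: "1 \<le> m \<Longrightarrow> as @ seg s m @ seg (s - 1) m @ (s - 1 + int m) # bs \<notin> Om"
proof (induction m arbitrary: as s)
  case (Suc m)
  show ?case
  proof (cases "m = 0")
    case True
    then show ?thesis using not_zigzag[of s "s - 1" as bs] by (simp add: seg_Suc)
  next
    case False
    show ?thesis
    proof
      assume "as @ seg s (Suc m) @ seg (s - 1) (Suc m) @ (s - 1 + int (Suc m)) # bs \<in> Om"
      then have "(as @ [s]) @ seg (s + 1) m @ (s - 1) # seg s m @ (s + int m) # bs \<in> Om"
        by (simp add: seg_Suc)
      from move_left[OF this] have "(as @ [s, s - 1]) @ seg (s + 1) m @ seg s m @ (s + int m) # bs \<in> Om"
        by (simp add: set_seg)
      with Suc.IH[of "as @ [s, s - 1]" "s + 1"] False show False by simp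
    qed
  qed
qed simp

definition partition :: "nat list \<Rightarrow> bool" where
  "partition ls \<longleftrightarrow> sorted_wrt (\<ge>) ls \<and> 0 \<notin> set ls"

text \<open>An entry that neither prolongs the last row nor starts the next one could be moved left
  into a forbidden pattern.\<close>

lemma prefix_is_reading:
  assumes red: "\<And>as x y bs. a = as @ x # y # bs \<Longrightarrow> y = x + 1 \<or> y < x"
    and a: "a \<in> Om"
  shows "a = pre @ post \<Longrightarrow> pre \<noteq> [] \<Longrightarrow> \<exists>ls. ls \<noteq> [] \<and> partition ls \<and> map cont (reading ls) = pre"
proof (induction pre arbitrary: post rule: rev_induct)
  case (snoc y pre)
  show ?case
  proof (cases "pre = []")
    case True
    with snoc a have "y = 0" using first[of y post] by simp
    with True show ?thesis by (intro exI[of _ "[1]"]) (simp add: partition_def reading_def cont_def One_nat_def)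
  next
    case False
    with snoc obtain ls where ls: "ls \<noteq> []" "partition ls" "map cont (reading ls) = pre" by fastforce
    obtain \<mu> l where mu: "ls = \<mu> @ [l]" using ls(1) by (metis rev_exhaust)
    define k where "k = length \<mu>"
    have l: "1 \<le> l" using ls(2) mu by (cases l) (auto simp: partition_def)
    let ?A = "map cont (reading \<mu>)"
    have pre: "pre = ?A @ seg (- int k) l"
      using ls(3) unfolding mu reading_snoc map_append cont_row by (simp add: k_def)
    let ?x = "int l - 1 - int k"
    have "seg (- int k) l = seg (- int k) (l - 1) @ [?x]"
      using seg_append[of "- int k" "l - 1" 1] l by (simp add: of_nat_diff)
    then have "a = (?A @ seg (- int k) (l - 1)) @ ?x # y # post" using snoc.prems pre by simp
    from red[OF this] consider "y = ?x + 1" | "y = - int k - 1" | "y < - int k - 1"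
      | "- int k \<le> y" "y < ?x" by linarith
    then show ?thesis
    proof cases
      case 1
      have "partition (\<mu> @ [Suc l])"
      proof (cases \<mu> rule: rev_cases)
        case Nil
        then show ?thesis by (simp add: partition_def)
      next
        case (snoc \<nu> m)
        have "m \<noteq> l"
        proof
          assume "m = l"
          then have "?A = map cont (reading \<nu>) @ seg (- int k + 1) l"
            unfolding snoc reading_snoc map_append cont_row by (simp add: k_def snoc)
          then have "a = map cont (reading \<nu>) @ seg (- int k + 1) l @ seg (- int k + 1 - 1) l
              @ (- int k + 1 - 1 + int l) # post"
            using \<open>a = (pre @ [y]) @ post\<close> pre 1 by simp
          with no_equal_rows[OF l] a show False by metis
        qed
        moreover have "\<forall>m'\<in>set \<mu>. m \<le> m'" "l \<le> m" "0 \<notin> set \<mu>" "sorted_wrt (\<ge>) \<mu>"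
          using ls(2) snoc unfolding mu partition_def by (auto simp: sorted_wrt_append)
        ultimately show ?thesis
          unfolding partition_def by (fastforce simp: sorted_wrt_append)
      qed
      moreover have "map cont (reading (\<mu> @ [Suc l])) = pre @ [y]"
        unfolding reading_snoc map_append cont_row pre
        using seg_append[of "- int k" l 1] 1 by (simp add: k_def flip: Suc_eq_plus1)
      ultimately show ?thesis by (intro exI[of _ "\<mu> @ [Suc l]"]) simp
    next
      case 2
      have "partition (ls @ [1])"
        using ls(2) unfolding partition_def
        by (auto simp: sorted_wrt_append) (metis One_nat_def Suc_leI gr0I)
      moreover have "map cont (reading (ls @ [1])) = pre @ [y]"
        unfolding reading_snoc using 2 ls(3) mu by (simp add: cont_def k_def One_nat_def)
      ultimately show ?thesis by (intro exI[of _ "ls @ [1]"]) simp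
    next
      case 3
      \<comment> \<open>An entry this small commutes with everything before it and would reach the
        front, where only 0 is allowed.\<close>
      have "\<forall>b\<in>set pre. 2 \<le> \<bar>b - y\<bar>"
      proof
        fix b assume "b \<in> set pre"
        then obtain r c where "(r, c) \<in> set (reading ls)" "b = cont (r, c)" using ls(3) by auto
        then have "- int k \<le> b" using mu by (auto simp: set_reading cont_def k_def)
        with 3 show "2 \<le> \<bar>b - y\<bar>" by linarith
      qed
      then have "y # pre @ post \<in> Om" using move_left[of "[]" pre y post] snoc.prems a by simp
      from first[OF this] 3 show ?thesis by simp
    next
      case 4
      \<comment> \<open>The value \<open>y\<close> already occurs in the last row, followed by
        \<open>y + 1\<close> and \<open>m\<close> more entries. The new \<open>y\<close> passes
        these \<open>m\<close> entries and completes a zigzag.\<close>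
      define j m where "j = nat (y + int k)" and "m = nat (?x - y - 1)"
      have jm: "l = j + Suc (Suc m)" "- int k + int j = y" using 4 by (auto simp: j_def m_def)
      have "seg (- int k) l = seg (- int k) j @ y # (y + 1) # seg (y + 2) m"
        unfolding jm(1) seg_append seg_Suc jm(2) by (simp add: add.assoc)
      then have "(?A @ seg (- int k) j @ [y, y + 1]) @ seg (y + 2) m @ y # post \<in> Om"
        using snoc.prems pre a by simp
      from move_left[OF this] have "(?A @ seg (- int k) j) @ y # (y + 1) # y # seg (y + 2) m @ post \<in> Om"
        by (simp add: set_seg)
      with not_zigzag[of y "y + 1" "?A @ seg (- int k) j" "seg (y + 2) m @ post"] show ?thesis by simp
    qed
  qed
qed simp

lemma row_reading_exists: "\<exists>ls. partition ls \<and> map cont (reading ls) \<in> Om"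
proof -
  obtain a where a: "a \<in> Om" "\<And>b. b \<in> Om \<Longrightarrow> ascents a \<le> ascents b"
    using ex_has_least_nat[of "\<lambda>a. a \<in> Om" _ ascents] nonempty by blast
  have red: "y = x + 1 \<or> y < x" if "a = as @ x # y # bs" for as x y bs
  proof (rule ccontr)
    assume *: "\<not> ?thesis"
    moreover have "x \<noteq> y" using not_equal a(1) that by blast
    ultimately have xy: "x < y" "2 \<le> \<bar>x - y\<bar>" by linarith+
    then have "as @ y # x # bs \<in> Om" using swap a(1) that by blast
    from a(2)[OF this] ascents_swap[OF xy(1), of as bs] that show False by simp
  qed
  have "\<exists>ls. ls \<noteq> [] \<and> partition ls \<and> map cont (reading ls) = a"
    by (rule prefix_is_reading[where a = a and post = "[]", OF red a(1)]) (use a(1) no_Nil in auto)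
  with a(1) show ?thesis by auto
qed

lemma insort_key_split:
  "\<exists>bs cs. ys = bs @ cs \<and> insort_key f x ys = bs @ x # cs \<and> (\<forall>b\<in>set bs. f b < f x) \<and>
    (cs \<noteq> [] \<longrightarrow> f x \<le> f (hd cs))"
proof (induction ys)
  case (Cons y ys)
  then obtain bs cs where *: "ys = bs @ cs" "insort_key f x ys = bs @ x # cs" "\<forall>b\<in>set bs. f b < f x"
    "cs \<noteq> [] \<longrightarrow> f x \<le> f (hd cs)" by blast
  show ?case
  proof (cases "f x \<le> f y")
    case True
    then show ?thesis by (intro exI[of _ "[]"] exI[of _ "y # ys"]) simp
  next
    case False
    with * show ?thesis by (intro exI[of _ "y # bs"] exI[of _ cs]) simp
  qed
qed simp

text \<open>Insertion sort: a box passes only boxes strictly below it and strictly to its left.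
  Their contents differ from its own by at least 2, so each exchange stays within
  \<open>Om\<close>.\<close>

lemma sort_by_column:
  assumes "sorted_wrt row_less bs"
  shows "map cont (as @ bs) \<in> Om \<Longrightarrow> map cont (as @ sort_key snd bs) \<in> Om"
    and "sorted_wrt col_less (sort_key snd bs)"
  using assms
proof (induction bs arbitrary: as)
  case (Cons x bs)
  {
    case 1
    have "map cont ((as @ [x]) @ sort_key snd bs) \<in> Om" using Cons.IH(1)[of "as @ [x]"] 1 by simp
    moreover obtain cs ds where s: "sort_key snd bs = cs @ ds" "insort_key snd x (sort_key snd bs) = cs @ x # ds"
      "\<forall>b\<in>set cs. snd b < snd x" using insort_key_split[of "sort_key snd bs" snd x] by blast
    ultimately have "map cont as @ cont x # map cont cs @ map cont ds \<in> Om" by simp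
    moreover have "\<forall>b\<in>set (map cont cs). 2 \<le> \<bar>b - cont x\<bar>"
    proof
      fix b assume "b \<in> set (map cont cs)"
      then obtain d where d: "d \<in> set cs" "b = cont d" by auto
      then have "d \<in> set (sort_key snd bs)" unfolding s(1) by simp
      then have "row_less x d" using 1 by simp
      moreover have "snd d < snd x" using s(3) d by simp
      ultimately show "2 \<le> \<bar>b - cont x\<bar>" using d(2) by (auto simp: row_less_def cont_def)
    qed
    ultimately have "map cont as @ map cont cs @ cont x # map cont ds \<in> Om" by (rule move_right)
    then show ?case using s(2) by simp
  next
    case 2
    then have IH: "sorted_wrt col_less (sort_key snd bs)" using Cons.IH(2) by simp
    obtain cs ds where s: "sort_key snd bs = cs @ ds" "insort_key snd x (sort_key snd bs) = cs @ x # ds"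
      "\<forall>b\<in>set cs. snd b < snd x" "ds \<noteq> [] \<longrightarrow> snd x \<le> snd (hd ds)" using insort_key_split[of "sort_key snd bs" snd x] by blast
    have "col_less x d" if d: "d \<in> set ds" for d
    proof -
      have "d \<in> set (sort_key snd bs)" unfolding s(1) using d by simp
      then have "row_less x d" using 2 by simp
      moreover have "snd x \<le> snd d"
      proof -
        have "sorted (map snd (cs @ ds))" using sorted_sort_key[of snd bs] s(1) by simp
        then have "snd (hd ds) \<le> snd d" using d by (cases ds) (auto simp: sorted_append)
        with s(4) d show ?thesis by (cases ds) auto
      qed
      ultimately show ?thesis by (auto simp: row_less_def col_less_def)
    qed
    moreover have "col_less b x" if "b \<in> set cs" for b using s(3) that by (simp add: col_less_def)
    ultimately show ?case using IH s by (auto simp: sorted_wrt_append)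
  }
qed simp_all

lemma partition_down_closed:
  assumes "partition ls" "(r, c) \<in> set (reading ls)" "r' \<le> r" "c' \<le> c"
  shows "(r', c') \<in> set (reading ls)"
proof -
  have "ls ! r \<le> ls ! r'"
    using assms sorted_wrt_nth_less[of "(\<ge>)" ls r' r] by (cases "r = r'") (auto simp: partition_def set_reading)
  with assms show ?thesis by (auto simp: set_reading)
qed

lemma row_and_column_readings:
  obtains rs cs where "map cont rs \<in> Om" "map cont cs \<in> Om" "mset rs = mset cs"
    "sorted_wrt row_less rs" "sorted_wrt col_less cs"
    "\<And>r c r' c'. (r, c) \<in> set rs \<Longrightarrow> r' \<le> r \<Longrightarrow> c' \<le> c \<Longrightarrow> (r', c') \<in> set rs"
proof -
  obtain ls where ls: "partition ls" "map cont (reading ls) \<in> Om" using row_reading_exists by blast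
  have "map cont (sort_key snd (reading ls)) \<in> Om"
    using sort_by_column(1)[OF sorted_reading, of "[]"] ls(2) by simp
  then show ?thesis
    using that[of "reading ls" "sort_key snd (reading ls)"] ls sorted_reading[of ls]
      sort_by_column(2)[OF sorted_reading] partition_down_closed[OF ls(1)] by simp
qed

end

section \<open>Row and column blocks\<close>

locale readings =
  fixes N :: nat and rs cs :: "(nat \<times> nat) list"
  assumes len: "length rs = N" "length cs = N"
    and mset_eq: "mset rs = mset cs"
    and sorted_rs: "sorted_wrt row_less rs"
    and sorted_cs: "sorted_wrt col_less cs"
    and down_closed: "(r, c) \<in> set rs \<Longrightarrow> r' \<le> r \<Longrightarrow> c' \<le> c \<Longrightarrow> (r', c') \<in> set rs"
begin

text \<open>Positions are numbered from \<open>1\<close>, list entries from \<open>0\<close>.\<close>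

definition rbox :: "nat \<Rightarrow> nat \<times> nat" where "rbox i = rs ! (i - 1)"
definition cbox :: "nat \<Rightarrow> nat \<times> nat" where "cbox i = cs ! (i - 1)"

abbreviation "rw i \<equiv> fst (rbox i)"
abbreviation "cl i \<equiv> snd (cbox i)"

lemma rbox_less: "1 \<le> i \<Longrightarrow> i < j \<Longrightarrow> j \<le> N \<Longrightarrow> row_less (rbox i) (rbox j)"
  unfolding rbox_def by (rule sorted_wrt_nth_less[OF sorted_rs]) (use len in auto)

lemma cbox_less: "1 \<le> i \<Longrightarrow> i < j \<Longrightarrow> j \<le> N \<Longrightarrow> col_less (cbox i) (cbox j)"
  unfolding cbox_def by (rule sorted_wrt_nth_less[OF sorted_cs]) (use len in auto)

lemma rw_mono: "1 \<le> i \<Longrightarrow> i \<le> j \<Longrightarrow> j \<le> N \<Longrightarrow> rw i \<le> rw j"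
  using rbox_less[of i j] by (cases "i = j") (auto simp: row_less_def)

lemma cl_mono: "1 \<le> i \<Longrightarrow> i \<le> j \<Longrightarrow> j \<le> N \<Longrightarrow> cl i \<le> cl j"
  using cbox_less[of i j] by (cases "i = j") (auto simp: col_less_def)

lemma rbox_inj: "i \<in> {1..N} \<Longrightarrow> j \<in> {1..N} \<Longrightarrow> rbox i = rbox j \<Longrightarrow> i = j"
  using rbox_less[of i j] rbox_less[of j i]
  by (cases i j rule: linorder_cases) (auto simp: row_less_def)

lemma cbox_inj: "i \<in> {1..N} \<Longrightarrow> j \<in> {1..N} \<Longrightarrow> cbox i = cbox j \<Longrightarrow> i = j"
  using cbox_less[of i j] cbox_less[of j i]
  by (cases i j rule: linorder_cases) (auto simp: col_less_def)

lemma rbox_set: "i \<in> {1..N} \<Longrightarrow> rbox i \<in> set rs"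
  using len by (auto simp: rbox_def)

lemma rbox_ex:
  assumes "b \<in> set rs"
  obtains i where "i \<in> {1..N}" "rbox i = b"
proof -
  obtain k where "k < N" "rs ! k = b" using assms len by (metis in_set_conv_nth)
  then show ?thesis using that[of "Suc k"] by (auto simp: rbox_def)
qed

lemma set_cs: "set cs = set rs"
  using mset_eq_setD[OF mset_eq] by simp

lemma cbox_set: "i \<in> {1..N} \<Longrightarrow> cbox i \<in> set rs"
  using len unfolding set_cs[symmetric] cbox_def by (intro nth_mem) auto

lemma cbox_ex:
  assumes "b \<in> set rs"
  obtains i where "i \<in> {1..N}" "cbox i = b"
proof -
  have "b \<in> set cs" using assms set_cs by simp
  then obtain k where "k < N" "cs ! k = b" using len by (auto simp: in_set_conv_nth)
  then show ?thesis using that[of "Suc k"] by (auto simp: cbox_def)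
qed

text \<open>Down-closure would fill a gap by a box that has no room in the reading between positions
  \<open>i\<close> and \<open>Suc i\<close>. So contents rise by exactly 1 inside a row, as
  \<open>adjacent_up\<close> requires.\<close>

lemma rbox_adjacent:
  assumes "1 \<le> i" "i < N" "rw i = rw (Suc i)"
  shows "snd (rbox (Suc i)) = Suc (snd (rbox i))"
proof (rule ccontr)
  assume *: "\<not> ?thesis"
  have lt: "snd (rbox i) < snd (rbox (Suc i))" using rbox_less[of i "Suc i"] assms by (auto simp: row_less_def)
  have "(rw (Suc i), Suc (snd (rbox i))) \<in> set rs"
    using down_closed[of "rw (Suc i)" "snd (rbox (Suc i))"] rbox_set[of "Suc i"] assms lt by simp
  then obtain j where j: "j \<in> {1..N}" "rbox j = (rw (Suc i), Suc (snd (rbox i)))" using rbox_ex by blast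
  have sj: "snd (rbox j) = Suc (snd (rbox i))" "rw j = rw (Suc i)" using j(2) by simp_all
  then have "j \<noteq> i" "j \<noteq> Suc i" using * by auto
  then consider "j < i" | "Suc i < j" by linarith
  then show False
    using rbox_less[of j i] rbox_less[of "Suc i" j] j(1) sj assms * lt
    by cases (auto simp: row_less_def)
qed

lemma cbox_adjacent:
  assumes "1 \<le> i" "i < N" "cl i = cl (Suc i)"
  shows "fst (cbox (Suc i)) = Suc (fst (cbox i))"
proof (rule ccontr)
  assume *: "\<not> ?thesis"
  have lt: "fst (cbox i) < fst (cbox (Suc i))" using cbox_less[of i "Suc i"] assms by (auto simp: col_less_def)
  have "(Suc (fst (cbox i)), cl (Suc i)) \<in> set rs"
    using down_closed[of "fst (cbox (Suc i))" "cl (Suc i)"] cbox_set[of "Suc i"] assms lt by simp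
  then obtain j where j: "j \<in> {1..N}" "cbox j = (Suc (fst (cbox i)), cl (Suc i))" using cbox_ex by blast
  have sj: "fst (cbox j) = Suc (fst (cbox i))" "cl j = cl (Suc i)" using j(2) by simp_all
  then have "j \<noteq> i" "j \<noteq> Suc i" using * by auto
  then consider "j < i" | "Suc i < j" by linarith
  then show False
    using cbox_less[of j i] cbox_less[of "Suc i" j] j(1) sj assms * lt
    by cases (auto simp: col_less_def)
qed

lemma sum_boxes: "(\<Sum>i\<in>{1..N}. h (cbox i)) = (\<Sum>i\<in>{1..N}. h (rbox i) :: nat)"
proof -
  have *: "(\<Sum>i\<in>{1..N}. h (xs ! (i - 1))) = sum_list (map h xs)" if "length xs = N" for xs
    using that by (simp add: One_nat_def sum.atLeast1_atMost_eq sum_list_sum_nth lessThan_atLeast0)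
  have "sum_list (map h cs) = sum_list (map h rs)"
    unfolding sum_mset_sum_list[symmetric] mset_map mset_eq ..
  then show ?thesis
    unfolding cbox_def rbox_def *[OF len(1)] *[OF len(2)] .
qed

section \<open>Inversions inside blocks and transversal permutations\<close>

definition row_inv :: "(nat \<Rightarrow> nat) \<Rightarrow> (nat \<times> nat) set" where
  "row_inv p = invset N (\<lambda>a b. rw a = rw b) p"

definition col_inv :: "(nat \<Rightarrow> nat) \<Rightarrow> (nat \<times> nat) set" where
  "col_inv p = invset N (\<lambda>a b. cl (p a) = cl (p b)) p"

text \<open>Equivalently, the row block subgroup meets the column block subgroup conjugated by
  \<open>p\<close> only in the identity.\<close>

definition transversal :: "(nat \<Rightarrow> nat) \<Rightarrow> bool" where
  "transversal p \<longleftrightarrow> (\<forall>a\<in>{1..N}. \<forall>b\<in>{1..N}. a \<noteq> b \<longrightarrow> rw a = rw b \<longrightarrow> cl (p a) \<noteq> cl (p b))"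

lemma row_inv_empty:
  assumes "p permutes {1..N}" "row_inv p = {}" "a \<in> {1..N}" "b \<in> {1..N}" "a < b" "rw a = rw b"
  shows "p a < p b"
proof -
  have "p a \<noteq> p b" using permutes_inj[OF assms(1)] assms(5) by (metis injD nat_neq_iff)
  moreover have "(a, b) \<notin> row_inv p" using assms(2) by simp
  ultimately show ?thesis using assms(3-) by (auto simp: row_inv_def invset_def)
qed

lemma col_inv_empty:
  assumes "p permutes {1..N}" "col_inv p = {}" "a \<in> {1..N}" "b \<in> {1..N}" "a < b" "cl (p a) = cl (p b)"
  shows "p a < p b"
proof -
  have "p a \<noteq> p b" using permutes_inj[OF assms(1)] assms(5) by (metis injD nat_neq_iff)
  moreover have "(a, b) \<notin> col_inv p" using assms(2) by simp
  ultimately show ?thesis using assms(3-) by (auto simp: col_inv_def invset_def)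
qed

text \<open>Along each row the columns of the images increase strictly, so they are at least the columns
  of the boxes themselves; the sums over all boxes agree, hence so do the columns.  The same
  argument along the columns then identifies the rows.\<close>

lemma transversal_unique:
  assumes p: "p permutes {1..N}" and "transversal p" and r: "row_inv p = {}" and c: "col_inv p = {}"
    and i: "i \<in> {1..N}"
  shows "cbox (p i) = rbox i"
proof -
  have pin: "p i \<in> {1..N}" if "i \<in> {1..N}" for i using permutes_in_image[OF p] that by blast
  have le: "snd (rbox i) \<le> cl (p i)" if "i \<in> {1..N}" for i
    using that
  proof (induction "snd (rbox i)" arbitrary: i)
    case (Suc k)
    have "(rw i, k) \<in> set rs"
      using down_closed[of "rw i" "snd (rbox i)"] rbox_set[OF Suc.prems] Suc.hyps(2) by simp
    then obtain j where j: "j \<in> {1..N}" "rbox j = (rw i, k)" using rbox_ex by blast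
    have rj: "rw j = rw i" "snd (rbox j) = k" using j(2) by simp_all
    have "j \<noteq> i" using rj(2) Suc.hyps(2) by auto
    moreover have "\<not> i < j"
      using rbox_less[of i j] j(1) Suc.prems Suc.hyps(2) rj by (auto simp: row_less_def)
    ultimately have "j < i" by simp
    then have "p j < p i" using row_inv_empty[OF p r, of j i] j(1) rj Suc.prems by simp
    then have "cl (p j) \<le> cl (p i)" using cl_mono[of "p j" "p i"] pin[OF j(1)] pin[OF Suc.prems] by simp
    moreover have "cl (p j) \<noteq> cl (p i)"
    proof -
      have "j \<noteq> i" using \<open>j < i\<close> by simp
      with assms(2) rj(1) j(1) Suc.prems show ?thesis unfolding transversal_def by blast
    qed
    moreover have "k \<le> cl (p j)" using Suc.hyps(1)[of j] j(1) rj by simp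
    ultimately show ?case using Suc.hyps(2) by simp
  qed simp
  have sums: "(\<Sum>i\<in>{1..N}. snd (rbox i)) = (\<Sum>i\<in>{1..N}. cl (p i))"
    using sum.permute[OF p, of cl] sum_boxes[of snd] by (simp add: comp_def)
  have col: "cl (p i) = snd (rbox i)" if "i \<in> {1..N}" for i
    by (rule sum_mono_inv[OF sums le that finite_atLeastAtMost, symmetric])
  have le': "rw i \<le> fst (cbox (p i))" if "i \<in> {1..N}" for i
    using that
  proof (induction "rw i" arbitrary: i)
    case (Suc k)
    have "(k, snd (rbox i)) \<in> set rs"
      using down_closed[of "rw i" "snd (rbox i)"] rbox_set[OF Suc.prems] Suc.hyps(2) by simp
    then obtain j where j: "j \<in> {1..N}" "rbox j = (k, snd (rbox i))" using rbox_ex by blast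
    have rj: "rw j = k" "snd (rbox j) = snd (rbox i)" using j(2) by simp_all
    have "j \<noteq> i" using rj(1) Suc.hyps(2) by auto
    moreover have "\<not> i < j"
      using rbox_less[of i j] j(1) Suc.prems Suc.hyps(2) rj by (auto simp: row_less_def)
    ultimately have "j < i" by simp
    have eq: "cl (p j) = cl (p i)" using col[OF j(1)] col[OF Suc.prems] rj by simp
    then have "p j < p i" using col_inv_empty[OF p c, of j i] j(1) Suc.prems \<open>j < i\<close> by simp
    then have "fst (cbox (p j)) < fst (cbox (p i))"
      using cbox_less[of "p j" "p i"] pin[OF j(1)] pin[OF Suc.prems] eq by (simp add: col_less_def)
    moreover have "k \<le> fst (cbox (p j))" using Suc.hyps(1)[of j] j(1) rj by simp
    ultimately show ?case using Suc.hyps(2) by simp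
  qed simp
  have "(\<Sum>i\<in>{1..N}. rw i) = (\<Sum>i\<in>{1..N}. fst (cbox (p i)))"
    using sum.permute[OF p, of "\<lambda>i. fst (cbox i)"] sum_boxes[of fst] by (simp add: comp_def)
  from sum_mono_inv[OF this le' i finite_atLeastAtMost] col[OF i] show ?thesis by (simp add: prod_eq_iff)
qed

lemma transversal_eq:
  assumes "p permutes {1..N}" "transversal p" "row_inv p = {}" "col_inv p = {}"
    and "p' permutes {1..N}" "transversal p'" "row_inv p' = {}" "col_inv p' = {}"
  shows "p = p'"
proof
  fix i
  show "p i = p' i"
  proof (cases "i \<in> {1..N}")
    case True
    then have "cbox (p i) = cbox (p' i)" using transversal_unique assms by metis
    then show ?thesis
      using cbox_inj permutes_in_image[OF assms(1)] permutes_in_image[OF assms(5)] True by metis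
  next
    case False
    then show ?thesis using assms by (metis permutes_not_in)
  qed
qed

text \<open>\<open>d\<close> matches equal boxes of the two readings; it represents the double coset
  that survives between \<open>y\<close> and \<open>x\<close>.\<close>

lemma transversal_exists:
  obtains d where "d permutes {1..N}" "transversal d" "row_inv d = {}" "col_inv d = {}"
proof -
  define d where "d i = (if i \<in> {1..N} then (THE j. j \<in> {1..N} \<and> cbox j = rbox i) else i)" for i
  have d: "d i \<in> {1..N}" "cbox (d i) = rbox i" if i: "i \<in> {1..N}" for i
  proof -
    obtain j where "j \<in> {1..N}" "cbox j = rbox i" using cbox_ex[OF rbox_set[OF i]] by blast
    then have "\<exists>!j. j \<in> {1..N} \<and> cbox j = rbox i" using cbox_inj by metis
    from theI'[OF this] i show "d i \<in> {1..N}" "cbox (d i) = rbox i" by (auto simp: d_def)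
  qed
  have "inj_on d {1..N}" by (rule inj_onI) (metis d(2) rbox_inj)
  then have "bij_betw d {1..N} {1..N}"
    using d(1) by (simp add: bij_betw_def endo_inj_surj image_subset_iff)
  then have p: "d permutes {1..N}" by (rule bij_imp_permutes) (auto simp: d_def)
  have "transversal d"
    unfolding transversal_def using d(2) by (metis rbox_inj prod_eqI)
  moreover have "row_inv d = {}"
  proof -
    have False if "a \<in> {1..N}" "b \<in> {1..N}" "a < b" "rw a = rw b" "d b < d a" for a b
      using cl_mono[of "d b" "d a"] rbox_less[of a b] that d by (auto simp: row_less_def)
    then show ?thesis by (force simp: row_inv_def invset_def)
  qed
  moreover have "col_inv d = {}"
  proof -
    have False if "a \<in> {1..N}" "b \<in> {1..N}" "a < b" "cl (d a) = cl (d b)" "d b < d a" for a b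
      using cbox_less[of "d b" "d a"] rbox_less[of a b] that d by (auto simp: row_less_def col_less_def)
    then show ?thesis by (force simp: col_inv_def invset_def)
  qed
  ultimately show ?thesis using that p by blast
qed

lemma rw_swp: "rw i = rw (Suc i) \<Longrightarrow> rw (swp i a) = rw a"
  by (cases "a = i \<or> a = Suc i") auto

lemma cl_swp: "cl i = cl (Suc i) \<Longrightarrow> cl (swp i a) = cl a"
  by (cases "a = i \<or> a = Suc i") auto

definition row_pairs :: "(nat \<times> nat) set" where
  "row_pairs = {(a, b). a \<in> {1..N} \<and> b \<in> {1..N} \<and> a < b \<and> rw a = rw b}"

lemma finite_row_pairs [simp]: "finite row_pairs"
  by (rule finite_subset[of _ "{1..N} \<times> {1..N}"]) (auto simp: row_pairs_def)

lemma row_inv_subset: "row_inv p \<subseteq> row_pairs"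
  by (auto simp: row_inv_def invset_def row_pairs_def)

text \<open>The longest element of the row block subgroup, found by maximising
  \<open>row_inv\<close>: an ascent left inside a row could still be reversed.\<close>

lemma row_reversal_exists:
  obtains q where "q permutes {1..N}" "\<And>a. rw (q a) = rw a"
    "\<And>a b. a \<in> {1..N} \<Longrightarrow> b \<in> {1..N} \<Longrightarrow> a < b \<Longrightarrow> rw a = rw b \<Longrightarrow> q b < q a"
proof -
  let ?P = "\<lambda>q. q permutes {1..N} \<and> (\<forall>a. rw (q a) = rw a)"
  have "?P id" by (simp add: permutes_id)
  moreover have "\<forall>q. ?P q \<longrightarrow> card (row_inv q) < Suc (card row_pairs)"
    using card_mono[OF finite_row_pairs row_inv_subset] by (simp add: less_Suc_eq_le)
  ultimately obtain q where q: "?P q" "\<And>q'. ?P q' \<Longrightarrow> card (row_inv q') \<le> card (row_inv q)"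
    using ex_has_greatest_nat[of ?P id "\<lambda>q. card (row_inv q)"] by blast
  have "q b < q a" if ab: "a \<in> {1..N}" "b \<in> {1..N}" "a < b" "rw a = rw b" for a b
  proof (rule ccontr)
    assume "\<not> q b < q a"
    moreover have "q a \<noteq> q b" using q(1) ab(3) by (metis permutes_inj injD nat_neq_iff)
    ultimately have "- int (q b) < - int (q a)" by simp
    then obtain i where i: "a \<le> i" "i < b" "q i < q (Suc i)"
      using adjacent_descent[OF ab(3), of "\<lambda>x. - int (q x)"] by auto
    have iN: "1 \<le> i" "i < N" using i ab by auto
    have rw: "rw i = rw (Suc i)"
      using rw_mono[of a i] rw_mono[of i "Suc i"] rw_mono[of "Suc i" b] ab i by simp
    let ?q = "q \<circ> swp i"
    have P: "?P ?q" using q(1) rw_swp[OF rw] permutes_swp_comp[OF _ iN] by simp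
    have "card (row_inv ?q) = card (row_inv (?q \<circ> swp i)) + 1"
      unfolding row_inv_def
      by (subst invset_comp_swp[where i = i and R' = "\<lambda>a b. rw a = rw b"])
        (use P iN i rw rw_swp[OF rw] in auto)
    with q(2)[OF P] show False by simp
  qed
  then show ?thesis using that q(1) by blast
qed

text \<open>This permutation carries the top power of \<open>u\<close>. It is the box matching
  composed with the row reversal; undoing the reversal reduces uniqueness to
  \<open>transversal_eq\<close>.\<close>

lemma extremal_transversal:
  obtains p where "p permutes {1..N}" "transversal p" "row_inv p = row_pairs" "col_inv p = {}"
    "\<And>p'. p' permutes {1..N} \<Longrightarrow> transversal p' \<Longrightarrow> row_inv p' = row_pairs \<Longrightarrow> col_inv p' = {} \<Longrightarrow> p' = p"
proof -
  obtain d where d: "d permutes {1..N}" "transversal d" "row_inv d = {}" "col_inv d = {}"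
    using transversal_exists .
  obtain q where q: "q permutes {1..N}" "\<And>a. rw (q a) = rw a"
    "\<And>a b. a \<in> {1..N} \<Longrightarrow> b \<in> {1..N} \<Longrightarrow> a < b \<Longrightarrow> rw a = rw b \<Longrightarrow> q b < q a"
    using row_reversal_exists by metis
  let ?q = "inv' q"
  have q': "?q permutes {1..N}" using permutes_inv[OF q(1)] .
  have qq: "q (?q a) = a" "?q (q a) = a" for a using permutes_inverses[OF q(1)] by auto
  have rq: "rw (?q a) = rw a" for a using q(2)[of "?q a"] by (simp add: qq)
  have qin: "q a \<in> {1..N}" "?q a \<in> {1..N}" if "a \<in> {1..N}" for a
    using permutes_in_image[OF q(1)] permutes_in_image[OF q'] that by blast+
  have q_dec: "?q b < ?q a" if "a \<in> {1..N}" "b \<in> {1..N}" "a < b" "rw a = rw b" for a b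
  proof (rule ccontr)
    assume "\<not> ?q b < ?q a"
    moreover have "?q a \<noteq> ?q b" using that(3) qq(1) by (metis nat_neq_iff)
    ultimately have "?q a < ?q b" by simp
    from q(3)[OF qin(2)[OF that(1)] qin(2)[OF that(2)] this] that rq show False by (simp add: qq)
  qed
  have rw_less: "a < b" if "rw a < rw b" "a \<in> {1..N}" "b \<in> {1..N}" for a b
    using rw_mono[of b a] that by (cases "a < b") auto
  let ?p = "d \<circ> ?q"
  have p: "?p permutes {1..N}" using permutes_compose[OF q' d(1)] .
  have tp: "transversal ?p"
    unfolding transversal_def
  proof (intro ballI impI)
    fix a b assume "a \<in> {1..N}" "b \<in> {1..N}" "a \<noteq> b" "rw a = rw b"
    then show "cl (?p a) \<noteq> cl (?p b)"
      using d(2) qin rq qq(1) unfolding transversal_def comp_def by metis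
  qed
  have "row_inv ?p = row_pairs"
  proof
    show "row_pairs \<subseteq> row_inv ?p"
    proof clarify
      fix a b assume "(a, b) \<in> row_pairs"
      then have ab: "a \<in> {1..N}" "b \<in> {1..N}" "a < b" "rw a = rw b" by (auto simp: row_pairs_def)
      have "d (?q b) < d (?q a)"
        by (rule row_inv_empty[OF d(1,3)]) (use qin(2) ab rq q_dec[OF ab] in simp_all)
      with ab show "(a, b) \<in> row_inv ?p" by (simp add: row_inv_def invset_def)
    qed
  qed (rule row_inv_subset)
  moreover have "col_inv ?p = {}"
  proof -
    have False if ab: "a \<in> {1..N}" "b \<in> {1..N}" "a < b" "cl (?p a) = cl (?p b)" "?p b < ?p a" for a b
    proof -
      have "rw a \<noteq> rw b" using tp ab unfolding transversal_def by (metis nat_neq_iff)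
      then have "rw (?q a) < rw (?q b)" using rw_mono[of a b] ab rq by (simp add: le_less)
      then have "?q a < ?q b" using rw_less qin ab by blast
      then have "d (?q a) < d (?q b)"
        by (intro col_inv_empty[OF d(1,4)]) (use qin(2) ab in simp_all)
      with ab show False by simp
    qed
    then show ?thesis by (force simp: col_inv_def invset_def)
  qed
  moreover have "p' = ?p" if p': "p' permutes {1..N}" "transversal p'" "row_inv p' = row_pairs" "col_inv p' = {}" for p'
  proof -
    have tr: "transversal (p' \<circ> q)"
      unfolding transversal_def
    proof (intro ballI impI)
      fix a b assume "a \<in> {1..N}" "b \<in> {1..N}" "a \<noteq> b" "rw a = rw b"
      then show "cl ((p' \<circ> q) a) \<noteq> cl ((p' \<circ> q) b)"
        using p'(2) qin q(2) qq(2) unfolding transversal_def comp_def by metis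
    qed
    have "p' \<circ> q = d"
    proof (rule transversal_eq[OF _ tr _ _ d])
      show "p' \<circ> q permutes {1..N}" using permutes_compose[OF q(1) p'(1)] .
      have False if ab: "a \<in> {1..N}" "b \<in> {1..N}" "a < b" "rw a = rw b" "p' (q b) < p' (q a)" for a b
      proof -
        have "(q b, q a) \<in> row_pairs" using q(3)[OF ab(1-4)] qin(1) ab q(2) by (simp add: row_pairs_def)
        then have "(q b, q a) \<in> row_inv p'" using p'(3) by simp
        with ab show False by (simp add: row_inv_def invset_def)
      qed
      then show "row_inv (p' \<circ> q) = {}" by (force simp: row_inv_def invset_def)
      have False if ab: "a \<in> {1..N}" "b \<in> {1..N}" "a < b" "cl (p' (q a)) = cl (p' (q b))" "p' (q b) < p' (q a)" for a b
      proof -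
        have "rw a \<noteq> rw b" using tr ab unfolding transversal_def comp_def by (metis nat_neq_iff)
        then have "rw (q a) < rw (q b)" using rw_mono[of a b] ab q(2) by (simp add: le_less)
        then have "q a < q b" using rw_less qin ab by blast
        then have "p' (q a) < p' (q b)"
          by (intro col_inv_empty[OF p'(1,4)]) (use qin(1) ab in simp_all)
        with ab show False by simp
      qed
      then show "col_inv (p' \<circ> q) = {}" by (force simp: col_inv_def invset_def)
    qed
    then show ?thesis using qq(1) by (auto simp: fun_eq_iff) metis
  qed
  ultimately show ?thesis using that p tp by blast
qed

end

section \<open>The line y H x\<close>

context type_A_hecke
begin

definition block_coef :: "(nat \<times> nat) list \<Rightarrow> (nat \<times> nat) list \<Rightarrow> (nat \<Rightarrow> nat) \<Rightarrow> 'k" where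
  "block_coef rs cs p = (if readings.transversal N rs cs p
    then u ^ card (readings.row_inv N rs p) * (- inverse u) ^ card (readings.col_inv N cs p) else 0)"

text \<open>Descents inside a row block are absorbed by \<open>x\<close>, left descents inside a
  column block by \<open>y\<close>. If none is left, \<open>p\<close> is the unique transversal, or
  it sends two neighbours of a row to neighbours of a column and the product vanishes.\<close>

lemma block_product:
  assumes "readings N rs cs"
    and x: "\<And>i. 1 \<le> i \<Longrightarrow> i < N \<Longrightarrow>
      fst (readings.rbox rs i) = fst (readings.rbox rs (Suc i)) \<Longrightarrow> g i * x = u *s x"
    and y: "\<And>i. 1 \<le> i \<Longrightarrow> i < N \<Longrightarrow>
      snd (readings.cbox cs i) = snd (readings.cbox cs (Suc i)) \<Longrightarrow> y * g i = (- inverse u) *s y"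
  shows "\<exists>z. \<forall>p. p permutes {1..N} \<longrightarrow> y * t p * x = block_coef rs cs p *s z"
proof -
  interpret readings N rs cs by fact
  obtain d where d: "d permutes {1..N}" "transversal d" "row_inv d = {}" "col_inv d = {}"
    using transversal_exists .
  have "y * t p * x = block_coef rs cs p *s (y * t d * x)" if "p permutes {1..N}" for p
    using that
  proof (induction "card (invs N p)" arbitrary: p rule: less_induct)
    case less
    note p = less.prems
    have pin: "p i \<in> {1..N}" "inv' p i \<in> {1..N}" if "i \<in> {1..N}" for i
      using permutes_in_image[OF p] permutes_in_image[OF permutes_inv[OF p]] that by blast+
    note pp = permutes_inverses[OF p]
    have pne: "p a \<noteq> p b" if "a \<noteq> b" for a b using that permutes_inj[OF p] by (metis injD)
    consider (row) i where "1 \<le> i" "i < N" "rw i = rw (Suc i)" "p (Suc i) < p i"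
      | (col) i where "1 \<le> i" "i < N" "cl i = cl (Suc i)" "inv' p (Suc i) < inv' p i"
      | (min) "\<And>i. 1 \<le> i \<Longrightarrow> i < N \<Longrightarrow> rw i = rw (Suc i) \<Longrightarrow> \<not> p (Suc i) < p i"
        "\<And>i. 1 \<le> i \<Longrightarrow> i < N \<Longrightarrow> cl i = cl (Suc i) \<Longrightarrow> \<not> inv' p (Suc i) < inv' p i"
      by blast
    then show ?case
    proof cases
      case row
      let ?p = "p \<circ> swp i"
      have p': "?p permutes {1..N}" using permutes_swp_comp[OF p row(1,2)] by simp
      have "t ?p * g i = t (?p \<circ> swp i)" by (rule t_mult_g[OF p' row(1,2)]) (use row in simp)
      then have tp: "t p = t ?p * g i" by simp
      have "card (invs N ?p) < card (invs N p)" using invs_comp_swp[OF p row(1,2)] row(4) by simp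
      then have IH: "y * t ?p * x = block_coef rs cs ?p *s (y * t d * x)" using less.hyps p' by blast
      have "y * t p * x = y * t ?p * (g i * x)" by (simp only: tp mult.assoc)
      also have "\<dots> = (u * block_coef rs cs ?p) *s (y * t d * x)"
        by (simp only: x[OF row(1,2,3)] scale_mult_right IH scale_scale)
      also have "u * block_coef rs cs ?p = block_coef rs cs p"
      proof -
        note rsw = rw_swp[OF row(3)]
        have in_iff: "swp i a \<in> {1..N} \<longleftrightarrow> a \<in> {1..N}" for a
          using permutes_in_image[OF swp_permutes[OF row(1,2)]] .
        have tr: "transversal (p \<circ> swp i)" if "transversal p" for p
          unfolding transversal_def comp_def
        proof (intro ballI impI)
          fix a b assume ab: "a \<in> {1..N}" "b \<in> {1..N}" "a \<noteq> b" "rw a = rw b"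
          then have "swp i a \<in> {1..N}" "swp i b \<in> {1..N}" "swp i a \<noteq> swp i b" "rw (swp i a) = rw (swp i b)"
            using in_iff rsw by (blast, blast, metis swp_simps(4), simp)
          with that show "cl (p (swp i a)) \<noteq> cl (p (swp i b))" unfolding transversal_def by blast
        qed
        have iff: "transversal ?p \<longleftrightarrow> transversal p" using tr[of p] tr[of ?p] by auto
        show ?thesis
        proof (cases "transversal p")
          case True
          have "card (row_inv p) = card (row_inv ?p) + 1"
            unfolding row_inv_def
            by (subst invset_comp_swp[OF p row(1,2,4), where R' = "\<lambda>a b. rw a = rw b"])
              (use row rsw in auto)
          \<comment> \<open>Transversality puts both images into different columns, so removing this
            descent affects no column inversion.\<close>
          moreover have "cl (p i) \<noteq> cl (p (Suc i))"
          proof -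
            have "i \<in> {1..N}" "Suc i \<in> {1..N}" "i \<noteq> Suc i" using row by auto
            with True row(3) show ?thesis unfolding transversal_def by blast
          qed
          then have "card (col_inv p) = card (col_inv ?p)"
            unfolding col_inv_def
            by (subst invset_comp_swp[OF p row(1,2,4), where R' = "\<lambda>a b. cl (?p a) = cl (?p b)"]) auto
          ultimately show ?thesis using True iff by (simp add: block_coef_def power_add)
        qed (use iff in \<open>simp add: block_coef_def\<close>)
      qed
      finally show ?thesis .
    next
      case col
      let ?p = "swp i \<circ> p"
      have p': "?p permutes {1..N}" using permutes_swp_comp[OF p col(1,2)] by simp
      have "g i * t ?p = t (swp i \<circ> ?p)"
        by (rule g_mult_t[OF p' col(1,2)]) (use col in \<open>simp add: inv_swp_comp[OF p col(1,2)]\<close>)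
      then have tp: "t p = g i * t ?p" by simp
      have "card (invs N ?p) < card (invs N p)" using invs_swp_comp[OF p col(1,2)] col(4) by simp
      then have IH: "y * t ?p * x = block_coef rs cs ?p *s (y * t d * x)" using less.hyps p' by blast
      have "y * t p * x = (y * g i) * t ?p * x" by (simp only: tp mult.assoc)
      also have "\<dots> = (- inverse u * block_coef rs cs ?p) *s (y * t d * x)"
        by (simp only: y[OF col(1,2,3)] scale_mult_left IH scale_scale)
      also have "- inverse u * block_coef rs cs ?p = block_coef rs cs p"
      proof -
        note csw = cl_swp[OF col(3)]
        have iff: "transversal ?p \<longleftrightarrow> transversal p"
          unfolding transversal_def comp_def csw ..
        show ?thesis
        proof (cases "transversal p")
          case True
          let ?a = "inv' p (Suc i)" and ?b = "inv' p i"
          have ab: "?a \<in> {1..N}" "?b \<in> {1..N}" "?a \<noteq> ?b" using pin(2) col by auto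
          have eq: "cl (p ?a) = cl (p ?b)" using col(3) by (simp add: pp)
          have "rw ?a \<noteq> rw ?b" using True ab eq unfolding transversal_def by blast
          then have "row_inv ?p = row_inv p"
            unfolding row_inv_def invset_swp_comp[OF p col(1,2,4)] by (auto simp: invset_def)
          moreover have "(?a, ?b) \<in> col_inv p"
            using ab eq col by (simp add: col_inv_def invset_def pp)
          moreover have "col_inv ?p = col_inv p - {(?a, ?b)}"
            using invset_swp_comp[OF p col(1,2,4), of "\<lambda>a b. cl (p a) = cl (p b)"]
            by (simp only: col_inv_def comp_apply[of "swp i" p] csw)
          ultimately have "row_inv ?p = row_inv p" "card (col_inv p) = Suc (card (col_inv ?p))"
            using card_Suc_Diff1[of "col_inv p" "(?a, ?b)"] by (simp_all add: col_inv_def)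
          then show ?thesis using True iff by (simp add: block_coef_def)
        qed (use iff in \<open>simp add: block_coef_def\<close>)
      qed
      finally show ?thesis .
    next
      case min
      have r: "row_inv p = {}"
      proof -
        have False if ab: "a \<in> {1..N}" "b \<in> {1..N}" "a < b" "rw a = rw b" "p b < p a" for a b
        proof -
          obtain i where i: "a \<le> i" "i < b" "p (Suc i) < p i" using adjacent_descent[OF ab(3,5)] .
          then have "rw i = rw (Suc i)"
            using rw_mono[of a i] rw_mono[of i "Suc i"] rw_mono[of "Suc i" b] ab by simp
          with min(1)[of i] i ab show False by simp
        qed
        then show ?thesis by (force simp: row_inv_def invset_def)
      qed
      have c: "col_inv p = {}"
      proof -
        have False if ab: "a \<in> {1..N}" "b \<in> {1..N}" "a < b" "cl (p a) = cl (p b)" "p b < p a" for a b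
        proof -
          have "inv' p (p a) < inv' p (p b)" using ab by (simp add: pp)
          then obtain i where i: "p b \<le> i" "i < p a" "inv' p (Suc i) < inv' p i"
            using adjacent_descent[OF ab(5)] by metis
          moreover have "p a \<in> {1..N}" "p b \<in> {1..N}" using pin(1) ab by auto
          ultimately have "cl i = cl (Suc i)"
            using cl_mono[of "p b" i] cl_mono[of i "Suc i"] cl_mono[of "Suc i" "p a"] ab by simp
          with min(2)[of i] i \<open>p a \<in> {1..N}\<close> \<open>p b \<in> {1..N}\<close> show False by simp
        qed
        then show ?thesis by (force simp: col_inv_def invset_def)
      qed
      show ?thesis
      proof (cases "transversal p")
        case True
        then have "p = d" using transversal_eq[OF p _ r c d] by simp
        then show ?thesis using True r c by (simp add: block_coef_def)
      next
        case False
        then obtain a b where "a \<in> {1..N}" "b \<in> {1..N}" "a \<noteq> b" "rw a = rw b" "cl (p a) = cl (p b)"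
          unfolding transversal_def by blast
        then obtain a b where ab: "a \<in> {1..N}" "b \<in> {1..N}" "a < b" "rw a = rw b" "cl (p a) = cl (p b)"
          by (metis nat_neq_iff)
        have aN: "1 \<le> a" "a < N" "Suc a \<in> {1..N}" using ab by auto
        \<comment> \<open>The second position may be moved to \<open>Suc a\<close>: blocks are
          intervals and \<open>p\<close> increases along the row, so all values from
          \<open>p a\<close> to \<open>p (Suc a)\<close> share a column.\<close>
        have rwa: "rw a = rw (Suc a)" using rw_mono[of a "Suc a"] rw_mono[of "Suc a" b] ab by simp
        have lt: "p a < p (Suc a)" using row_inv_empty[OF p r ab(1) aN(3) lessI rwa] .
        have "p (Suc a) \<le> p b"
          using row_inv_empty[OF p r aN(3) ab(2)] ab rwa by (cases "Suc a = b") auto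
        moreover have pin': "p a \<in> {1..N}" "p (Suc a) \<in> {1..N}" "p b \<in> {1..N}" using pin(1) ab aN by blast+
        ultimately have cla: "cl j = cl (p a)" if "p a \<le> j" "j \<le> p (Suc a)" for j
          using cl_mono[of "p a" j] cl_mono[of j "p b"] ab that by simp
        have "p (Suc a) = Suc (p a)"
        proof (rule ccontr)
          assume "p (Suc a) \<noteq> Suc (p a)"
          with lt have v: "Suc (p a) < p (Suc a)" by simp
          \<comment> \<open>A value strictly between the two would come from before \<open>a\<close>
            or after \<open>Suc a\<close> and create a column inversion.\<close>
          define m where "m = inv' p (Suc (p a))"
          have pm: "p m = Suc (p a)" by (simp add: m_def pp)
          have m: "m \<in> {1..N}" unfolding m_def using pin(2) v pin' by simp
          have "\<not> m < a"
            using col_inv_empty[OF p c m ab(1)] pm cla[of "p m"] v by auto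
          moreover have "\<not> Suc a < m"
            using col_inv_empty[OF p c aN(3) m] pm cla[of "p m"] cla[of "p (Suc a)"] v lt by auto
          ultimately have "m = a \<or> m = Suc a" by linarith
          with pm v show False by auto
        qed
        then have comm: "p \<circ> swp a = swp (p a) \<circ> p"
        proof -
          assume *: "p (Suc a) = Suc (p a)"
          have "p (swp a k) = swp (p a) (p k)" for k
            using * pne[of k a] pne[of k "Suc a"] by (cases "k = a \<or> k = Suc a") auto
          then show ?thesis by (simp add: fun_eq_iff)
        qed
        have pa: "1 \<le> p a" "p a < N" using pin' lt by auto
        have Suc_pa: "p (Suc a) = Suc (p a)"
          using fun_cong[OF comm, of a] by simp
        have "t p * g a = t (swp (p a) \<circ> p)" using t_mult_g[OF p aN(1,2) lt] comm by simp
        also have "\<dots> = g (p a) * t p"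
          using g_mult_t[OF p pa] Suc_pa pp(2)[of a] pp(2)[of "Suc a"] by simp
        finally have tg: "t p * g a = g (p a) * t p" .
        \<comment> \<open>The same generator gives \<open>u\<close> when applied to \<open>x\<close>
          and \<open>- inverse u\<close> when carried across \<open>t p\<close> to
          \<open>y\<close>.\<close>
        have "u *s (y * t p * x) = y * t p * (g a * x)"
          by (simp only: x[OF aN(1,2) rwa] scale_mult_right)
        also have "\<dots> = y * (t p * g a) * x" by (simp only: mult.assoc)
        also have "\<dots> = (y * g (p a)) * t p * x" by (simp only: tg mult.assoc)
        also have "\<dots> = (- inverse u) *s (y * t p * x)"
          using y[OF pa] cla[of "Suc (p a)"] Suc_pa by (simp only: scale_mult_left)
        finally have "(u + inverse u) *s (y * t p * x) = 0"
          by (simp only: scale_left_distrib) (simp add: scale_minus_left)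
        moreover have "u + inverse u \<noteq> 0" using u_pos by (simp add: add_pos_pos less_imp_neq[symmetric])
        ultimately show ?thesis using False by (simp add: block_coef_def)
      qed
    qed
  qed
  then show ?thesis by blast
qed

text \<open>As \<open>u\<close> is infinitely large, the sum is dominated by the unique term with the largest power of \<open>u\<close>.\<close>

lemma block_coef_sum_nonzero:
  assumes "readings N rs cs"
  shows "(\<Sum>p\<in>perms N. block_coef rs cs p) \<noteq> 0"
proof
  interpret readings N rs cs by fact
  assume 0: "(\<Sum>p\<in>perms N. block_coef rs cs p) = 0"
  let ?c = "block_coef rs cs" and ?M = "card row_pairs"
  obtain q where q: "q permutes {1..N}" "transversal q" "row_inv q = row_pairs" "col_inv q = {}"
    "\<And>p. p permutes {1..N} \<Longrightarrow> transversal p \<Longrightarrow> row_inv p = row_pairs \<Longrightarrow> col_inv p = {} \<Longrightarrow> p = q"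
    using extremal_transversal by metis
  \<comment> \<open>Any other term lacks a row inversion or has a factor \<open>inverse u\<close>,
    so it falls short by at least one power of \<open>u\<close>.\<close>
  have small: "\<bar>?c p\<bar> * u \<le> u ^ ?M" if "p permutes {1..N}" "p \<noteq> q" for p
  proof (cases "transversal p")
    case True
    have abs: "\<bar>?c p\<bar> = u ^ card (row_inv p) * inverse u ^ card (col_inv p)"
      using True u_pos by (simp add: block_coef_def abs_mult power_abs)
    have le: "card (row_inv p) \<le> ?M" by (rule card_mono[OF finite_row_pairs row_inv_subset])
    have iu: "0 \<le> inverse u" "inverse u \<le> 1" using u_gt_1 by (auto simp: inverse_le_1_iff)
    have "row_inv p \<noteq> row_pairs \<or> col_inv p \<noteq> {}" using q(5)[of p] that True by blast
    then consider "row_inv p \<noteq> row_pairs" | "col_inv p \<noteq> {}" by blast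
    then show ?thesis
    proof cases
      case 1
      then have "card (row_inv p) < ?M"
        using row_inv_subset by (intro psubset_card_mono) auto
      then have "u ^ Suc (card (row_inv p)) \<le> u ^ ?M" using u_gt_1 by (intro power_increasing) auto
      moreover have "inverse u ^ card (col_inv p) \<le> 1" using iu by (rule power_le_one)
      then have "u ^ card (row_inv p) * inverse u ^ card (col_inv p) \<le> u ^ card (row_inv p) * 1"
        using u_pos by (intro mult_left_mono) auto
      then have "\<bar>?c p\<bar> * u \<le> u ^ card (row_inv p) * u" unfolding abs using u_pos by simp
      ultimately show ?thesis by (simp add: mult.commute)
    next
      case 2
      then obtain k where k: "card (col_inv p) = Suc k"
        by (cases "card (col_inv p)") (auto simp: col_inv_def)
      have "\<bar>?c p\<bar> * u = u ^ card (row_inv p) * inverse u ^ k"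
        unfolding abs k using u_pos by (simp add: field_simps)
      also have "\<dots> \<le> u ^ card (row_inv p) * 1"
        using power_le_one[OF iu, of k] u_pos by (intro mult_left_mono) auto
      also have "\<dots> \<le> u ^ ?M" using le u_gt_1 by (simp add: power_increasing)
      finally show ?thesis .
    qed
  next
    case False
    then show ?thesis using u_pos by (simp add: block_coef_def)
  qed
  have "?c q = u ^ ?M" using q(1-4) by (simp add: block_coef_def)
  moreover have "(\<Sum>p\<in>perms N. ?c p) = ?c q + (\<Sum>p\<in>perms N - {q}. ?c p)"
    using q(1) by (intro sum.remove) auto
  ultimately have "(\<Sum>p\<in>perms N - {q}. ?c p) = - (u ^ ?M)" using 0 by (simp add: add_eq_0_iff)
  then have "u ^ ?M = \<bar>\<Sum>p\<in>perms N - {q}. ?c p\<bar>" using u_pos by simp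
  also have "\<dots> \<le> (\<Sum>p\<in>perms N - {q}. \<bar>?c p\<bar>)" by (rule sum_abs)
  finally have "u ^ ?M * u \<le> (\<Sum>p\<in>perms N - {q}. \<bar>?c p\<bar> * u)"
    using u_pos by (simp add: sum_distrib_right[symmetric])
  also have "\<dots> \<le> (\<Sum>p\<in>perms N - {q}. u ^ ?M)" using small by (intro sum_mono) auto
  finally have "u ^ ?M * u \<le> u ^ ?M * of_nat (card (perms N - {q}))" by (simp add: mult.commute)
  then have "u \<le> of_nat (card (perms N - {q}))" using u_pos by (simp add: mult_le_cancel_left)
  with u_large show False by (metis not_le)
qed

end

section \<open>The canonical line\<close>

context type_A_hecke_module
begin

lemma weight_set_weights: "weight_set weights"
proof
  show "\<exists>a. a \<in> weights" by (rule weights_nonempty)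
  show "[] \<notin> weights" using N_pos by (auto simp: weights_def)
qed (fact weights_first weights_not_equal weights_not_zigzag weights_swap)+

text \<open>Both elements come from weights of the same module and the same diagram. They are
  rescaled so as to fix their weight vectors.\<close>

lemma row_and_column_elements:
  obtains y x z c v w where "\<And>h. \<exists>k. y * h * x = k *s z" "y * X * x = c *s z" "c \<noteq> 0"
    "act x v = v" "act y w = w" "v \<noteq> 0" "w \<noteq> 0"
proof -
  obtain rs cs where rc: "map cont rs \<in> weights" "map cont cs \<in> weights" "mset rs = mset cs"
    "sorted_wrt row_less rs" "sorted_wrt col_less cs"
    "\<And>r c r' c'. (r, c) \<in> set rs \<Longrightarrow> r' \<le> r \<Longrightarrow> c' \<le> c \<Longrightarrow> (r', c') \<in> set rs"
    by (rule weight_set.row_and_column_readings[OF weight_set_weights]) (rule that; blast)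
  have len: "length rs = N" "length cs = N" using rc(1,2) by (auto simp: weights_def)
  interpret readings N rs cs
    using rc len by unfold_locales
  obtain x v \<kappa> where x: "\<And>k. k < N \<Longrightarrow> jm k * x = qpow (map cont rs ! k) *s x"
    "\<kappa> \<noteq> 0" "act x v = smul \<kappa> v" "v \<noteq> 0"
    using weight_projector[OF rc(1)] by metis
  obtain y w \<mu> where y: "sig y = y" "\<And>k. k < N \<Longrightarrow> jm k * y = qpow (map cont cs ! k) *s y"
    "\<mu> \<noteq> 0" "act y w = smul \<mu> w" "w \<noteq> 0"
    using weight_projector[OF rc(2)] by metis
  have gx: "g i * x = u *s x" if i: "1 \<le> i" "i < N" "rw i = rw (Suc i)" for i
  proof -
    obtain k where k: "i = Suc k" using i(1) by (cases i) auto
    have "cont (rbox (Suc i)) = cont (rbox i) + 1"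
      using rbox_adjacent[OF i] i(3) by (simp add: cont_def)
    then have e: "jm k * x = qpow (cont (rbox i)) *s x" "jm (Suc k) * x = qpow (cont (rbox i) + 1) *s x"
      using x(1)[of k] x(1)[of "Suc k"] i k len by (simp_all add: rbox_def del: jm.simps)
    show ?thesis unfolding k by (rule adjacent_up[OF _ e]) (use i k in simp)
  qed
  have gy: "y * g i = (- inverse u) *s y" if i: "1 \<le> i" "i < N" "cl i = cl (Suc i)" for i
  proof -
    obtain k where k: "i = Suc k" using i(1) by (cases i) auto
    have "cont (cbox (Suc i)) = cont (cbox i) - 1"
      using cbox_adjacent[OF i] i(3) by (simp add: cont_def)
    then have e: "jm k * y = qpow (cont (cbox i)) *s y" "jm (Suc k) * y = qpow (cont (cbox i) - 1) *s y"
      using y(2)[of k] y(2)[of "Suc k"] i k len by (simp_all add: cbox_def del: jm.simps)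
    \<comment> \<open>\<open>adjacent_down\<close> speaks of left multiplication; as
      \<open>sig\<close> fixes \<open>y\<close>, it transfers the equation to the right.\<close>
    have "g i * y = (- inverse u) *s y" unfolding k by (rule adjacent_down[OF _ e]) (use i k in simp)
    from arg_cong[OF this, of sig] i show ?thesis by (simp only: sig_mult sig_scale y(1) sig_g)
  qed
  obtain z where z: "\<And>p. p permutes {1..N} \<Longrightarrow> y * t p * x = block_coef rs cs p *s z"
    using block_product[OF readings_axioms gx gy] by blast
  let ?x = "inverse \<kappa> *s x" and ?y = "inverse \<mu> *s y" and ?z = "(inverse \<kappa> * inverse \<mu>) *s z"
  have yx: "?y * h * ?x = (inverse \<kappa> * inverse \<mu>) *s (y * h * x)" for h
    by (simp only: scale_mult_left scale_mult_right scale_scale mult.commute)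
  have "\<exists>k. y * h * x = k *s z" for h
  proof (induction h rule: t_induct)
    case (add h h')
    then show ?case by (metis distrib_left distrib_right scale_left_distrib)
  next
    case (scale c h)
    then show ?case by (metis scale_mult_left scale_mult_right scale_scale)
  qed (use z in blast)
  then have 1: "\<exists>k. ?y * h * ?x = k *s ?z" for h
    unfolding yx by (metis scale_left_commute)
  have "y * X * x = (\<Sum>p\<in>perms N. block_coef rs cs p) *s z"
    by (simp add: X_def sum_distrib_left sum_distrib_right z scale_sum_left)
  then have 2: "?y * X * ?x = (\<Sum>p\<in>perms N. block_coef rs cs p) *s ?z"
    unfolding yx by (simp only: scale_left_commute)
  have "act ?x v = v" "act ?y w = w"
    using x(2,3) y(3,4) by (simp_all add: act_scale)
  from that[OF 1 2 block_coef_sum_nonzero[OF readings_axioms] this x(4) y(5)] show ?thesis .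
qed

text \<open>Let \<open>y\<close> be a column element, so that \<open>y E\<close> is a line.  For suitable \<open>h0\<close>, \<open>h1\<close> the operator
  \<open>X h0 y h1\<close> has rank one and fixes \<open>p \<in> X E\<close>; the operators \<open>X h\<close> commute with it on \<open>X E\<close>,
  hence preserve the line through \<open>p\<close>, and since \<open>p\<close> generates \<open>E\<close> this line is all of \<open>X E\<close>.\<close>

lemma range_X: "\<exists>p. p \<noteq> 0 \<and> range (act X) = E.span {p}"
proof -
  obtain y x z c v w where yx: "\<And>h. \<exists>k. y * h * x = k *s z" "y * X * x = c *s z" "c \<noteq> 0"
    and fixed: "act x v = v" "act y w = w" "v \<noteq> 0" "w \<noteq> 0"
    using row_and_column_elements by metis
  have yE: "\<exists>k. act y e = smul k (act z v)" for e
  proof -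
    obtain h where "act h v = e" using cyclic[OF fixed(3)] by metis
    then have "act y e = act (y * h * x) v" by (simp add: act_mult fixed)
    with yx(1)[of h] show ?thesis by (metis act_scale)
  qed
  obtain k where k: "w = smul k (act z v)" using yE[of w] fixed(2) by metis
  with fixed(4) have k0: "k \<noteq> 0" and zv: "act z v \<noteq> 0" by auto
  have yE: "\<exists>k. act y e = smul k w" for e
  proof -
    obtain k' where "act y e = smul k' (act z v)" using yE by blast
    then have "act y e = smul (k' * inverse k) w" using k k0 by simp
    then show ?thesis by blast
  qed
  \<comment> \<open>This excludes XE = 0: already \<open>y * X\<close> sends \<open>v\<close> to a
    nonzero multiple of \<open>act z v\<close>.\<close>
  have "act (y * X * x) v = smul c (act z v)" using yx(2) by (simp add: act_scale)
  then have "act y (act X v) \<noteq> 0" using yx(3) zv by (simp add: act_mult fixed)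
  then have Xv: "act X v \<noteq> 0" by auto
  define p where "p = act X v"
  \<comment> \<open>A cycle is closed: \<open>h1\<close> sends \<open>p\<close> to \<open>w\<close>,
    \<open>y\<close> fixes \<open>w\<close>, \<open>h0\<close> sends \<open>w\<close> to
    \<open>v\<close>, and \<open>X\<close> sends \<open>v\<close> back to \<open>p\<close>.\<close>
  obtain h0 where h0: "act h0 w = v" using cyclic[OF fixed(4)] by metis
  obtain h1 where h1: "act h1 p = w" using cyclic[of p] Xv p_def by metis
  let ?b = "X * (h0 * y * h1)"
  have rank: "\<exists>k. act ?b e = smul k p" for e
  proof -
    obtain k where "act y (act h1 e) = smul k w" using yE by blast
    then have "act ?b e = smul k p" by (simp add: act_mult act_smul h0 p_def)
    then show ?thesis by blast
  qed
  have bp: "act ?b p = p" by (simp only: act_mult h1 fixed(2) h0) (simp only: p_def)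
  \<comment> \<open>Writing \<open>p\<close> as \<open>act X v\<close> supplies the trailing
    \<open>X\<close> with which \<open>X_commute\<close> can interchange \<open>h\<close> and
    \<open>h0 * y * h1\<close>.\<close>
  have line: "\<exists>k. act (X * h) p = smul k p" for h
  proof -
    have "act (X * h) p = act (X * h) (act ?b p)" by (simp only: bp)
    also have "\<dots> = act (X * h * X * (h0 * y * h1) * X) v"
      by (simp only: p_def act_mult)
    also have "\<dots> = act ?b (act (X * h * X) v)"
      unfolding X_commute[of h "h0 * y * h1"] by (simp only: act_mult)
    finally show ?thesis using rank by metis
  qed
  have "range (act X) = E.span {p}"
  proof
    show "range (act X) \<subseteq> E.span {p}"
    proof clarify
      fix e
      obtain h where "act h p = e" using cyclic[of p] Xv p_def by metis
      then have "act X e = act (X * h) p" by (simp add: act_mult)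
      with line[of h] show "act X e \<in> E.span {p}" by (auto simp: E.span_singleton)
    qed
    show "E.span {p} \<subseteq> range (act X)"
      unfolding E.span_singleton p_def by (auto simp: act_smul[symmetric])
  qed
  with Xv show ?thesis by (auto simp: p_def)
qed

end

section \<open>Length and inversions\<close>

lemma swp_transposes: "{transpose i (Suc i) |i. i \<in> {1..n}} = swp ` {1..n}"
  by (auto simp: swp_def)

locale weyl_group_A =
  fixes n :: nat and W :: "('w, 'm) monoid_scheme" and S :: "'w set" and \<phi> :: "'w \<Rightarrow> nat \<Rightarrow> nat"
  assumes grp: "Group.group W" and S_sub: "S \<subseteq> carrier W"
    and iso: "\<phi> \<in> iso W (sym_group (Suc n))"
    and image_S: "\<phi> ` S = swp ` {1..n}"
begin

sublocale Group.group W by (rule grp)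

lemma phi_bij: "bij_betw \<phi> (carrier W) (perms (Suc n))"
  using iso by (simp add: Group.iso_def sym_group_def)

lemma phi_mult: "x \<in> carrier W \<Longrightarrow> y \<in> carrier W \<Longrightarrow> \<phi> (x \<otimes>\<^bsub>W\<^esub> y) = \<phi> x \<circ> \<phi> y"
  using iso by (simp add: Group.iso_def hom_mult sym_group_def) (metis hom_mult sym_group_mult iso Group.iso_iff)

lemma phi_one: "\<phi> \<one>\<^bsub>W\<^esub> = id"
proof -
  have "\<phi> \<one>\<^bsub>W\<^esub> \<circ> \<phi> \<one>\<^bsub>W\<^esub> = \<phi> \<one>\<^bsub>W\<^esub>" using phi_mult[OF one_closed one_closed] by simp
  moreover have "bij (\<phi> \<one>\<^bsub>W\<^esub>)"
    using phi_bij one_closed by (metis bij_betwE mem_Collect_eq permutes_bij)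
  ultimately show ?thesis by (metis bij_is_inj comp_id fun.map_comp inv_o_cancel id_comp)
qed

lemma phi_inj: "x \<in> carrier W \<Longrightarrow> y \<in> carrier W \<Longrightarrow> \<phi> x = \<phi> y \<Longrightarrow> x = y"
  using phi_bij by (auto simp: bij_betw_def inj_on_def)

lemma phi_permutes: "x \<in> carrier W \<Longrightarrow> \<phi> x permutes {1..Suc n}"
  using phi_bij by (auto simp: bij_betw_def)

definition \<psi> :: "(nat \<Rightarrow> nat) \<Rightarrow> 'w" where "\<psi> = inv_into (carrier W) \<phi>"

lemma psi: "p permutes {1..Suc n} \<Longrightarrow> \<psi> p \<in> carrier W" "p permutes {1..Suc n} \<Longrightarrow> \<phi> (\<psi> p) = p"
  "x \<in> carrier W \<Longrightarrow> \<psi> (\<phi> x) = x"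
proof -
  assume p: "p permutes {1..Suc n}"
  then have "p \<in> \<phi> ` carrier W" using phi_bij by (auto simp: bij_betw_def)
  then show "\<psi> p \<in> carrier W" "\<phi> (\<psi> p) = p" by (auto simp: \<psi>_def inv_into_into f_inv_into_f)
next
  assume "x \<in> carrier W"
  then show "\<psi> (\<phi> x) = x" using phi_bij by (simp add: \<psi>_def bij_betw_def)
qed

lemma psi_mult:
  assumes "p permutes {1..Suc n}" "q permutes {1..Suc n}"
  shows "\<psi> p \<otimes>\<^bsub>W\<^esub> \<psi> q = \<psi> (p \<circ> q)"
  using psi assms permutes_compose[OF assms(2,1)]
  by (intro phi_inj) (auto simp: phi_mult)

lemma psi_id: "\<psi> id = \<one>\<^bsub>W\<^esub>"
  using psi(3)[OF one_closed] phi_one by simp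

lemma psi_swp_in_S: "1 \<le> i \<Longrightarrow> i < Suc n \<Longrightarrow> \<psi> (swp i) \<in> S"
proof -
  assume "1 \<le> i" "i < Suc n"
  then have "swp i \<in> \<phi> ` S" unfolding image_S by auto
  then show ?thesis using psi(3) S_sub by auto
qed

text \<open>Each letter creates at most one inversion, which bounds the length from below.\<close>

lemma invs_le_word:
  "set ss \<subseteq> S \<Longrightarrow> foldr (\<otimes>\<^bsub>W\<^esub>) ss \<one>\<^bsub>W\<^esub> \<in> carrier W \<and>
    card (invs (Suc n) (\<phi> (foldr (\<otimes>\<^bsub>W\<^esub>) ss \<one>\<^bsub>W\<^esub>))) \<le> length ss"
proof (induction ss)
  case (Cons s ss)
  let ?w = "foldr (\<otimes>\<^bsub>W\<^esub>) ss \<one>\<^bsub>W\<^esub>"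
  have w: "?w \<in> carrier W" "card (invs (Suc n) (\<phi> ?w)) \<le> length ss" using Cons by auto
  have s: "s \<in> carrier W" using Cons.prems S_sub by auto
  have "\<phi> s \<in> swp ` {1..n}" using Cons.prems image_S by auto
  then obtain i where i: "1 \<le> i" "i < Suc n" "\<phi> s = swp i" by auto
  have c: "card (invs (Suc n) (swp i \<circ> \<phi> ?w)) \<le> Suc (card (invs (Suc n) (\<phi> ?w)))"
    using invs_swp_comp[OF phi_permutes[OF w(1)] i(1,2)] by (simp add: le_diff_conv)
  have eq: "foldr (\<otimes>\<^bsub>W\<^esub>) (s # ss) \<one>\<^bsub>W\<^esub> = s \<otimes>\<^bsub>W\<^esub> ?w" by simp
  show ?case
    unfolding eq phi_mult[OF s w(1)] i(3)
  proof
    show "s \<otimes>\<^bsub>W\<^esub> ?w \<in> carrier W" using s w(1) by simp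
    show "card (invs (Suc n) (swp i \<circ> \<phi> ?w)) \<le> length (s # ss)"
      using order_trans[OF c] w(2) by simp
  qed
qed (simp add: phi_one)

lemma word_exists:
  "p permutes {1..Suc n} \<Longrightarrow>
    \<exists>ss. length ss = card (invs (Suc n) p) \<and> set ss \<subseteq> S \<and> foldr (\<otimes>\<^bsub>W\<^esub>) ss \<one>\<^bsub>W\<^esub> = \<psi> p"
proof (induction "card (invs (Suc n) p)" arbitrary: p rule: less_induct)
  case less
  show ?case
  proof (cases "p = id")
    case True
    then show ?thesis by (intro exI[of _ "[]"]) (simp add: psi_id)
  next
    case False
    obtain i where i: "1 \<le> i" "i < Suc n" "inv' p (Suc i) < inv' p i"
      using permutes_left_descent[OF less.prems False] .
    let ?q = "swp i \<circ> p"
    have q: "?q permutes {1..Suc n}" using permutes_swp_comp[OF less.prems i(1,2)] by simp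
    have c: "card (invs (Suc n) p) = Suc (card (invs (Suc n) ?q))"
      using invs_swp_comp[OF less.prems i(1,2)] i(3) by simp
    then obtain ss where ss: "length ss = card (invs (Suc n) ?q)" "set ss \<subseteq> S"
      "foldr (\<otimes>\<^bsub>W\<^esub>) ss \<one>\<^bsub>W\<^esub> = \<psi> ?q" using less.hyps[OF _ q] by auto
    have "\<psi> (swp i) \<otimes>\<^bsub>W\<^esub> \<psi> ?q = \<psi> p"
      using psi_mult[OF swp_permutes[OF i(1,2)] q] by simp
    with ss c psi_swp_in_S[OF i(1,2)] show ?thesis
      by (intro exI[of _ "\<psi> (swp i) # ss"]) simp
  qed
qed

lemma word_length_psi:
  assumes "p permutes {1..Suc n}"
  shows "word_length W S (\<psi> p) = card (invs (Suc n) p)"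
  unfolding word_length_def
proof (rule Least_equality)
  show "\<exists>ss. length ss = card (invs (Suc n) p) \<and> set ss \<subseteq> S \<and> foldr (\<otimes>\<^bsub>W\<^esub>) ss \<one>\<^bsub>W\<^esub> = \<psi> p"
    by (rule word_exists[OF assms])
next
  fix k assume "\<exists>ss. length ss = k \<and> set ss \<subseteq> S \<and> foldr (\<otimes>\<^bsub>W\<^esub>) ss \<one>\<^bsub>W\<^esub> = \<psi> p"
  then show "card (invs (Suc n) p) \<le> k" using invs_le_word psi(2)[OF assms] by metis
qed

end

text \<open>The order on rational functions goes through leading coefficients, so the indeterminate
  exceeds every constant.\<close>

lemma of_nat_less_indet: "of_nat k < indet_u"
proof -
  have "(of_nat k :: rat poly) < [:0, 1:]"
    unfolding less_poly_def by (simp add: of_nat_poly pos_poly_pCons)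
  then show ?thesis unfolding indet_u_def of_nat_fract by simp
qed

section \<open>Passage from the basis T_w to the normalised basis\<close>

locale hecke_algebra_A = weyl_group_A n W S \<phi> + hecke_algebra W S scale T
  for n :: nat and W :: "('w, 'm) monoid_scheme" and S :: "'w set" and \<phi> :: "'w \<Rightarrow> nat \<Rightarrow> nat"
    and scale :: "ratfun \<Rightarrow> 'h::ring_1 \<Rightarrow> 'h" and T :: "'w \<Rightarrow> 'h"
begin

sublocale V: vector_space scale by (rule vector_space)

abbreviation "len p \<equiv> card (invs (Suc n) p)"

definition t :: "(nat \<Rightarrow> nat) \<Rightarrow> 'h" where
  "t p = scale (indet_u powi (- int (len p))) (T (\<psi> p))"

lemma u_pos: "0 < indet_u" using of_nat_less_indet[of 0] by simp

text \<open>The length rule makes this a left unit on a spanning set; evaluating at 1 identifies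
  it.\<close>

lemma T_one: "T \<one>\<^bsub>W\<^esub> = 1"
proof -
  have "T \<one>\<^bsub>W\<^esub> * h = h" if "h \<in> V.span (T ` carrier W)" for h
    using that
  proof (induction rule: V.span_induct_alt)
    case (step c x y)
    then obtain w where w: "w \<in> carrier W" "x = T w" by auto
    have "word_length W S \<one>\<^bsub>W\<^esub> = 0"
      using word_length_psi[OF permutes_id] by (simp add: psi_id)
    then have "T \<one>\<^bsub>W\<^esub> * x = x" using T_mult[OF one_closed w(1)] w by simp
    with step show ?case by (simp add: distrib_left scale_mult_right)
  qed simp
  from this[of 1] show ?thesis using span_T by simp
qed

lemma len_swp: "1 \<le> i \<Longrightarrow> i < Suc n \<Longrightarrow> len (swp i) = 1"
  using invs_swp_comp(1)[OF permutes_id, of i "Suc n"] by (simp add: One_nat_def)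

lemma T_swp_mult:
  assumes "p permutes {1..Suc n}" "1 \<le> i" "i < Suc n" "inv' p i < inv' p (Suc i)"
  shows "T (\<psi> (swp i)) * T (\<psi> p) = T (\<psi> (swp i \<circ> p))" "len (swp i \<circ> p) = Suc (len p)"
proof -
  note s = swp_permutes[OF assms(2,3)]
  show l: "len (swp i \<circ> p) = Suc (len p)" using invs_swp_comp[OF assms(1-3)] assms(4) by simp
  have "len (swp i) = 1" by (rule len_swp[OF assms(2,3)])
  with l show "T (\<psi> (swp i)) * T (\<psi> p) = T (\<psi> (swp i \<circ> p))"
    using T_mult[OF psi(1)[OF s] psi(1)[OF assms(1)]] psi_mult[OF s assms(1)] word_length_psi s assms(1)
      permutes_swp_comp[OF assms(1-3)] by simp
qed

lemma T_mult_swp: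
  assumes "p permutes {1..Suc n}" "1 \<le> i" "i < Suc n" "p i < p (Suc i)"
  shows "T (\<psi> p) * T (\<psi> (swp i)) = T (\<psi> (p \<circ> swp i))" "len (p \<circ> swp i) = Suc (len p)"
proof -
  note s = swp_permutes[OF assms(2,3)]
  show l: "len (p \<circ> swp i) = Suc (len p)" using invs_comp_swp[OF assms(1-3)] assms(4) by simp
  have "len (swp i) = 1" by (rule len_swp[OF assms(2,3)])
  with l show "T (\<psi> p) * T (\<psi> (swp i)) = T (\<psi> (p \<circ> swp i))"
    using T_mult[OF psi(1)[OF assms(1)] psi(1)[OF s]] psi_mult[OF assms(1) s] word_length_psi s assms(1)
      permutes_swp_comp[OF assms(1-3)] by simp
qed

lemma T_swp_square:
  assumes "1 \<le> i" "i < Suc n"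
  shows "T (\<psi> (swp i)) * T (\<psi> (swp i)) =
    scale (indet_u ^ 2 - 1) (T (\<psi> (swp i))) + scale (indet_u ^ 2) 1"
  using T_quadratic[OF psi_swp_in_S[OF assms]]
  by (simp add: algebra_simps scale_mult_left scale_mult_right V.scale_left_diff_distrib)

lemma t_swp: "1 \<le> i \<Longrightarrow> i < Suc n \<Longrightarrow> t (swp i) = scale (inverse indet_u) (T (\<psi> (swp i)))"
  by (simp add: t_def len_swp power_int_minus)

lemma powi_Suc: "indet_u powi (- int (Suc k)) = inverse indet_u * indet_u powi (- int k)"
  by (simp only: power_int_minus power_int_of_nat power_Suc inverse_mult_distrib)

sublocale A: type_A_hecke scale "Suc n" indet_u t
proof
  show "scale c x * y = scale c (x * y)" for c x y by (rule scale_mult_left)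
  show "x * scale c y = scale c (x * y)" for c x y by (rule scale_mult_right)
  show "of_nat k < indet_u" for k by (rule of_nat_less_indet)
  show "1 \<le> Suc n" by simp
  show "t id = 1" by (simp add: t_def psi_id T_one)
next
  fix p i assume a: "p permutes {1..Suc n}" "1 \<le> i" "i < Suc n"
  show "t (swp i) * t p = t (swp i \<circ> p) +
    (if inv' p (Suc i) < inv' p i then scale (indet_u - inverse indet_u) (t p) else 0)"
  proof (cases "inv' p (Suc i) < inv' p i")
    case False
    then have "inv' p i < inv' p (Suc i)"
      using permutes_inj[OF permutes_inv[OF a(1)]] by (metis injD linorder_neqE_nat n_not_Suc_n)
    note m = T_swp_mult[OF a this]
    have "t (swp i) * t p = scale (inverse indet_u * indet_u powi (- int (len p))) (T (\<psi> (swp i \<circ> p)))"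
      unfolding t_swp[OF a(2,3)] t_def[of p] by (simp only: scale_mult_left scale_mult_right V.scale_scale m(1) mult.commute)
    with False show ?thesis unfolding t_def[of "swp i \<circ> p"] m(2) powi_Suc by simp
  next
    case True
    \<comment> \<open>With \<open>p\<close> written as \<open>swp i\<close> times the shorter
      \<open>?q\<close>, the quadratic relation contributes the coefficients u^2 - 1 and u^2;
      normalising turns them into u - 1/u and 1.\<close>
    let ?q = "swp i \<circ> p"
    have q: "?q permutes {1..Suc n}" using permutes_swp_comp[OF a] by simp
    have "inv' ?q i < inv' ?q (Suc i)" using True by (simp add: inv_swp_comp[OF a])
    note m = T_swp_mult[OF q a(2,3) this, unfolded swp_comp]
    have "T (\<psi> (swp i)) * T (\<psi> p) = (T (\<psi> (swp i)) * T (\<psi> (swp i))) * T (\<psi> ?q)"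
      by (simp add: m(1)[symmetric] mult.assoc)
    also have "\<dots> = scale (indet_u ^ 2 - 1) (T (\<psi> p)) + scale (indet_u ^ 2) (T (\<psi> ?q))"
      by (simp only: T_swp_square[OF a(2,3)] distrib_right scale_mult_left m(1) mult_1_left)
    finally have eq: "T (\<psi> (swp i)) * T (\<psi> p) =
      scale (indet_u ^ 2 - 1) (T (\<psi> p)) + scale (indet_u ^ 2) (T (\<psi> ?q))" .
    let ?c = "indet_u powi (- int (len p))"
    have "t (swp i) * t p = scale (inverse indet_u * ?c) (T (\<psi> (swp i)) * T (\<psi> p))"
      unfolding t_swp[OF a(2,3)] t_def[of p] by (simp only: scale_mult_left scale_mult_right V.scale_scale mult.commute)
    also have "\<dots> = scale (inverse indet_u * ?c * (indet_u ^ 2 - 1)) (T (\<psi> p))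
      + scale (inverse indet_u * ?c * indet_u ^ 2) (T (\<psi> ?q))"
      by (simp only: eq V.scale_right_distrib V.scale_scale)
    also have "inverse indet_u * ?c * (indet_u ^ 2 - 1) = (indet_u - inverse indet_u) * ?c"
      using u_pos by (simp add: field_simps power2_eq_square)
    also have "inverse indet_u * ?c * indet_u ^ 2 = indet_u powi (- int (len ?q))"
      unfolding m(2) powi_Suc using u_pos by (simp add: field_simps power2_eq_square)
    finally show ?thesis using True by (simp add: t_def comp_def)
  qed
  show "t p * t (swp i) = t (p \<circ> swp i) +
    (if p (Suc i) < p i then scale (indet_u - inverse indet_u) (t p) else 0)"
  proof (cases "p (Suc i) < p i")
    case False
    then have "p i < p (Suc i)"
      using permutes_inj[OF a(1)] by (metis injD linorder_neqE_nat n_not_Suc_n)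
    note m = T_mult_swp[OF a this]
    have "t p * t (swp i) = scale (inverse indet_u * indet_u powi (- int (len p))) (T (\<psi> (p \<circ> swp i)))"
      unfolding t_swp[OF a(2,3)] t_def[of p] by (simp only: scale_mult_left scale_mult_right V.scale_scale m(1) mult.commute)
    with False show ?thesis unfolding t_def[of "p \<circ> swp i"] m(2) powi_Suc by simp
  next
    case True
    let ?q = "p \<circ> swp i"
    have q: "?q permutes {1..Suc n}" using permutes_swp_comp[OF a] by simp
    have "?q i < ?q (Suc i)" using True by simp
    note m = T_mult_swp[OF q a(2,3) this, unfolded swp_comp]
    have "T (\<psi> p) * T (\<psi> (swp i)) = T (\<psi> ?q) * (T (\<psi> (swp i)) * T (\<psi> (swp i)))"
      by (simp add: m(1)[symmetric] mult.assoc comp_def)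
    also have "\<dots> = scale (indet_u ^ 2 - 1) (T (\<psi> p)) + scale (indet_u ^ 2) (T (\<psi> ?q))"
      by (simp only: T_swp_square[OF a(2,3)] distrib_left scale_mult_right m(1) mult_1_right)
    finally have eq: "T (\<psi> p) * T (\<psi> (swp i)) =
      scale (indet_u ^ 2 - 1) (T (\<psi> p)) + scale (indet_u ^ 2) (T (\<psi> ?q))" .
    let ?c = "indet_u powi (- int (len p))"
    have "t p * t (swp i) = scale (inverse indet_u * ?c) (T (\<psi> p) * T (\<psi> (swp i)))"
      unfolding t_swp[OF a(2,3)] t_def[of p] by (simp only: scale_mult_left scale_mult_right V.scale_scale mult.commute)
    also have "\<dots> = scale (inverse indet_u * ?c * (indet_u ^ 2 - 1)) (T (\<psi> p))
      + scale (inverse indet_u * ?c * indet_u ^ 2) (T (\<psi> ?q))"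
      by (simp only: eq V.scale_right_distrib V.scale_scale)
    also have "inverse indet_u * ?c * (indet_u ^ 2 - 1) = (indet_u - inverse indet_u) * ?c"
      using u_pos by (simp add: field_simps power2_eq_square)
    also have "inverse indet_u * ?c * indet_u ^ 2 = indet_u powi (- int (len ?q))"
      unfolding m(2) powi_Suc using u_pos by (simp add: field_simps power2_eq_square)
    finally show ?thesis using True by (simp add: t_def comp_def)
  qed
next
  have inj: "inj_on (\<lambda>p. T (\<psi> p)) (perms (Suc n))"
    by (rule inj_onI) (metis inj_T inj_onD mem_Collect_eq psi(1,2))
  have img: "(\<lambda>p. T (\<psi> p)) ` perms (Suc n) = T ` carrier W"
    using psi phi_permutes by (auto intro!: image_eqI)
  have fin: "finite (T ` carrier W)" unfolding img[symmetric] by simp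

  {
    fix f p assume 0: "(\<Sum>p\<in>perms (Suc n). scale (f p) (t p)) = 0" and p: "p permutes {1..Suc n}"
    \<comment> \<open>Independence is stated for a set of vectors, so the coefficients are carried
      over to that set and the power of u in \<open>t p\<close> is absorbed into them.\<close>
    define k where "k v = f (inv_into (perms (Suc n)) (\<lambda>p. T (\<psi> p)) v) *
      indet_u powi (- int (len (inv_into (perms (Suc n)) (\<lambda>p. T (\<psi> p)) v)))" for v
    have k: "k (T (\<psi> p)) = f p * indet_u powi (- int (len p))" if "p \<in> perms (Suc n)" for p
      unfolding k_def using inv_into_f_f[OF inj that] by simp
    have sum_eq: "(\<Sum>v\<in>T ` carrier W. scale (k v) v) = (\<Sum>p\<in>perms (Suc n). scale (f p) (t p))"
      unfolding img[symmetric] sum.reindex[OF inj] comp_def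
      by (rule sum.cong) (auto simp: k t_def)
    have "k (T (\<psi> p)) = 0"
      by (rule V.independentD[OF independent_T fin subset_refl sum_eq[unfolded 0]])
        (use psi(1)[OF p] in simp)
    then show "f p = 0" using k[of p] p u_pos by simp
  }
  fix h
  have "h \<in> V.span (T ` carrier W)" unfolding span_T by simp
  then obtain k where "h = (\<Sum>v\<in>T ` carrier W. scale (k v) v)"
    unfolding V.span_finite[OF fin] by auto
  also have "\<dots> = (\<Sum>p\<in>perms (Suc n). scale (k (T (\<psi> p)) * indet_u powi (int (len p))) (t p))"
    unfolding img[symmetric] sum.reindex[OF inj] comp_def
    by (rule sum.cong) (use u_pos in \<open>auto simp: t_def power_int_minus\<close>)
  finally show "\<exists>f. h = (\<Sum>p\<in>perms (Suc n). scale (f p) (t p))"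
    by (intro exI[of _ "\<lambda>p. k (T (\<psi> p)) * indet_u powi (int (len p))"])
qed

lemma hecke_X_eq: "hecke_X W S scale T = A.X"
proof -
  have "word_length W S x = len (\<phi> x)" if "x \<in> carrier W" for x
    using word_length_psi[OF phi_permutes[OF that]] psi(3)[OF that] by simp
  then have "hecke_X W S scale T = (\<Sum>x\<in>carrier W. t (\<phi> x))"
    unfolding hecke_X_def t_def by (intro sum.cong) (auto simp: psi(3))
  also have "\<dots> = (\<Sum>p\<in>perms (Suc n). t p)"
    by (rule sum.reindex_bij_betw[OF phi_bij])
  finally show ?thesis by (simp only: A.X_def)
qed

end

theorem mainTheorem6:
  fixes n :: nat
    and W :: "('w, 'm) monoid_scheme"
    and S :: "'w set"
    and scale :: "ratfun \<Rightarrow> 'h::ring_1 \<Rightarrow> 'h"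
    and T :: "'w \<Rightarrow> 'h"
    and act :: "'h \<Rightarrow> 'e::ab_group_add \<Rightarrow> 'e"
  assumes "n \<ge> 1"
    and "weyl_type_A n W S"
    and "hecke_algebra W S scale T"
    and "simple_left_module act"
  shows "vector_space.dim (module_scale scale act) (range (act (hecke_X W S scale T))) = 1 \<and>
         module.subspace (module_scale scale act) (range (act (hecke_X W S scale T)))"
proof -
  obtain \<phi> where \<phi>: "Group.group W" "S \<subseteq> carrier W" "\<phi> \<in> iso W (sym_group (Suc n))"
    "\<phi> ` S = swp ` {1..n}"
    using assms(2) unfolding weyl_type_A_def swp_transposes by blast
  interpret hecke_algebra_A n W S \<phi> scale T
    by (intro hecke_algebra_A.intro weyl_group_A.intro \<phi> assms(3))
  have "left_module act" using assms(4) by (simp add: simple_left_module_def)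
  then interpret M: left_module act .
  interpret M: type_A_hecke_module scale "Suc n" indet_u t act
    by unfold_locales (use assms(4) in \<open>auto simp: simple_left_module_def\<close>)
  have smul: "module_scale scale act = M.smul"
    by (simp add: fun_eq_iff module_scale_def M.smul_def)
  obtain p where p: "p \<noteq> 0" "range (act A.X) = M.E.span {p}" using M.range_X by blast
  have "M.E.dim (range (act A.X)) = 1"
    using p M.E.dim_eq_card_independent[of "{p}"] by simp
  moreover have "M.E.subspace (range (act A.X))" unfolding p(2) by (rule M.E.subspace_span)
  ultimately show ?thesis unfolding smul hecke_X_eq by simp
qed

end
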